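(* Let $n\ge3$ and let $x\colon M^n\to\mathbb{R}^{n+1}$ be a locally strongly convex centroaffine hypersurface with positive definite centroaffine metric $h$, difference tensor $K$ and Tchebychev vector field $T$. Assume that $T$ is nowhere zero and that there are smooth functions $\alpha,\beta$ on $M$ such that $$K(T,X)=\alpha X,\qquad X(\alpha)=0\qquad\text{for every }X\perp T,$$ and $$K(T,T)=\beta T.$$ If $\beta=2\alpha$, then $(M,h)$ locally admits a warped-product structure: every point of $M$ has a neighborhood isometric to a warped product $I\times_\rho N$ of an interval $I$ and an $(n-1)$-dimensional Riemannian manifold $N$. No restriction on the $T^\perp$-component $\bar K$ of $K|_{T^\perp\times T^\perp}$ is required.
   Context: All objects are smooth. A centroaffine hypersurface is an immersion $x\colon M^n\to\mathbb{R}^{n+1}$ of an $n$-manifold whose position vector $x$ is everywhere transversal to $x_*(TM)$. With $D$ the standard flat connection of $\mathbb{R}^{n+1}$, the induced connection $\nabla$ and the centroaffine metric $h$ are defined by the centroaffine Gauss formula $$D_Xx_*Y=x_*(\nabla_XY)-h(X,Y)\,\widetilde\varepsilon\,x,\qquad \widetilde\varepsilon\in\{\pm1\}.$$ Locally strongly convex means that $h$ is definite; the sign $\widetilde\varepsilon$ is chosen so that $h$ is positive definite. Let $\widehat\nabla$ be the Levi-Civita connection of $h$. The difference tensor is $K(X,Y)=\nabla_XY-\widehat\nabla_XY$, and the Tchebychev vector field is $T=\frac1n\operatorname{tr}_hK=\frac1n\sum_{i=1}^nK(e_i,e_i)$ for any local $h$-orthonormal frame $e_1,\ldots,e_n$.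 Orthogonality $\perp$ is with respect to $h$. For $X,Y\in T^\perp$, $\bar K(X,Y)$ denotes the $T^\perp$-component of $K(X,Y)$. The warped product $I\times_\rho N$ is the product manifold $I\times N$ with the metric $dt^2+\rho(t)^2g_N$, where $\rho>0$ is a smooth function on $I$ and $g_N$ is a Riemannian metric on $N$. *)

theory Defs
  imports "HOL-Analysis.Analysis"
begin

section \<open>Smooth manifolds\<close>

(* Intended for open S only: frechet_derivative is the derivative "at x", not "within S". *)
primrec Ck_on :: "nat \<Rightarrow> 'a::euclidean_space set \<Rightarrow> ('a \<Rightarrow> 'b::real_normed_vector) \<Rightarrow> bool" where
  "Ck_on 0 S f \<longleftrightarrow> continuous_on S f"
| "Ck_on (Suc k) S f \<longleftrightarrow> (\<forall>x\<in>S. f differentiable (at x)) \<and>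
     (\<forall>v. Ck_on k S (\<lambda>x. frechet_derivative f (at x) v))"

definition smooth_on :: "'a::euclidean_space set \<Rightarrow> ('a \<Rightarrow> 'b::real_normed_vector) \<Rightarrow> bool" where
  "smooth_on S f \<longleftrightarrow> (\<forall>k. Ck_on k S f)"

(* A chart (U, \<phi>) is a map \<phi> on the open set U; the values of \<phi> off U are irrelevant. *)
type_synonym ('m, 'a) chart = "'m set \<times> ('m \<Rightarrow> 'a)"

record ('m, 'a) manifold =
  mtop :: "'m topology"
  charts :: "('m, 'a) chart set"

(* The dimension is DIM('a).  The atlas need not be maximal. *)
definition smooth_manifold :: "('m, 'a::euclidean_space) manifold \<Rightarrow> bool" where
  "smooth_manifold M \<longleftrightarrow>
     Hausdorff_space (mtop M) \<and> second_countable (mtop M) \<and>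
     topspace (mtop M) = (\<Union>(U, \<phi>)\<in>charts M. U) \<and>
     (\<forall>(U, \<phi>)\<in>charts M. openin (mtop M) U \<and> open (\<phi> ` U) \<and>
        homeomorphic_map (subtopology (mtop M) U) (top_of_set (\<phi> ` U)) \<phi>) \<and>
     (\<forall>(U, \<phi>)\<in>charts M. \<forall>(V, \<psi>)\<in>charts M.
        smooth_on (\<phi> ` (U \<inter> V)) (\<psi> \<circ> inv_into U \<phi>))"

(* Intended for open W; f is only inspected on W. *)
definition smooth_fun_on ::
  "('m, 'a::euclidean_space) manifold \<Rightarrow> 'm set \<Rightarrow> ('m \<Rightarrow> 'b::real_normed_vector) \<Rightarrow> bool" where
  "smooth_fun_on M W f \<longleftrightarrow>
     (\<forall>(U, \<phi>)\<in>charts M. smooth_on (\<phi> ` (U \<inter> W)) (f \<circ> inv_into U \<phi>))"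

definition smooth_at ::
  "('m, 'a::euclidean_space) manifold \<Rightarrow> 'm \<Rightarrow> ('m \<Rightarrow> 'b::real_normed_vector) \<Rightarrow> bool" where
  "smooth_at M p f \<longleftrightarrow> (\<exists>W. openin (mtop M) W \<and> p \<in> W \<and> smooth_fun_on M W f)"

definition smooth_map ::
  "('m, 'a::euclidean_space) manifold \<Rightarrow> ('n, 'b::euclidean_space) manifold \<Rightarrow> ('m \<Rightarrow> 'n) \<Rightarrow> bool" where
  "smooth_map M N F \<longleftrightarrow> continuous_map (mtop M) (mtop N) F \<and>
     (\<forall>(U, \<phi>)\<in>charts M. \<forall>(V, \<psi>)\<in>charts N.
        smooth_on (\<phi> ` (U \<inter> F -` V)) (\<psi> \<circ> F \<circ> inv_into U \<phi>))"

definition diffeomorphism ::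
  "('m, 'a::euclidean_space) manifold \<Rightarrow> ('n, 'b::euclidean_space) manifold \<Rightarrow> ('m \<Rightarrow> 'n) \<Rightarrow> bool" where
  "diffeomorphism M N F \<longleftrightarrow> smooth_map M N F \<and>
     (\<exists>G. smooth_map N M G \<and> (\<forall>p\<in>topspace (mtop M). G (F p) = p) \<and>
          (\<forall>q\<in>topspace (mtop N). F (G q) = q))"

definition open_submanifold :: "('m, 'a) manifold \<Rightarrow> 'm set \<Rightarrow> ('m, 'a) manifold" where
  "open_submanifold M W =
     \<lparr>mtop = subtopology (mtop M) W, charts = (\<lambda>(U, \<phi>). (U \<inter> W, \<phi>)) ` charts M\<rparr>"

definition product_manifold ::
  "('m, 'a) manifold \<Rightarrow> ('n, 'b) manifold \<Rightarrow> ('m \<times> 'n, 'a \<times> 'b) manifold" where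
  "product_manifold M N =
     \<lparr>mtop = prod_topology (mtop M) (mtop N),
      charts = {(U \<times> V, map_prod \<phi> \<psi>) | U \<phi> V \<psi>. (U, \<phi>) \<in> charts M \<and> (V, \<psi>) \<in> charts N}\<rparr>"

definition euclidean_open_manifold :: "'a::euclidean_space set \<Rightarrow> ('a, 'a) manifold" where
  "euclidean_open_manifold S = \<lparr>mtop = top_of_set S, charts = {(S, id)}\<rparr>"


section \<open>Tangent vectors, vector fields, metrics and connections\<close>

(* A tangent vector at p is a derivation on real functions that are smooth near p.  It is
   extended by 0 to all other functions, so that it is a unique element of a HOL type that
   mentions neither p nor a chart.  Linear combinations are taken pointwise. *)
type_synonym 'm tvec = "('m \<Rightarrow> real) \<Rightarrow> real"
type_synonym 'm vfield = "'m \<Rightarrow> 'm tvec"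

definition coord_tvec ::
  "('m, 'a::euclidean_space) manifold \<Rightarrow> ('m, 'a) chart \<Rightarrow> 'm \<Rightarrow> 'a \<Rightarrow> 'm tvec" where
  "coord_tvec M c p v = (\<lambda>f. if smooth_at M p f
     then frechet_derivative (f \<circ> inv_into (fst c) (snd c)) (at (snd c p)) v else 0)"

definition tangent_space :: "('m, 'a::euclidean_space) manifold \<Rightarrow> 'm \<Rightarrow> 'm tvec set" where
  "tangent_space M p = {coord_tvec M c p v | c v. c \<in> charts M \<and> p \<in> fst c}"

definition pushforward ::
  "('n, 'b::euclidean_space) manifold \<Rightarrow> ('m \<Rightarrow> 'n) \<Rightarrow> 'm \<Rightarrow> 'm tvec \<Rightarrow> 'n tvec" where
  "pushforward N F p v = (\<lambda>f. if smooth_at N (F p) f then v (f \<circ> F) else 0)"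

(* The flat directional derivative D_v Z of a vector-valued function Z. *)
definition flat_deriv :: "'m tvec \<Rightarrow> ('m \<Rightarrow> 'e::euclidean_space) \<Rightarrow> 'e" where
  "flat_deriv v Z = (\<Sum>b\<in>Basis. v (\<lambda>q. Z q \<bullet> b) *\<^sub>R b)"

definition vector_field_on ::
  "('m, 'a::euclidean_space) manifold \<Rightarrow> 'm set \<Rightarrow> 'm vfield \<Rightarrow> bool" where
  "vector_field_on M W X \<longleftrightarrow> (\<forall>p\<in>W. X p \<in> tangent_space M p) \<and>
     (\<forall>W' f. openin (mtop M) W' \<and> W' \<subseteq> W \<and> smooth_fun_on M W' f
        \<longrightarrow> smooth_fun_on M W' (\<lambda>p. X p f))"

(* The outer test is needed: X (Y f) may be nonzero at p although f is not smooth near p. *)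
definition lie_bracket ::
  "('m, 'a::euclidean_space) manifold \<Rightarrow> 'm vfield \<Rightarrow> 'm vfield \<Rightarrow> 'm vfield" where
  "lie_bracket M X Y = (\<lambda>p f. if smooth_at M p f
     then X p (\<lambda>q. Y q f) - Y p (\<lambda>q. X q f) else 0)"

(* A metric at p is only meaningful on tangent vectors at p. *)
type_synonym 'm metric_tensor = "'m \<Rightarrow> 'm tvec \<Rightarrow> 'm tvec \<Rightarrow> real"

definition positive_definite_metric ::
  "('m, 'a::euclidean_space) manifold \<Rightarrow> 'm metric_tensor \<Rightarrow> bool" where
  "positive_definite_metric M g \<longleftrightarrow>
     (\<forall>p\<in>topspace (mtop M). \<forall>v\<in>tangent_space M p. v \<noteq> (\<lambda>f. 0) \<longrightarrow> g p v v > 0)"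

definition riemannian_metric ::
  "('m, 'a::euclidean_space) manifold \<Rightarrow> 'm metric_tensor \<Rightarrow> bool" where
  "riemannian_metric M g \<longleftrightarrow>
     (\<forall>p\<in>topspace (mtop M). \<forall>u\<in>tangent_space M p. \<forall>v\<in>tangent_space M p. \<forall>w\<in>tangent_space M p. \<forall>a b.
        g p u v = g p v u \<and> g p (\<lambda>f. a * u f + b * v f) w = a * g p u w + b * g p v w) \<and>
     positive_definite_metric M g \<and>
     (\<forall>W X Y. openin (mtop M) W \<and> vector_field_on M W X \<and> vector_field_on M W Y
        \<longrightarrow> smooth_fun_on M W (\<lambda>p. g p (X p) (Y p)))"

(* Connections act on locally defined vector fields.  Locality is a consequence: if Z vanishes
   near p, then Z = fZ for a function f which is 0 near p and 1 elsewhere. *)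
type_synonym 'm connection_op = "'m vfield \<Rightarrow> 'm vfield \<Rightarrow> 'm vfield"

definition affine_connection ::
  "('m, 'a::euclidean_space) manifold \<Rightarrow> 'm connection_op \<Rightarrow> bool" where
  "affine_connection M nabla \<longleftrightarrow>
     (\<forall>W X X' Y Y' f. openin (mtop M) W \<and> vector_field_on M W X \<and> vector_field_on M W X' \<and>
        vector_field_on M W Y \<and> vector_field_on M W Y' \<and> smooth_fun_on M W f \<longrightarrow>
        vector_field_on M W (nabla X Y) \<and>
        (\<forall>p\<in>W.
          nabla (\<lambda>q k. X q k + X' q k) Y p = (\<lambda>k. nabla X Y p k + nabla X' Y p k) \<and>
          nabla (\<lambda>q k. f q * X q k) Y p = (\<lambda>k. f p * nabla X Y p k) \<and>
          nabla X (\<lambda>q k. Y q k + Y' q k) p = (\<lambda>k. nabla X Y p k + nabla X Y' p k) \<and>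
          nabla X (\<lambda>q k. f q * Y q k) p = (\<lambda>k. X p f * Y p k + f p * nabla X Y p k)))"

definition levi_civita ::
  "('m, 'a::euclidean_space) manifold \<Rightarrow> 'm metric_tensor \<Rightarrow> 'm connection_op \<Rightarrow> bool" where
  "levi_civita M g nabla \<longleftrightarrow> affine_connection M nabla \<and>
     (\<forall>W X Y Z. openin (mtop M) W \<and> vector_field_on M W X \<and> vector_field_on M W Y \<and>
        vector_field_on M W Z \<longrightarrow>
        (\<forall>p\<in>W.
          (\<lambda>k. nabla X Y p k - nabla Y X p k) = lie_bracket M X Y p \<and>
          X p (\<lambda>q. g q (Y q) (Z q)) = g p (nabla X Y p) (Z p) + g p (Y p) (nabla X Z p)))"

definition isometry ::
  "('m, 'a::euclidean_space) manifold \<Rightarrow> 'm metric_tensor \<Rightarrow>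
   ('n, 'b::euclidean_space) manifold \<Rightarrow> 'n metric_tensor \<Rightarrow> ('m \<Rightarrow> 'n) \<Rightarrow> bool" where
  "isometry M g N h F \<longleftrightarrow> diffeomorphism M N F \<and>
     (\<forall>p\<in>topspace (mtop M). \<forall>v\<in>tangent_space M p. \<forall>w\<in>tangent_space M p.
        h (F p) (pushforward N F p v) (pushforward N F p w) = g p v w)"

(* The metric dt^2 + \<rho>(t)^2 g_N; here dt(v) = v fst, as fst is the function t on I \<times> N. *)
definition warped_metric ::
  "('n, 'b::euclidean_space) manifold \<Rightarrow> 'n metric_tensor \<Rightarrow> (real \<Rightarrow> real) \<Rightarrow>
   (real \<times> 'n) metric_tensor" where
  "warped_metric N gN \<rho> = (\<lambda>z v w. v fst * w fst +
     (\<rho> (fst z))\<^sup>2 * gN (snd z) (pushforward N snd z v) (pushforward N snd z w))"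


section \<open>Centroaffine hypersurfaces\<close>

definition centroaffine_hypersurface ::
  "('m, 'a::euclidean_space) manifold \<Rightarrow> ('m \<Rightarrow> 'e::euclidean_space) \<Rightarrow> bool" where
  "centroaffine_hypersurface M x \<longleftrightarrow> DIM('e) = DIM('a) + 1 \<and>
     smooth_fun_on M (topspace (mtop M)) x \<and>
     (\<forall>p\<in>topspace (mtop M).
        (\<forall>v\<in>tangent_space M p. flat_deriv v x = 0 \<longrightarrow> v = (\<lambda>f. 0)) \<and>
        (\<forall>v\<in>tangent_space M p. flat_deriv v x \<noteq> x p))"

(* The centroaffine Gauss formula.  For a centroaffine hypersurface x it determines nabla
   and h (on local vector fields and on tangent vectors, respectively). *)
definition centroaffine_gauss ::
  "('m, 'a::euclidean_space) manifold \<Rightarrow> ('m \<Rightarrow> 'e::euclidean_space) \<Rightarrow> real \<Rightarrow>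
   'm connection_op \<Rightarrow> 'm metric_tensor \<Rightarrow> bool" where
  "centroaffine_gauss M x \<epsilon> nabla h \<longleftrightarrow>
     (\<forall>W X Y. openin (mtop M) W \<and> vector_field_on M W X \<and> vector_field_on M W Y \<longrightarrow>
        (\<forall>p\<in>W. nabla X Y p \<in> tangent_space M p \<and>
          flat_deriv (X p) (\<lambda>q. flat_deriv (Y q) x) =
            flat_deriv (nabla X Y p) x - (h p (X p) (Y p) * \<epsilon>) *\<^sub>R x p))"

definition difference_tensor :: "'m connection_op \<Rightarrow> 'm connection_op \<Rightarrow> 'm connection_op" where
  "difference_tensor nabla lc = (\<lambda>X Y p f. nabla X Y p f - lc X Y p f)"

definition orthonormal_frame_on ::
  "('m, 'a::euclidean_space) manifold \<Rightarrow> 'm metric_tensor \<Rightarrow> 'm set \<Rightarrow> (nat \<Rightarrow> 'm vfield) \<Rightarrow> bool" where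
  "orthonormal_frame_on M h W e \<longleftrightarrow>
     (\<forall>i<DIM('a). vector_field_on M W (e i)) \<and>
     (\<forall>p\<in>W. \<forall>i<DIM('a). \<forall>j<DIM('a). h p (e i p) (e j p) = (if i = j then 1 else 0))"

(* T is the Tchebychev vector field of K with respect to h. *)
definition tchebychev_field ::
  "('m, 'a::euclidean_space) manifold \<Rightarrow> 'm metric_tensor \<Rightarrow> 'm connection_op \<Rightarrow> 'm vfield \<Rightarrow> bool" where
  "tchebychev_field M h K T \<longleftrightarrow> vector_field_on M (topspace (mtop M)) T \<and>
     (\<forall>W e. openin (mtop M) W \<and> orthonormal_frame_on M h W e \<longrightarrow>
        (\<forall>p\<in>W. T p = (\<lambda>f. (\<Sum>i<DIM('a). K (e i) (e i) p f) / real DIM('a))))"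

end

theory Submission
  imports Defs
begin

text \<open>
  The trace of K(T,-) gives \<alpha> = n/(n+1) h(T,T), and the Codazzi equation for K, which comes from the
  flatness of the ambient connection, makes T a closed field. Since \<alpha> is constant orthogonally to T
  and \<beta> = 2\<alpha>, the Codazzi equation with one entry T forces h(T,T) to be constant and T to be geodesic;
  it also shows that K commutes with the shape operator S = (Levi-Civita derivative of T) on the complement of T.
  Hence K is block diagonal and trace-free on each eigenspace of S there, and the trace of the Codazzi
  equation over two eigenspaces yields that their eigenvalues agree: S is a multiple \<mu> of the
  identity on the complement of T. Symmetry of the second derivatives of x_*(T) then
  determines d\<mu>, and a suitable combination \<xi> of x_*(T) and x has constant direction. A primitive t of the form
  dual to T/|T|, together with the coordinates y of x modulo that direction, is a chart
  in which T is a multiple of d/dt and h = dt^2 + \<rho>(t)^2 g(y).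
\<close>

section \<open>Smooth functions on open sets\<close>

text \<open>The obstacle is that nothing is known about K on the complement of T, so every term
  involving it has to disappear. Commutation with S confines it to the eigenspaces of S, and the
  vanishing of its traces removes it after summation. The condition \<beta> = 2\<alpha> enters
  through one cancellation: for a unit vector z orthogonal to T, the Levi-Civita derivative of the
  cubic form along z with entries T, T, z is (\<beta> - 2\<alpha>) h(S z, z), hence zero, while the
  Codazzi equation identifies it with a positive multiple of h(S T, T). The field \<xi> = x_*(T) - m
  x arises because across T the derivative of x_*(T) is m times that of x, so that subtracting m x
  leaves a derivative along T only. Since T x = \<xi> + m x, an integral curve of T stays in the
  plane spanned by x and the constant direction of \<xi>. A linear projection along \<xi>, followed
  by passage to rays, is therefore constant on these curves and supplies the remaining coordinates
  without the flow of T or a Frobenius argument.\<close>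

abbreviation D :: "('a::real_normed_vector \<Rightarrow> 'b::real_normed_vector) \<Rightarrow> 'a \<Rightarrow> 'a \<Rightarrow> 'b" where
  "D f u \<equiv> frechet_derivative f (at u)"

lemma D_eqI: "(f has_derivative f') (at u) \<Longrightarrow> D f u = f'"
  by (metis frechet_derivative_at)

lemma D_cong:
  assumes "open S" "u \<in> S" "\<And>x. x \<in> S \<Longrightarrow> f x = g x"
  shows "D f u = D g u"
proof -
  have "(f has_derivative f') (at u) \<longleftrightarrow> (g has_derivative f') (at u)" for f'
    using assms by (metis has_derivative_transform_within_open)
  then show ?thesis by (simp add: frechet_derivative_def)
qed

lemma Ck_on_subset: "Ck_on k S f \<Longrightarrow> S' \<subseteq> S \<Longrightarrow> Ck_on k S' f"
  by (induction k arbitrary: f) (auto intro: continuous_on_subset)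

lemma Ck_on_cong:
  assumes "open S" "\<And>x. x \<in> S \<Longrightarrow> f x = g x" "Ck_on k S f"
  shows "Ck_on k S g"
  using assms(2,3)
proof (induction k arbitrary: f g)
  case 0
  then show ?case by (simp cong: continuous_on_cong)
next
  case (Suc k)
  have eq: "D f x = D g x" if "x \<in> S" for x
    by (rule D_cong[OF assms(1) that Suc.prems(1)])
  have "g differentiable (at x)" if "x \<in> S" for x
  proof -
    have "(f has_derivative D f x) (at x)"
      using Suc.prems(2) that by (simp add: frechet_derivative_works)
    then show ?thesis
      using has_derivative_transform_within_open[OF _ assms(1) that] Suc.prems(1)
      by (metis differentiableI)
  qed
  moreover have "Ck_on k S (\<lambda>x. D g x v)" for v
    by (rule Suc.IH[of "\<lambda>x. D f x v"]) (use Suc.prems(2) in \<open>auto simp: eq\<close>)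
  ultimately show ?case by simp
qed

lemma Ck_on_SucI:
  assumes "open S" "\<And>x. x \<in> S \<Longrightarrow> (f has_derivative f' x) (at x)"
    "\<And>v. Ck_on k S (\<lambda>x. f' x v)"
  shows "Ck_on (Suc k) S f"
proof -
  have "Ck_on k S (\<lambda>x. D f x v)" for v
    by (rule Ck_on_cong[OF assms(1) _ assms(3)[of v]]) (simp add: D_eqI[OF assms(2)])
  then show ?thesis using assms(2) by (auto intro: differentiableI)
qed

lemma Ck_on_Suc_has_derivative:
  "Ck_on (Suc k) S f \<Longrightarrow> x \<in> S \<Longrightarrow> (f has_derivative D f x) (at x)"
  by (simp add: frechet_derivative_works)

lemma Ck_on_SucD: "Ck_on (Suc k) S f \<Longrightarrow> Ck_on k S f"
proof (induction k arbitrary: f)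
  case 0
  then show ?case
    by (auto intro!: continuous_at_imp_continuous_on differentiable_imp_continuous_within)
next
  case (Suc k)
  then show ?case by (metis Ck_on.simps(2))
qed

lemma Ck_on_continuous: "Ck_on k S f \<Longrightarrow> continuous_on S f"
  by (induction k) (auto dest: Ck_on_SucD simp del: Ck_on.simps(2))

lemma Ck_on_const: "open S \<Longrightarrow> Ck_on k S (\<lambda>x. c)"
proof (induction k arbitrary: c)
  case (Suc k)
  then show ?case by (intro Ck_on_SucI[where f' = "\<lambda>x v. 0"]) auto
qed auto

lemma Ck_on_linear:
  assumes "bounded_linear A" "open S" "Ck_on k S f"
  shows "Ck_on k S (\<lambda>x. A (f x))"
  using assms(3)
proof (induction k arbitrary: f)
  case 0
  then show ?case using assms by (simp add: bounded_linear.continuous_on)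
next
  case (Suc k)
  show ?case
    by (rule Ck_on_SucI[where f' = "\<lambda>x v. A (D f x v)"])
      (use Suc assms in \<open>auto intro: bounded_linear.has_derivative simp: frechet_derivative_works\<close>)
qed

lemma Ck_on_id: "open S \<Longrightarrow> Ck_on k S (\<lambda>x. x)"
proof (cases k)
  case (Suc k')
  then show "open S \<Longrightarrow> ?thesis"
    by (auto intro!: Ck_on_SucI[where f' = "\<lambda>x v. v"] Ck_on_const simp del: Ck_on.simps(2))
qed auto

lemma Ck_on_add:
  assumes "open S" "Ck_on k S f" "Ck_on k S g"
  shows "Ck_on k S (\<lambda>x. f x + g x)"
  using assms(2,3)
proof (induction k arbitrary: f g)
  case 0
  then show ?case by (simp add: continuous_on_add)
next
  case (Suc k)
  show ?case
    by (rule Ck_on_SucI[where f' = "\<lambda>x v. D f x v + D g x v"])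
      (use Suc assms in \<open>auto intro: has_derivative_add simp: frechet_derivative_works\<close>)
qed

lemma Ck_on_bilinear:
  assumes "bounded_bilinear pr" "open S" "Ck_on k S f" "Ck_on k S g"
  shows "Ck_on k S (\<lambda>x. pr (f x) (g x))"
  using assms(3,4)
proof (induction k arbitrary: f g)
  case 0
  then show ?case by (simp add: bounded_bilinear.continuous_on[OF assms(1)])
next
  case (Suc k)
  show ?case
  proof (rule Ck_on_SucI[where f' = "\<lambda>x v. pr (f x) (D g x v) + pr (D f x v) (g x)"])
    show "((\<lambda>x. pr (f x) (g x)) has_derivative (\<lambda>v. pr (f x) (D g x v) + pr (D f x v) (g x))) (at x)"
      if "x \<in> S" for x
      using Suc.prems that
      by (intro bounded_bilinear.FDERIV[OF assms(1)]) (simp_all add: frechet_derivative_works)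
    show "Ck_on k S (\<lambda>x. pr (f x) (D g x v) + pr (D f x v) (g x))" for v
      using Suc.prems Ck_on_SucD[of k S f] Ck_on_SucD[of k S g]
      by (intro Ck_on_add Suc.IH assms) auto
  qed (rule assms)
qed

lemma Ck_on_sum:
  assumes "open S" "\<And>i. i \<in> I \<Longrightarrow> Ck_on k S (f i)"
  shows "Ck_on k S (\<lambda>x. \<Sum>i\<in>I. f i x)"
  using assms(2)
proof (induction I rule: infinite_finite_induct)
  case (insert i I)
  then show ?case by (simp add: Ck_on_add assms(1))
qed (simp_all add: Ck_on_const assms(1))

lemma linear_sum_Basis:
  fixes A :: "'a::euclidean_space \<Rightarrow> 'b::real_vector"
  assumes "linear A"
  shows "A v = (\<Sum>b\<in>Basis. (v \<bullet> b) *\<^sub>R A b)"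
proof -
  have "A v = A (\<Sum>b\<in>Basis. (v \<bullet> b) *\<^sub>R b)" by (simp add: euclidean_representation)
  then show ?thesis by (simp add: linear_sum[OF assms] linear_scale[OF assms])
qed

text \<open>Tensors are handled as functions \<open>B u v\<close> known to be smooth for each fixed
  v. Expanding the argument in \<open>Basis\<close> carries this over to an argument that moves with
  the base point.\<close>

lemma Ck_on_linear_field:
  fixes a :: "'a::euclidean_space \<Rightarrow> 'c::euclidean_space"
  assumes "open S" "\<And>u. u \<in> S \<Longrightarrow> linear (B u)" "\<And>v. Ck_on k S (\<lambda>u. B u v)" "Ck_on k S a"
  shows "Ck_on k S (\<lambda>u. B u (a u))"
proof (rule Ck_on_cong[OF assms(1)])
  show "Ck_on k S (\<lambda>u. \<Sum>b\<in>Basis. (a u \<bullet> b) *\<^sub>R B u b)"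
    using assms
    by (intro Ck_on_sum Ck_on_bilinear[OF bounded_bilinear_scaleR]
        Ck_on_linear[OF bounded_linear_inner_left])
  show "u \<in> S \<Longrightarrow> (\<Sum>b\<in>Basis. (a u \<bullet> b) *\<^sub>R B u b) = B u (a u)" for u
    using linear_sum_Basis[OF assms(2)[of u], of "a u"] by simp
qed

lemma Ck_on_compose:
  fixes f :: "'a::euclidean_space \<Rightarrow> 'c::euclidean_space"
  assumes "open S" "open S'" "f ` S \<subseteq> S'" "Ck_on k S f" "Ck_on k S' g"
  shows "Ck_on k S (\<lambda>x. g (f x))"
  using assms(4,5)
proof (induction k arbitrary: g)
  case 0
  then show ?case using assms(3) by (simp add: continuous_on_compose2)
next
  case (Suc k)
  have dg: "(g has_derivative D g (f x)) (at (f x))" if "x \<in> S" for x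
    using Suc.prems(2) assms(3) that by (auto simp: frechet_derivative_works)
  show ?case
  proof (rule Ck_on_SucI[where f' = "\<lambda>x v. D g (f x) (D f x v)"])
    show "((\<lambda>x. g (f x)) has_derivative (\<lambda>v. D g (f x) (D f x v))) (at x)" if "x \<in> S" for x
      using has_derivative_compose[OF Ck_on_Suc_has_derivative[OF Suc.prems(1) that] dg[OF that]] .
    show "Ck_on k S (\<lambda>x. D g (f x) (D f x v))" for v
    proof (rule Ck_on_linear_field[OF assms(1)])
      show "linear (D g (f x))" if "x \<in> S" for x
        using dg[OF that] by (rule has_derivative_linear)
      show "Ck_on k S (\<lambda>x. D g (f x) w)" for w
        using Suc.prems Ck_on_SucD[of k S f] by (intro Suc.IH) auto
    qed (use Suc.prems in auto)
  qed (rule assms)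
qed

lemma smooth_on_subset: "smooth_on S f \<Longrightarrow> S' \<subseteq> S \<Longrightarrow> smooth_on S' f"
  by (meson Ck_on_subset smooth_on_def)

lemma smooth_on_cong:
  "smooth_on S f \<Longrightarrow> open S \<Longrightarrow> (\<And>x. x \<in> S \<Longrightarrow> f x = g x) \<Longrightarrow> smooth_on S g"
  using Ck_on_cong[of S f g] unfolding smooth_on_def by blast

lemma smooth_on_has_derivative:
  "smooth_on S f \<Longrightarrow> x \<in> S \<Longrightarrow> (f has_derivative D f x) (at x)"
  using Ck_on_Suc_has_derivative smooth_on_def by blast

lemma smooth_on_differentiable: "smooth_on S f \<Longrightarrow> x \<in> S \<Longrightarrow> f differentiable (at x)"
  using differentiableI smooth_on_has_derivative by blast

lemma smooth_on_linear_D: "smooth_on S f \<Longrightarrow> x \<in> S \<Longrightarrow> linear (D f x)"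
  by (meson has_derivative_linear smooth_on_has_derivative)

lemma smooth_on_continuous: "smooth_on S f \<Longrightarrow> continuous_on S f"
  using Ck_on_continuous smooth_on_def by blast

lemma smooth_on_D: "smooth_on S f \<Longrightarrow> smooth_on S (\<lambda>u. D f u v)"
  unfolding smooth_on_def by (metis Ck_on.simps(2))

lemma smooth_onI:
  assumes "open S" "\<And>x. x \<in> S \<Longrightarrow> (f has_derivative f' x) (at x)"
    "\<And>v. smooth_on S (\<lambda>x. f' x v)"
  shows "smooth_on S f"
  unfolding smooth_on_def
proof
  fix k
  have "Ck_on (Suc k) S f"
    using assms by (intro Ck_on_SucI[where f' = f']) (auto simp: smooth_on_def)
  then show "Ck_on k S f" by (rule Ck_on_SucD)
qed

lemma smooth_on_const: "open S \<Longrightarrow> smooth_on S (\<lambda>x. c)"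
  by (simp add: smooth_on_def Ck_on_const)

lemma smooth_on_id: "open S \<Longrightarrow> smooth_on S (\<lambda>x. x)"
  by (simp add: smooth_on_def Ck_on_id)

lemma smooth_on_linear:
  "bounded_linear A \<Longrightarrow> open S \<Longrightarrow> smooth_on S f \<Longrightarrow> smooth_on S (\<lambda>x. A (f x))"
  by (simp add: smooth_on_def Ck_on_linear)

lemma smooth_on_add:
  "open S \<Longrightarrow> smooth_on S f \<Longrightarrow> smooth_on S g \<Longrightarrow> smooth_on S (\<lambda>x. f x + g x)"
  by (simp add: smooth_on_def Ck_on_add)

lemma smooth_on_sum:
  "open S \<Longrightarrow> (\<And>i. i \<in> I \<Longrightarrow> smooth_on S (f i)) \<Longrightarrow> smooth_on S (\<lambda>x. \<Sum>i\<in>I. f i x)"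
  by (simp add: smooth_on_def Ck_on_sum)

lemma smooth_on_bilinear:
  "bounded_bilinear pr \<Longrightarrow> open S \<Longrightarrow> smooth_on S f \<Longrightarrow> smooth_on S g \<Longrightarrow>
    smooth_on S (\<lambda>x. pr (f x) (g x))"
  by (simp add: smooth_on_def Ck_on_bilinear)

lemmas smooth_on_scaleR = smooth_on_bilinear[OF bounded_bilinear_scaleR]

lemma smooth_on_mult:
  fixes f g :: "'a::euclidean_space \<Rightarrow> real"
  shows "open S \<Longrightarrow> smooth_on S f \<Longrightarrow> smooth_on S g \<Longrightarrow> smooth_on S (\<lambda>x. f x * g x)"
  using smooth_on_bilinear[OF bounded_bilinear_mult] .

lemma smooth_on_minus:
  assumes "open S" "smooth_on S f" shows "smooth_on S (\<lambda>x. - f x)"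
  using smooth_on_linear[OF bounded_linear_minus[OF bounded_linear_ident] assms] .

lemma smooth_on_diff:
  assumes "open S" "smooth_on S f" "smooth_on S g" shows "smooth_on S (\<lambda>x. f x - g x)"
  using smooth_on_add[OF assms(1,2) smooth_on_minus[OF assms(1,3)]] by simp

lemma smooth_on_linear_field:
  fixes a :: "'a::euclidean_space \<Rightarrow> 'c::euclidean_space"
  assumes "open S" "\<And>u. u \<in> S \<Longrightarrow> linear (B u)" "\<And>v. smooth_on S (\<lambda>u. B u v)" "smooth_on S a"
  shows "smooth_on S (\<lambda>u. B u (a u))"
  using assms Ck_on_linear_field[of S B _ a] unfolding smooth_on_def by blast

lemma smooth_on_compose:
  fixes f :: "'a::euclidean_space \<Rightarrow> 'c::euclidean_space"
  assumes "open S" "open S'" "f ` S \<subseteq> S'" "smooth_on S f" "smooth_on S' g"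
  shows "smooth_on S (\<lambda>x. g (f x))"
  using assms Ck_on_compose[of S S' f _ g] unfolding smooth_on_def by blast

lemma smooth_on_Pair:
  fixes f :: "'a::euclidean_space \<Rightarrow> 'b::euclidean_space" and g :: "'a \<Rightarrow> 'c::euclidean_space"
  assumes "open S" "smooth_on S f" "smooth_on S g"
  shows "smooth_on S (\<lambda>x. (f x, g x))"
proof -
  have "smooth_on S (\<lambda>x. (f x, 0) + (0, g x))"
    using smooth_on_linear[OF bounded_linear_Pair[OF bounded_linear_ident bounded_linear_zero] assms(1,2)]
      smooth_on_linear[OF bounded_linear_Pair[OF bounded_linear_zero bounded_linear_ident] assms(1,3)]
    by (rule smooth_on_add[OF assms(1)])
  then show ?thesis by simp
qed

text \<open>The derivative is again built from products of \<open>inverse\<close>, so each order of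
  differentiability yields the next.\<close>

lemma smooth_on_inverse_real: "smooth_on {x::real. x \<noteq> 0} inverse"
proof -
  have op: "open {x::real. x \<noteq> 0}" by (simp add: open_Collect_neq continuous_intros)
  have "Ck_on k {x::real. x \<noteq> 0} inverse" for k
  proof (induction k)
    case 0
    then show ?case by (auto intro!: continuous_intros)
  next
    case (Suc k)
    have "Ck_on k {x::real. x \<noteq> 0} (\<lambda>x. - (inverse x * v * inverse x))" for v
      by (intro Ck_on_linear[OF bounded_linear_minus[OF bounded_linear_ident]]
          Ck_on_bilinear[OF bounded_bilinear_mult] op Suc Ck_on_const)
    then show ?case
      by (intro Ck_on_SucI[where f' = "\<lambda>x v. - (inverse x * v * inverse x)"] op has_derivative_inverse') auto
  qed
  then show ?thesis by (simp add: smooth_on_def)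
qed

lemma smooth_on_inverse:
  fixes f :: "'a::euclidean_space \<Rightarrow> real"
  assumes "open S" "smooth_on S f" "\<And>x. x \<in> S \<Longrightarrow> f x \<noteq> 0"
  shows "smooth_on S (\<lambda>x. inverse (f x))"
proof -
  have op: "open {x::real. x \<noteq> 0}" by (simp add: open_Collect_neq continuous_intros)
  show ?thesis
    by (rule smooth_on_compose[OF assms(1) op _ assms(2) smooth_on_inverse_real]) (use assms in auto)
qed

lemma smooth_on_divide:
  fixes f g :: "'a::euclidean_space \<Rightarrow> real"
  assumes "open S" "smooth_on S f" "smooth_on S g" "\<And>x. x \<in> S \<Longrightarrow> g x \<noteq> 0"
  shows "smooth_on S (\<lambda>x. f x / g x)"
  unfolding divide_inverse using assms by (intro smooth_on_mult smooth_on_inverse)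

lemma smooth_on_sqrt_real: "smooth_on {0<..} sqrt"
proof -
  have "Ck_on k {0<..} sqrt" for k
  proof (induction k)
    case 0
    then show ?case by (auto intro!: continuous_intros)
  next
    case (Suc k)
    have "Ck_on k {0::real<..} inverse"
      using Ck_on_subset[of k "{x::real. x \<noteq> 0}" inverse "{0<..}"] smooth_on_inverse_real
      by (auto simp: smooth_on_def)
    then have "Ck_on k {0<..} (\<lambda>x. (v / 2) * (sqrt x * inverse x))" for v
      by (intro Ck_on_bilinear[OF bounded_bilinear_mult] Suc Ck_on_const) auto
    \<comment> \<open>The derivative 1 / (2 sqrt x) is rewritten as sqrt x / (2 x), so that the
      induction hypothesis on \<open>sqrt\<close> covers it.\<close>
    moreover have "(sqrt has_derivative (\<lambda>v. (v / 2) * (sqrt x * inverse x))) (at x)" if "x \<in> {0<..}" for x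
    proof -
      have "(sqrt has_derivative (\<lambda>v. v * (inverse (sqrt x) / 2))) (at x)"
        using DERIV_real_sqrt[of x] that by (simp only: has_field_derivative_def mult_commute_abs greaterThan_iff)
      moreover have "(\<lambda>v. v * (inverse (sqrt x) / 2)) = (\<lambda>v. (v / 2) * (sqrt x * inverse x))"
        using that by (simp add: fun_eq_iff field_simps)
      ultimately show ?thesis by metis
    qed
    ultimately show ?case
      by (intro Ck_on_SucI[where f' = "\<lambda>x v. (v / 2) * (sqrt x * inverse x)"]) auto
  qed
  then show ?thesis by (simp add: smooth_on_def)
qed

lemma smooth_on_sqrt:
  fixes f :: "'a::euclidean_space \<Rightarrow> real"
  assumes "open S" "smooth_on S f" "\<And>x. x \<in> S \<Longrightarrow> f x > 0"
  shows "smooth_on S (\<lambda>x. sqrt (f x))"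
  by (rule smooth_on_compose[OF assms(1) _ _ assms(2) smooth_on_sqrt_real]) (use assms in auto)

text \<open>Product rule for a linear map applied to a vector when both depend on the point. In the
  first term the vector is frozen at \<open>a u\<close>, so structure equations stated for constant
  arguments apply to it.\<close>

lemma has_derivative_linear_field:
  fixes a :: "'a::euclidean_space \<Rightarrow> 'c::euclidean_space" and B :: "'a \<Rightarrow> 'c \<Rightarrow> 'd::real_normed_vector"
  assumes S: "open S" "u \<in> S"
    and lin: "\<And>y. y \<in> S \<Longrightarrow> linear (B y)"
    and dB: "\<And>v. (\<lambda>y. B y v) differentiable (at u)"
    and da: "(a has_derivative a') (at u)"
  shows "((\<lambda>y. B y (a y)) has_derivative (\<lambda>w. D (\<lambda>y. B y (a u)) u w + B u (a' w))) (at u)"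
proof -
  have dB': "((\<lambda>y. B y v) has_derivative D (\<lambda>y. B y v) u) (at u)" for v
    using dB by (simp add: frechet_derivative_works)
  have "((\<lambda>y. \<Sum>b\<in>Basis. (a y \<bullet> b) *\<^sub>R B y b) has_derivative
      (\<lambda>w. \<Sum>b\<in>Basis. (a u \<bullet> b) *\<^sub>R D (\<lambda>y. B y b) u w + (a' w \<bullet> b) *\<^sub>R B u b)) (at u)"
    by (intro has_derivative_sum has_derivative_scaleR has_derivative_inner_left da dB')
  then have 1: "((\<lambda>y. B y (a y)) has_derivative
      (\<lambda>w. \<Sum>b\<in>Basis. (a u \<bullet> b) *\<^sub>R D (\<lambda>y. B y b) u w + (a' w \<bullet> b) *\<^sub>R B u b)) (at u)"
    by (rule has_derivative_transform_within_open[OF _ S]) (simp add: linear_sum_Basis[OF lin, symmetric])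
  have "((\<lambda>y. \<Sum>b\<in>Basis. (a u \<bullet> b) *\<^sub>R B y b) has_derivative
      (\<lambda>w. \<Sum>b\<in>Basis. (a u \<bullet> b) *\<^sub>R D (\<lambda>y. B y b) u w)) (at u)"
    by (intro has_derivative_sum has_derivative_scaleR_right dB')
  then have "((\<lambda>y. B y (a u)) has_derivative
      (\<lambda>w. \<Sum>b\<in>Basis. (a u \<bullet> b) *\<^sub>R D (\<lambda>y. B y b) u w)) (at u)"
    by (rule has_derivative_transform_within_open[OF _ S]) (simp add: linear_sum_Basis[OF lin, symmetric])
  from 1 D_eqI[OF this] show ?thesis
    by (simp add: sum.distrib linear_sum_Basis[OF lin[OF S(2)], of "a' _"])
qed

lemma D_linear_field:
  fixes a :: "'a::euclidean_space \<Rightarrow> 'c::euclidean_space" and B :: "'a \<Rightarrow> 'c \<Rightarrow> 'd::real_normed_vector"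
  assumes "open S" "u \<in> S" "\<And>y. y \<in> S \<Longrightarrow> linear (B y)" "\<And>v. smooth_on S (\<lambda>y. B y v)" "smooth_on S a"
  shows "D (\<lambda>y. B y (a y)) u w = D (\<lambda>y. B y (a u)) u w + B u (D a u w)"
  by (simp add: D_eqI[OF has_derivative_linear_field[OF assms(1-3) smooth_on_differentiable[OF assms(4,2)]
        smooth_on_has_derivative[OF assms(5,2)]]])

lemma D_compose:
  assumes "g differentiable (at (f u))" "f differentiable (at u)"
  shows "D (\<lambda>y. g (f y)) u w = D g (f u) (D f u w)"
  using frechet_derivative_compose[OF assms(2,1)] by (simp add: o_def)

lemma D_add: "f differentiable (at u) \<Longrightarrow> g differentiable (at u) \<Longrightarrow>
    D (\<lambda>y. f y + g y) u w = D f u w + D g u w"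
  by (subst D_eqI[OF has_derivative_add]) (auto simp: frechet_derivative_works)

lemma D_diff: "f differentiable (at u) \<Longrightarrow> g differentiable (at u) \<Longrightarrow>
    D (\<lambda>y. f y - g y) u w = D f u w - D g u w"
  by (subst D_eqI[OF has_derivative_diff]) (auto simp: frechet_derivative_works)

lemma D_scaleR: "f differentiable (at u) \<Longrightarrow> g differentiable (at u) \<Longrightarrow>
    D (\<lambda>y. f y *\<^sub>R g y) u w = f u *\<^sub>R D g u w + D f u w *\<^sub>R g u"
  by (subst D_eqI[OF has_derivative_scaleR]) (auto simp: frechet_derivative_works)

lemma D_mult: 
  fixes f g :: "'a::real_normed_vector \<Rightarrow> real"
  shows "f differentiable (at u) \<Longrightarrow> g differentiable (at u) \<Longrightarrow>
    D (\<lambda>y. f y * g y) u w = f u * D g u w + D f u w * g u"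
  by (subst D_eqI[OF has_derivative_mult]) (auto simp: frechet_derivative_works)

lemma D_bounded_linear: "bounded_linear A \<Longrightarrow> f differentiable (at u) \<Longrightarrow>
    D (\<lambda>y. A (f y)) u w = A (D f u w)"
  by (subst D_eqI[OF bounded_linear.has_derivative]) (auto simp: frechet_derivative_works)

lemma D_sum: "finite I \<Longrightarrow> (\<And>i. i \<in> I \<Longrightarrow> f i differentiable (at u)) \<Longrightarrow>
    D (\<lambda>y. \<Sum>i\<in>I. f i y) u w = (\<Sum>i\<in>I. D (f i) u w)"
  by (subst D_eqI[OF has_derivative_sum]) (auto simp: frechet_derivative_works)

text \<open>A smooth family of injective linear systems has a smooth solution: the derivative of the
  solution solves the differentiated system, so regularity bootstraps.\<close>

lemma linear_system_estimate:
  fixes B :: "'a::euclidean_space \<Rightarrow> 'c::euclidean_space \<Rightarrow> 'd::euclidean_space"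
  assumes S: "open S" "u \<in> S"
    and lin: "\<And>y. y \<in> S \<Longrightarrow> linear (B y)" and inj: "inj (B u)"
    and cB: "\<And>v. isCont (\<lambda>y. B y v) u"
    and eq: "\<And>y. y \<in> S \<Longrightarrow> B y (s y) = r y"
  obtains A E where "linear A" "(E \<longlongrightarrow> 0) (at u)" "\<And>y. E y \<ge> (0::real)"
    "\<And>y. y \<in> S \<Longrightarrow> norm (s y - s u - A (r y - B y (s u))) \<le> norm (s y - s u) * E y"
proof -
  obtain A where A: "linear A" "A \<circ> B u = id"
    using linear_injective_left_inverse[OF lin[OF S(2)] inj] by auto
  have bA: "bounded_linear A" using A(1) by (simp add: linear_conv_bounded_linear)
  have id: "A (B u v) = v" for v using A(2) by (metis comp_apply id_apply)
  define E where "E y = (\<Sum>b\<in>Basis. norm (A (B y b - B u b)))" for y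
  \<comment> \<open>A inverts \<open>B u\<close> from the left, so the error made by
    \<open>A (r y - B y (s u))\<close> is governed by the difference of \<open>B y\<close> and
    \<open>B u\<close>, which tends to zero.\<close>
  have key: "s y - s u - A (r y - B y (s u)) = - A (B y (s y - s u) - B u (s y - s u))" if "y \<in> S" for y
  proof -
    have "A (r y - B y (s u)) = A (B y (s y - s u))"
      by (simp add: linear_diff[OF lin[OF that]] eq[OF that])
    then show ?thesis by (simp add: linear_diff[OF A(1)] id)
  qed
  have bound: "norm (A (B y v - B u v)) \<le> norm v * E y" if "y \<in> S" for y v
  proof -
    have "linear (\<lambda>v. A (B y v - B u v))"
      using linear_compose[OF linear_compose_sub[OF lin[OF that] lin[OF S(2)]] A(1)] by (simp add: o_def)
    from linear_sum_Basis[OF this, of v]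
    have "norm (A (B y v - B u v)) = norm (\<Sum>b\<in>Basis. (v \<bullet> b) *\<^sub>R A (B y b - B u b))" by simp
    also have "\<dots> \<le> (\<Sum>b\<in>Basis. norm v * norm (A (B y b - B u b)))"
      by (intro sum_norm_le) (simp add: Basis_le_norm mult_right_mono)
    finally show ?thesis by (simp add: E_def sum_distrib_left)
  qed
  have "((\<lambda>y. A (B y b - B u b)) \<longlongrightarrow> A (B u b - B u b)) (at u)" for b
    using cB by (intro bounded_linear.tendsto[OF bA] tendsto_intros) (simp add: isCont_def)
  then have "((\<lambda>y. norm (A (B y b - B u b))) \<longlongrightarrow> 0) (at u)" for b
    by (simp add: linear_0[OF A(1)] tendsto_norm_zero)
  then have "(E \<longlongrightarrow> (\<Sum>b\<in>(Basis::'c set). 0)) (at u)" unfolding E_def by (intro tendsto_sum)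
  then have E0: "(E \<longlongrightarrow> 0) (at u)" by simp
  have "E y \<ge> 0" for y by (simp add: E_def sum_nonneg)
  from that[OF A(1) E0 this] key bound show ?thesis by (metis norm_minus_cancel)
qed

lemma isCont_linear_system:
  fixes B :: "'a::euclidean_space \<Rightarrow> 'c::euclidean_space \<Rightarrow> 'd::euclidean_space"
  assumes S: "open S" "u \<in> S"
    and lin: "\<And>y. y \<in> S \<Longrightarrow> linear (B y)" and inj: "inj (B u)"
    and cB: "\<And>v. isCont (\<lambda>y. B y v) u"
    and cr: "isCont r u"
    and eq: "\<And>y. y \<in> S \<Longrightarrow> B y (s y) = r y"
  shows "isCont s u"
proof -
  obtain A E where A: "linear A" and E: "(E \<longlongrightarrow> 0) (at u)" "\<And>y. E y \<ge> (0::real)"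
    and est: "\<And>y. y \<in> S \<Longrightarrow> norm (s y - s u - A (r y - B y (s u))) \<le> norm (s y - s u) * E y"
    using linear_system_estimate[OF S lin inj cB eq] by blast
  have bA: "bounded_linear A" using A(1) by (simp add: linear_conv_bounded_linear)
  have "((\<lambda>y. A (r y - B y (s u))) \<longlongrightarrow> A (r u - B u (s u))) (at u)"
    using cB cr by (intro bounded_linear.tendsto[OF bA] tendsto_intros) (simp_all add: isCont_def)
  then have lim: "((\<lambda>y. 2 * norm (A (r y - B y (s u)))) \<longlongrightarrow> 2 * 0) (at u)"
    using eq[OF S(2)] by (intro tendsto_mult tendsto_const tendsto_norm_zero) (simp add: linear_0[OF A])
  have evS: "\<forall>\<^sub>F y in at u. y \<in> S" using S eventually_at_topological by blast
  have evE: "\<forall>\<^sub>F y in at u. E y < 1/2"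
    using order_tendstoD(2)[OF E(1), of "1/2"] by simp
  have "((\<lambda>y. norm (s y - s u)) \<longlongrightarrow> 0) (at u)"
  proof (rule tendsto_sandwich[OF _ _ tendsto_const lim[simplified]])
    show "\<forall>\<^sub>F y in at u. norm (s y - s u) \<le> 2 * norm (A (r y - B y (s u)))"
      using evS evE
    proof eventually_elim
      case (elim y)
      have "norm (s y - s u) \<le> norm (A (r y - B y (s u))) + norm (s y - s u - A (r y - B y (s u)))"
        by norm
      also have "\<dots> \<le> norm (A (r y - B y (s u))) + norm (s y - s u) * (1/2)"
        using est[OF elim(1)] elim(2) mult_left_mono[of "E y" "1/2" "norm (s y - s u)"] by simp
      finally show ?case by simp
    qed
  qed auto
  then show ?thesis by (simp add: isCont_def tendsto_norm_zero_iff Lim_null[symmetric])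
qed

lemma differentiable_linear_system:
  fixes B :: "'a::euclidean_space \<Rightarrow> 'c::euclidean_space \<Rightarrow> 'd::euclidean_space"
  assumes S: "open S" "u \<in> S"
    and lin: "\<And>y. y \<in> S \<Longrightarrow> linear (B y)" and inj: "inj (B u)"
    and dB: "\<And>v. (\<lambda>y. B y v) differentiable (at u)"
    and dr: "(r has_derivative r') (at u)"
    and eq: "\<And>y. y \<in> S \<Longrightarrow> B y (s y) = r y"
  shows "s differentiable (at u)"
proof -
  have dB': "((\<lambda>y. B y v) has_derivative D (\<lambda>y. B y v) u) (at u)" for v
    using dB by (simp add: frechet_derivative_works)
  have cB: "isCont (\<lambda>y. B y v) u" for v using dB'[of v] by (rule has_derivative_continuous)
  obtain A E where A: "linear A" and E: "(E \<longlongrightarrow> 0) (at u)" "\<And>y. E y \<ge> (0::real)"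
    and est: "\<And>y. y \<in> S \<Longrightarrow> norm (s y - s u - A (r y - B y (s u))) \<le> norm (s y - s u) * E y"
    using linear_system_estimate[OF S lin inj cB eq] by blast
  have bA: "bounded_linear A" using A(1) by (simp add: linear_conv_bounded_linear)
  define q where "q y = A (r y - B y (s u))" for y
  \<comment> \<open>Formal differentiation of \<open>B y (s y) = r y\<close> at u asks for
    \<open>B u (s' w) = r' w - D (\<lambda>y. B y (s u)) u w\<close>; applying A gives the candidate
    for s'.\<close>
  define A' where "A' w = A (r' w - D (\<lambda>y. B y (s u)) u w)" for w
  have dq: "(q has_derivative A') (at u)"
    unfolding q_def A'_def by (intro bounded_linear.has_derivative[OF bA] has_derivative_diff dr dB')
  have q0: "q u = 0" using eq[OF S(2)] by (simp add: q_def linear_0[OF A(1)])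
  obtain C where C: "\<And>w. norm (A' w) \<le> norm w * C"
    using bounded_linear.bounded has_derivative_bounded_linear[OF dq] by metis
  have lim: "((\<lambda>y. norm (q y - A' (y - u)) / norm (y - u)) \<longlongrightarrow> 0) (at u)"
  proof -
    have "((\<lambda>y. norm ((1 / norm (y - u)) *\<^sub>R (q y - (q u + A' (y - u))))) \<longlongrightarrow> 0) (at u)"
      using dq unfolding has_derivative_at2 by (intro tendsto_norm_zero) simp
    then show ?thesis using q0 by simp
  qed
  have lim2: "((\<lambda>y. (1 + 2 * E y) * (norm (q y - A' (y - u)) / norm (y - u)) + 2 * \<bar>C\<bar> * E y) \<longlongrightarrow>
      (1 + 2 * 0) * 0 + 2 * \<bar>C\<bar> * 0) (at u)"
    by (intro tendsto_intros lim E)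
  have evS: "\<forall>\<^sub>F y in at u. y \<in> S" using S eventually_at_topological by blast
  have evE: "\<forall>\<^sub>F y in at u. E y < 1/2"
    using order_tendstoD(2)[OF E(1), of "1/2"] by simp
  have "(s has_derivative A') (at u)"
    unfolding has_derivative_at2
  proof
    show "bounded_linear A'" by (rule has_derivative_bounded_linear[OF dq])
    show "((\<lambda>y. (1 / norm (y - u)) *\<^sub>R (s y - (s u + A' (y - u)))) \<longlongrightarrow> 0) (at u)"
    proof (rule tendsto_norm_zero_cancel, rule tendsto_sandwich[OF _ _ tendsto_const lim2[simplified]])
      show "\<forall>\<^sub>F y in at u. norm ((1 / norm (y - u)) *\<^sub>R (s y - (s u + A' (y - u))))
          \<le> (1 + 2 * E y) * norm (q y - A' (y - u)) / norm (y - u) + 2 * \<bar>C\<bar> * E y"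
        using evS evE eventually_neq_at_within[of u u UNIV]
      proof eventually_elim
        case (elim y)
        let ?n = "norm (y - u)" and ?d = "norm (s y - s u)" and ?e = "norm (q y - A' (y - u))"
        have n: "?n > 0" using elim by simp
        have est': "norm (s y - s u - q y) \<le> ?d * E y" using est[OF elim(1)] by (simp add: q_def)
        \<comment> \<open>As \<open>E y < 1/2\<close>, the error is absorbed into the left side.
          This bounds the increment of s by that of q and makes the error term of smaller
          order.\<close>
        have "?d \<le> norm (q y) + norm (s y - s u - q y)" by norm
        then have "?d \<le> norm (q y) + ?d * (1/2)"
          using est' elim(2) mult_left_mono[of "E y" "1/2" ?d] by simp
        then have d: "?d \<le> 2 * norm (q y)" by simp
        have "norm (A' (y - u)) \<le> ?n * \<bar>C\<bar>"
          using C[of "y - u"] by (meson abs_ge_self mult_left_mono norm_ge_zero order_trans)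
        moreover have "norm (q y) \<le> ?e + norm (A' (y - u))" by norm
        ultimately have "?d \<le> 2 * (?e + ?n * \<bar>C\<bar>)" using d by simp
        then have dE: "?d * E y \<le> 2 * (?e + ?n * \<bar>C\<bar>) * E y"
          using E(2) by (intro mult_right_mono)
        have "norm (s y - (s u + A' (y - u))) \<le> norm (s y - s u - q y) + ?e" by norm
        then have "norm (s y - (s u + A' (y - u))) \<le> ?e + 2 * (?e + ?n * \<bar>C\<bar>) * E y"
          using est' dE by linarith
        then have "norm (s y - (s u + A' (y - u))) / ?n \<le> (?e + 2 * (?e + ?n * \<bar>C\<bar>) * E y) / ?n"
          using n by (intro divide_right_mono) auto
        also have "\<dots> = (1 + 2 * E y) * ?e / ?n + 2 * \<bar>C\<bar> * E y"
          using n by (simp add: field_simps)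
        finally show ?case by simp
      qed
    qed auto
  qed
  then show ?thesis by (rule differentiableI)
qed

lemma Ck_on_linear_system:
  fixes B :: "'a::euclidean_space \<Rightarrow> 'c::euclidean_space \<Rightarrow> 'd::euclidean_space"
  assumes S: "open S"
    and lin: "\<And>y. y \<in> S \<Longrightarrow> linear (B y)" and inj: "\<And>y. y \<in> S \<Longrightarrow> inj (B y)"
    and "\<And>v. Ck_on k S (\<lambda>y. B y v)"
    and "Ck_on k S r"
    and "\<And>y. y \<in> S \<Longrightarrow> B y (s y) = r y"
  shows "Ck_on k S s"
  using assms(4-6)
proof (induction k arbitrary: s r)
  case 0
  have "isCont s u" if "u \<in> S" for u
  proof (rule isCont_linear_system[where B = B and r = r])
    show "isCont (\<lambda>y. B y v) u" for v
      using 0(1)[of v] S that by (simp add: continuous_on_eq_continuous_at)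
    show "isCont r u" using 0(2) S that by (simp add: continuous_on_eq_continuous_at)
  qed (use S that lin inj 0(3) in auto)
  then show ?case by (simp add: continuous_at_imp_continuous_on)
next
  case (Suc k)
  have dB: "(\<lambda>y. B y v) differentiable (at u)" if "u \<in> S" for u v
    using Suc.prems(1)[of v] that by simp
  have ds: "(s has_derivative D s u) (at u)" if "u \<in> S" for u
    using differentiable_linear_system[OF S that lin inj[OF that] dB[OF that]
        Ck_on_Suc_has_derivative[OF Suc.prems(2) that] Suc.prems(3)]
    by (simp add: frechet_derivative_works)
  have eq: "B u (D s u w) = D r u w - D (\<lambda>y. B y (s u)) u w" if "u \<in> S" for u w
  proof -
    have "((\<lambda>y. B y (s y)) has_derivative (\<lambda>w. D (\<lambda>y. B y (s u)) u w + B u (D s u w))) (at u)"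
      using ds[OF that] by (intro has_derivative_linear_field[OF S that lin dB[OF that]])
    then have "D (\<lambda>y. B y (s y)) u = (\<lambda>w. D (\<lambda>y. B y (s u)) u w + B u (D s u w))"
      by (rule D_eqI)
    moreover have "D (\<lambda>y. B y (s y)) u = D r u" using D_cong[OF S that Suc.prems(3)] .
    ultimately have "D r u w = D (\<lambda>y. B y (s u)) u w + B u (D s u w)" by metis
    then show ?thesis by simp
  qed
  have sk: "Ck_on k S s" by (rule Suc.IH[OF Ck_on_SucD[OF Suc.prems(1)] Ck_on_SucD[OF Suc.prems(2)] Suc.prems(3)])
  have DB: "linear (\<lambda>v. D (\<lambda>y. B y v) u w)" if u: "u \<in> S" for u w
  proof (rule linearI)
    fix a b :: 'c and c :: real
    have "D (\<lambda>y. B y (a + b)) u = D (\<lambda>y. B y a + B y b) u"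
      by (rule D_cong[OF S u]) (simp add: linear_add[OF lin])
    then show "D (\<lambda>y. B y (a + b)) u w = D (\<lambda>y. B y a) u w + D (\<lambda>y. B y b) u w"
      using dB[OF u] by (simp add: D_add)
    have "D (\<lambda>y. B y (c *\<^sub>R a)) u = D (\<lambda>y. c *\<^sub>R B y a) u"
      by (rule D_cong[OF S u]) (simp add: linear_scale[OF lin])
    then show "D (\<lambda>y. B y (c *\<^sub>R a)) u w = c *\<^sub>R D (\<lambda>y. B y a) u w"
      using dB[OF u] by (simp add: D_bounded_linear[OF bounded_linear_scaleR_right])
  qed
  have "Ck_on k S (\<lambda>u. D s u w)" for w
  proof (rule Suc.IH[OF Ck_on_SucD[OF Suc.prems(1)] _ eq])
    have "Ck_on k S (\<lambda>u. D (\<lambda>y. B y v) u w)" for v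
      using Suc.prems(1)[of v] by simp
    then have "Ck_on k S (\<lambda>u. D (\<lambda>y. B y (s u)) u w)"
      by (intro Ck_on_linear_field[OF S DB _ sk])
    then have "Ck_on k S (\<lambda>u. D r u w + - D (\<lambda>y. B y (s u)) u w)"
      using Suc.prems(2)
      by (intro Ck_on_add[OF S] Ck_on_linear[OF bounded_linear_minus[OF bounded_linear_ident] S]) auto
    then show "Ck_on k S (\<lambda>u. D r u w - D (\<lambda>y. B y (s u)) u w)" by simp
  qed
  then show ?case using ds by (auto intro: differentiableI)
qed

lemma smooth_on_linear_system:
  fixes B :: "'a::euclidean_space \<Rightarrow> 'c::euclidean_space \<Rightarrow> 'd::euclidean_space"
  assumes "open S" "\<And>y. y \<in> S \<Longrightarrow> linear (B y)" "\<And>y. y \<in> S \<Longrightarrow> inj (B y)"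
    "\<And>v. smooth_on S (\<lambda>y. B y v)" "smooth_on S r" "\<And>y. y \<in> S \<Longrightarrow> B y (s y) = r y"
  shows "smooth_on S s"
  using Ck_on_linear_system[of S B _ r s] assms unfolding smooth_on_def by blast

section \<open>Symmetry of second derivatives\<close>

lemma has_real_derivative_line:
  fixes g :: "'a::real_normed_vector \<Rightarrow> real"
  assumes "g differentiable (at (p + s *\<^sub>R v))"
  shows "((\<lambda>s. g (p + s *\<^sub>R v)) has_real_derivative D g (p + s *\<^sub>R v) v) (at s)"
proof -
  have g: "(g has_derivative D g (p + s *\<^sub>R v)) (at (p + s *\<^sub>R v))"
    using assms by (simp add: frechet_derivative_works)
  have "((\<lambda>s. p + s *\<^sub>R v) has_derivative (\<lambda>h. h *\<^sub>R v)) (at s)"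
    by (auto intro!: derivative_eq_intros)
  from has_derivative_compose[OF this g]
  have "((\<lambda>s. g (p + s *\<^sub>R v)) has_derivative (\<lambda>h. D g (p + s *\<^sub>R v) (h *\<^sub>R v))) (at s)" .
  moreover have "D g (p + s *\<^sub>R v) (h *\<^sub>R v) = D g (p + s *\<^sub>R v) v * h" for h
    using linear_scale[OF has_derivative_linear[OF g]] by simp
  ultimately show ?thesis by (simp add: has_field_derivative_def)
qed

text \<open>Two applications of the mean value theorem. The second difference is symmetric in v and
  w, while the right side differentiates in a chosen order; comparing both orders as t tends to zero
  gives \<open>D_commute_real\<close>.\<close>

lemma second_difference:
  fixes f :: "'a::euclidean_space \<Rightarrow> real"
  assumes S: "ball u e \<subseteq> S" and f: "smooth_on S f" and t: "t > 0" "t * (norm v + norm w) < e"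
  obtains z where "dist u z \<le> t * (norm v + norm w)"
    "f (u + t *\<^sub>R v + t *\<^sub>R w) - f (u + t *\<^sub>R v) - f (u + t *\<^sub>R w) + f u
      = t * t * D (\<lambda>y. D f y v) z w"
proof -
  have near: "dist u (u + a *\<^sub>R v + b *\<^sub>R w) \<le> t * (norm v + norm w)"
    if "0 \<le> a" "a \<le> t" "0 \<le> b" "b \<le> t" for a b
  proof -
    have "norm (a *\<^sub>R v + b *\<^sub>R w) \<le> a * norm v + b * norm w"
      using norm_triangle_ineq[of "a *\<^sub>R v" "b *\<^sub>R w"] that by simp
    also have "\<dots> \<le> t * norm v + t * norm w" using that by (intro add_mono mult_right_mono) auto
    finally show ?thesis by (simp add: dist_norm norm_minus_commute algebra_simps)
  qed
  then have inS: "u + a *\<^sub>R v + b *\<^sub>R w \<in> S" if "0 \<le> a" "a \<le> t" "0 \<le> b" "b \<le> t" for a b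
    using S t that by (meson le_less_trans mem_ball subsetD)
  have d1: "((\<lambda>s. f (u + b *\<^sub>R w + s *\<^sub>R v)) has_real_derivative D f (u + a *\<^sub>R v + b *\<^sub>R w) v) (at a)"
    if "0 \<le> a" "a \<le> t" "0 \<le> b" "b \<le> t" for a b
    using has_real_derivative_line[of f "u + b *\<^sub>R w" a v] smooth_on_differentiable[OF f inS[OF that]]
    by (simp add: algebra_simps)
  have "\<exists>a. 0 < a \<and> a < t \<and> (f (u + t *\<^sub>R w + t *\<^sub>R v) - f (u + 0 *\<^sub>R w + t *\<^sub>R v)) -
      (f (u + t *\<^sub>R w + 0 *\<^sub>R v) - f (u + 0 *\<^sub>R w + 0 *\<^sub>R v)) =
      (t - 0) * (D f (u + a *\<^sub>R v + t *\<^sub>R w) v - D f (u + a *\<^sub>R v + 0 *\<^sub>R w) v)"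
    by (rule MVT2[OF t(1)], rule DERIV_diff; rule d1) (use t in auto)
  then obtain a where a: "0 < a" "a < t" and eq1:
    "f (u + t *\<^sub>R v + t *\<^sub>R w) - f (u + t *\<^sub>R v) - f (u + t *\<^sub>R w) + f u =
      t * (D f (u + a *\<^sub>R v + t *\<^sub>R w) v - D f (u + a *\<^sub>R v + 0 *\<^sub>R w) v)"
    by (force simp: algebra_simps)
  have d2: "((\<lambda>s. D f (u + a *\<^sub>R v + s *\<^sub>R w) v) has_real_derivative
      D (\<lambda>y. D f y v) (u + a *\<^sub>R v + b *\<^sub>R w) w) (at b)" if "0 \<le> b" "b \<le> t" for b
    using has_real_derivative_line[of "\<lambda>y. D f y v" "u + a *\<^sub>R v" b w] a
      smooth_on_differentiable[OF smooth_on_D[OF f] inS[of a b]] that by simp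
  have "\<exists>b. 0 < b \<and> b < t \<and> D f (u + a *\<^sub>R v + t *\<^sub>R w) v - D f (u + a *\<^sub>R v + 0 *\<^sub>R w) v =
      (t - 0) * D (\<lambda>y. D f y v) (u + a *\<^sub>R v + b *\<^sub>R w) w"
    by (rule MVT2[OF t(1)]) (rule d2)
  then obtain b where b: "0 < b" "b < t" and eq2:
    "D f (u + a *\<^sub>R v + t *\<^sub>R w) v - D f (u + a *\<^sub>R v + 0 *\<^sub>R w) v =
      t * D (\<lambda>y. D f y v) (u + a *\<^sub>R v + b *\<^sub>R w) w" by auto
  show ?thesis by (rule that[OF near[of a b]]) (use a b eq1 eq2 in auto)
qed

lemma D_commute_real:
  fixes f :: "'a::euclidean_space \<Rightarrow> real"
  assumes S: "open S" "u \<in> S" and f: "smooth_on S f"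
  shows "D (\<lambda>y. D f y v) u w = D (\<lambda>y. D f y w) u v"
proof -
  let ?P = "\<lambda>y. D (\<lambda>y. D f y v) y w" and ?Q = "\<lambda>y. D (\<lambda>y. D f y w) y v"
  obtain e where e: "e > 0" "ball u e \<subseteq> S" using S openE by blast
  have cont: "isCont ?P u" "isCont ?Q u"
    using smooth_on_continuous[OF smooth_on_D[OF smooth_on_D[OF f]]] S
    by (simp_all add: continuous_on_eq_continuous_at)
  have "dist (?P u) (?Q u) \<le> 2 * r" if "r > 0" for r
  proof -
    obtain d1 where d1: "d1 > 0" "\<And>y. dist y u < d1 \<Longrightarrow> dist (?P y) (?P u) < r"
      using cont(1) \<open>r > 0\<close> unfolding continuous_at_eps_delta by metis
    obtain d2 where d2: "d2 > 0" "\<And>y. dist y u < d2 \<Longrightarrow> dist (?Q y) (?Q u) < r"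
      using cont(2) \<open>r > 0\<close> unfolding continuous_at_eps_delta by metis
    define m where "m = min e (min d1 d2)"
    define t where "t = m / (2 * (norm v + norm w + 1))"
    have m: "m > 0" using e d1 d2 by (simp add: m_def)
    have n: "norm v + norm w + 1 > 0" by (simp add: add_nonneg_pos)
    have t: "t > 0" using m n by (simp add: t_def)
    have "t * (norm v + norm w) \<le> t * (norm v + norm w + 1)" using t by simp
    also have "\<dots> = m / 2" using n by (simp add: t_def field_simps)
    also have "\<dots> < m" using m by simp
    finally have tm: "t * (norm v + norm w) < m" .
    then have tm': "t * (norm w + norm v) < m" by (simp add: add.commute)
    obtain z where z: "dist u z \<le> t * (norm v + norm w)"
      "f (u + t *\<^sub>R v + t *\<^sub>R w) - f (u + t *\<^sub>R v) - f (u + t *\<^sub>R w) + f u = t * t * ?P z"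
      using second_difference[OF e(2) f t, of v w] tm by (auto simp: m_def)
    obtain z' where z': "dist u z' \<le> t * (norm w + norm v)"
      "f (u + t *\<^sub>R w + t *\<^sub>R v) - f (u + t *\<^sub>R w) - f (u + t *\<^sub>R v) + f u = t * t * ?Q z'"
      using second_difference[OF e(2) f t, of w v] tm' by (auto simp: m_def)
    have "t * t * ?P z = t * t * ?Q z'" using z(2) z'(2) by (simp add: algebra_simps)
    then have "?P z = ?Q z'" using t by simp
    moreover have "dist (?P z) (?P u) < r" using z(1) tm by (intro d1) (simp add: m_def dist_commute)
    moreover have "dist (?Q z') (?Q u) < r" using z'(1) tm' by (intro d2) (simp add: m_def dist_commute)
    ultimately show ?thesis by (simp add: dist_real_def)
  qed
  \<comment> \<open>For this r the bound says that the distance is at most half of itself.\<close>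
  from this[of "dist (?P u) (?Q u) / 4"] show ?thesis by (cases "?P u = ?Q u") auto
qed

lemma D_commute:
  fixes f :: "'a::euclidean_space \<Rightarrow> 'c::euclidean_space"
  assumes S: "open S" "u \<in> S" and f: "smooth_on S f"
  shows "D (\<lambda>y. D f y v) u w = D (\<lambda>y. D f y w) u v"
proof (rule euclidean_eqI)
  fix b :: 'c
  have fb: "smooth_on S (\<lambda>y. f y \<bullet> b)" by (rule smooth_on_linear[OF bounded_linear_inner_left S(1) f])
  have "D (\<lambda>y. D f y v) u w \<bullet> b = D (\<lambda>y. D (\<lambda>y. f y \<bullet> b) y v) u w" for v w
  proof -
    have "D (\<lambda>y. D f y v) u w \<bullet> b = D (\<lambda>y. D f y v \<bullet> b) u w"
      using smooth_on_differentiable[OF smooth_on_D[OF f] S(2)]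
      by (simp add: D_bounded_linear[OF bounded_linear_inner_left])
    also have "\<dots> = D (\<lambda>y. D (\<lambda>y. f y \<bullet> b) y v) u w"
      using smooth_on_differentiable[OF f]
      by (subst D_cong[OF S]) (simp_all add: D_bounded_linear[OF bounded_linear_inner_left])
    finally show ?thesis .
  qed
  then show "D (\<lambda>y. D f y v) u w \<bullet> b = D (\<lambda>y. D f y w) u v \<bullet> b"
    using D_commute_real[OF S fb, of v w] by simp
qed

text \<open>Poincare lemma on a convex set: t is the integral of \<theta> along the segment from a
  fixed point c. Closedness turns the u-derivative of the integrand in direction w into the
  s-derivative of \<open>s * \<theta> (\<gamma> u s) w\<close>, and this integrates to
  \<open>\<theta> u w\<close>.\<close>

lemma closed_form_exact:
  fixes \<theta> :: "'a::euclidean_space \<Rightarrow> 'a \<Rightarrow> real"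
  assumes S: "open S" "convex S"
    and lin: "\<And>u. u \<in> S \<Longrightarrow> linear (\<theta> u)" and smo: "\<And>v. smooth_on S (\<lambda>u. \<theta> u v)"
    and closed: "\<And>u v w. u \<in> S \<Longrightarrow> D (\<lambda>y. \<theta> y v) u w = D (\<lambda>y. \<theta> y w) u v"
  obtains t where "\<And>u. u \<in> S \<Longrightarrow> (t has_derivative \<theta> u) (at u)"
proof (cases "S = {}")
  case False
  then obtain c where c: "c \<in> S" by auto
  define \<gamma> where "\<gamma> u s = c + s *\<^sub>R (u - c)" for u and s :: real
  have \<gamma>S: "\<gamma> u s \<in> S" if "u \<in> S" "s \<in> {0..1}" for u s
    using convexD_alt[OF S(2) c that(1), of s] that(2) by (simp add: \<gamma>_def algebra_simps)
  \<comment> \<open>The derivative of the integrand with respect to u, packed as a bounded linear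
    map because \<open>leibniz_rule\<close> integrates derivatives in that form.\<close>
  define fx where "fx u s = Blinfun (\<lambda>w. \<theta> (\<gamma> u s) w + s * D (\<lambda>y. \<theta> y w) (\<gamma> u s) (u - c))" for u s
  have lin2: "linear (\<lambda>w. D (\<lambda>y. \<theta> y w) u v)" if "u \<in> S" for u v
    using smooth_on_linear_D[OF smo that] closed[OF that, of _ v] by simp
  have fx: "blinfun_apply (fx u s) w = \<theta> (\<gamma> u s) w + s * D (\<lambda>y. \<theta> y w) (\<gamma> u s) (u - c)"
    if "u \<in> S" "s \<in> {0..1}" for u s w
  proof -
    have "linear (\<lambda>w. \<theta> (\<gamma> u s) w + s *\<^sub>R D (\<lambda>y. \<theta> y w) (\<gamma> u s) (u - c))"
      using \<gamma>S[OF that] by (intro linear_compose_add linear_compose_scale_right lin lin2)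
    then show ?thesis unfolding fx_def
      by (subst bounded_linear_Blinfun_apply) (simp_all add: linear_conv_bounded_linear)
  qed
  define F where "F u s = \<theta> (\<gamma> u s) (u - c)" for u s
  have dF: "((\<lambda>u. F u s) has_derivative blinfun_apply (fx u s)) (at u within S)" if "u \<in> S" "s \<in> {0..1}" for u s
  proof -
    have d\<gamma>: "((\<lambda>u. \<gamma> u s) has_derivative (\<lambda>w. s *\<^sub>R w)) (at u)"
      unfolding \<gamma>_def by (auto intro!: derivative_eq_intros simp: algebra_simps)
    have comp: "((\<lambda>y. \<theta> (\<gamma> y s) v) has_derivative (\<lambda>w. D (\<lambda>y. \<theta> y v) (\<gamma> u s) (s *\<^sub>R w))) (at u)" for v
      using has_derivative_compose[OF d\<gamma> smooth_on_has_derivative[OF smo \<gamma>S[OF that]]] by simp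
    have "((\<lambda>y. \<theta> (\<gamma> y s) (y - c)) has_derivative
        (\<lambda>w. D (\<lambda>y. \<theta> (\<gamma> y s) (u - c)) u w + \<theta> (\<gamma> u s) w)) (at u)"
      by (rule has_derivative_linear_field[OF S(1) that(1)])
        (use comp lin \<gamma>S that(2) in \<open>auto intro!: derivative_eq_intros differentiableI\<close>)
    moreover have "D (\<lambda>y. \<theta> (\<gamma> y s) (u - c)) u w = s * D (\<lambda>y. \<theta> y w) (\<gamma> u s) (u - c)" for w
      using linear_scale[OF smooth_on_linear_D[OF smo \<gamma>S[OF that]]] closed[OF \<gamma>S[OF that]]
      by (simp add: D_eqI[OF comp])
    moreover have "blinfun_apply (fx u s) = (\<lambda>w. s * D (\<lambda>y. \<theta> y w) (\<gamma> u s) (u - c) + \<theta> (\<gamma> u s) w)"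
      by (simp add: fun_eq_iff fx[OF that])
    ultimately show ?thesis by (simp add: F_def has_derivative_at_withinI)
  qed
  have contg: "continuous_on (S \<times> {0..1}) (\<lambda>(u, s). \<gamma> u s)"
    unfolding \<gamma>_def by (auto intro!: continuous_intros simp: split_beta)
  have \<gamma>im: "(\<lambda>p. \<gamma> (fst p) (snd p)) ` (S \<times> {0..1}) \<subseteq> S"
    by (auto intro: \<gamma>S)
  have cont\<theta>: "continuous_on (S \<times> {0..1}) (\<lambda>p. g (\<gamma> (fst p) (snd p)))" if "smooth_on S g" for g :: "'a \<Rightarrow> real"
    using continuous_on_compose2[OF smooth_on_continuous[OF that] contg[unfolded split_beta] \<gamma>im] .
  have contfx: "continuous_on (S \<times> {0..1}) (\<lambda>(u, s). fx u s)"
  proof (rule continuous_on_blinfun_componentwise)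
    fix i :: 'a assume "i \<in> Basis"
    have "continuous_on (S \<times> {0..1}) (\<lambda>p. \<theta> (\<gamma> (fst p) (snd p)) i + snd p *
        (\<Sum>b\<in>Basis. ((fst p - c) \<bullet> b) *\<^sub>R D (\<lambda>y. \<theta> y i) (\<gamma> (fst p) (snd p)) b))"
      by (intro continuous_intros cont\<theta> smo smooth_on_D)
    moreover have "blinfun_apply (case p of (u, s) \<Rightarrow> fx u s) i = \<theta> (\<gamma> (fst p) (snd p)) i + snd p *
        (\<Sum>b\<in>Basis. ((fst p - c) \<bullet> b) *\<^sub>R D (\<lambda>y. \<theta> y i) (\<gamma> (fst p) (snd p)) b)" if "p \<in> S \<times> {0..1}" for p
      using that linear_sum_Basis[OF smooth_on_linear_D[OF smo \<gamma>S[of "fst p" "snd p"]], of i "fst p - c"]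
      by (auto simp: fx split_beta)
    ultimately show "continuous_on (S \<times> {0..1}) (\<lambda>p. blinfun_apply (case p of (u, s) \<Rightarrow> fx u s) i)"
      by (simp cong: continuous_on_cong)
  qed
  have slice: "continuous_on {0..1} (\<lambda>s. g (\<gamma> u s))" if "smooth_on S g" "u \<in> S" for g :: "'a \<Rightarrow> real" and u
    by (rule continuous_on_compose2[OF smooth_on_continuous[OF that(1)]])
      (use \<gamma>S that in \<open>auto simp: \<gamma>_def intro!: continuous_intros\<close>)
  have slicefx: "continuous_on {0..1} (fx u)" if "u \<in> S" for u
  proof -
    have "continuous_on {0..1} (\<lambda>s. (u, s))" by (intro continuous_intros)
    moreover have "(\<lambda>s. (u, s)) ` {0..1} \<subseteq> S \<times> {0..1::real}" using that by auto
    ultimately have "continuous_on {0..1} (\<lambda>s. case (u, s) of (u, s) \<Rightarrow> fx u s)"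
      by (rule continuous_on_compose2[OF contfx])
    then show ?thesis by simp
  qed
  have int: "integral {0..1} (fx u) = Blinfun (\<theta> u)" if "u \<in> S" for u
  proof (rule blinfun_eqI)
    fix w
    have "blinfun_apply (integral {0..1} (fx u)) w = integral {0..1} (\<lambda>s. blinfun_apply (fx u s) w)"
      using slicefx[OF that] by (intro blinfun_apply_integral integrable_continuous_interval)
    also have "\<dots> = integral {0..1} (\<lambda>s. \<theta> (\<gamma> u s) w + s * D (\<lambda>y. \<theta> y w) (\<gamma> u s) (u - c))"
      by (intro integral_cong) (simp add: fx[OF that])
    also have "\<dots> = 1 * \<theta> (\<gamma> u 1) w - 0 * \<theta> (\<gamma> u 0) w"
    proof (intro integral_unique fundamental_theorem_of_calculus)
      fix s :: real assume s: "s \<in> {0..1}"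
      have "((\<lambda>s. \<theta> (\<gamma> u s) w) has_real_derivative D (\<lambda>y. \<theta> y w) (\<gamma> u s) (u - c)) (at s)"
        using has_real_derivative_line[of "\<lambda>y. \<theta> y w" c s "u - c"]
          smooth_on_differentiable[OF smo \<gamma>S[OF that s]] by (simp add: \<gamma>_def)
      then have "((\<lambda>s. s * \<theta> (\<gamma> u s) w) has_real_derivative
          \<theta> (\<gamma> u s) w + s * D (\<lambda>y. \<theta> y w) (\<gamma> u s) (u - c)) (at s)"
        by (auto intro!: derivative_eq_intros)
      then show "((\<lambda>s. s * \<theta> (\<gamma> u s) w) has_vector_derivative
          \<theta> (\<gamma> u s) w + s * D (\<lambda>y. \<theta> y w) (\<gamma> u s) (u - c)) (at s within {0..1})"
        unfolding has_real_derivative_iff_has_vector_derivative by (rule has_vector_derivative_at_within)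
    qed simp
    also have "\<dots> = \<theta> u w" by (simp add: \<gamma>_def)
    also have "\<dots> = blinfun_apply (Blinfun (\<theta> u)) w"
      using lin[OF that] by (simp add: bounded_linear_Blinfun_apply linear_conv_bounded_linear)
    finally show "blinfun_apply (integral {0..1} (fx u)) w = blinfun_apply (Blinfun (\<theta> u)) w" .
  qed
  show ?thesis
  proof
    fix u assume u: "u \<in> S"
    have "((\<lambda>u. integral (cbox 0 1) (F u)) has_derivative integral (cbox 0 1) (fx u)) (at u within S)"
    proof (rule leibniz_rule[OF _ _ _ u S(2)])
      show "F y integrable_on cbox 0 1" if "y \<in> S" for y
        using slice[OF smo that, of "y - c"] by (auto simp: F_def intro!: integrable_continuous_interval)
    qed (use dF contfx in auto)
    then show "((\<lambda>u. integral {0..1} (F u)) has_derivative \<theta> u) (at u)"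
      using int[OF u] lin[OF u] at_within_open[OF u S(1)]
      by (simp add: bounded_linear_Blinfun_apply linear_conv_bounded_linear)
  qed
qed (use that in auto)

text \<open>The isomorphism j makes \<open>j (f u)\<close> a self-map of 'a, to which
  \<open>inverse_function_theorem\<close> applies and gives a differentiable inverse.
  Differentiating f after g as the identity yields an injective linear system for the derivative of
  the inverse, with coefficients \<open>D f (g (j z))\<close>, so \<open>Ck_on_linear_system\<close>
  raises the regularity one order at a time.\<close>

lemma smooth_local_inverse:
  fixes f :: "'a::euclidean_space \<Rightarrow> 'c::euclidean_space"
  assumes U: "open U" "u0 \<in> U" and f: "smooth_on U f" and inj: "\<And>u. u \<in> U \<Longrightarrow> inj (D f u)"
    and dim: "DIM('a) = DIM('c)"
  obtains U' V g where "open U'" "U' \<subseteq> U" "u0 \<in> U'" "open V" "f ` U' = V" "g ` V = U'"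
    "\<And>u. u \<in> U' \<Longrightarrow> g (f u) = u" "\<And>z. z \<in> V \<Longrightarrow> f (g z) = z" "smooth_on V g"
proof -
  obtain j :: "'c \<Rightarrow> 'a" and k :: "'a \<Rightarrow> 'c" where jk: "linear j" "linear k" "\<And>y. k (j y) = y" "\<And>y. j (k y) = y"
    using isomorphisms_UNIV_UNIV[OF dim[symmetric]] by metis
  have bj: "bounded_linear j" and bk: "bounded_linear k" using jk by (auto simp: linear_conv_bounded_linear)
  define f' where "f' u = Blinfun (\<lambda>v. j (D f u v))" for u
  have f': "blinfun_apply (f' u) = (\<lambda>v. j (D f u v))" if "u \<in> U" for u
    unfolding f'_def
    using bounded_linear_compose[OF bj has_derivative_bounded_linear[OF smooth_on_has_derivative[OF f that]]]
    by (rule bounded_linear_Blinfun_apply)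
  have lin: "linear (D f u)" if "u \<in> U" for u by (rule smooth_on_linear_D[OF f that])
  have der: "((\<lambda>u. j (f u)) has_derivative blinfun_apply (f' u)) (at u)" if "u \<in> U" for u
    unfolding f'[OF that] by (rule bounded_linear.has_derivative[OF bj smooth_on_has_derivative[OF f that]])
  have cont: "continuous_on U f'"
  proof (rule continuous_on_blinfun_componentwise)
    fix i :: 'a
    have "continuous_on U (\<lambda>u. j (D f u i))"
      by (intro bounded_linear.continuous_on[OF bj] smooth_on_continuous smooth_on_D f)
    then show "continuous_on U (\<lambda>u. blinfun_apply (f' u) i)" by (simp add: f' cong: continuous_on_cong)
  qed
  have lin0: "linear (\<lambda>v. j (D f u0 v))" using linear_compose[OF lin[OF U(2)] jk(1)] by (simp add: o_def)
  moreover have "inj (\<lambda>v. j (D f u0 v))"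
    using inj[OF U(2)] jk(3) unfolding inj_def by metis
  ultimately obtain m where m: "linear m" "m \<circ> (\<lambda>v. j (D f u0 v)) = id"
    using linear_injective_left_inverse by blast
  have "Blinfun m o\<^sub>L f' u0 = id_blinfun"
    using m(2) by (intro blinfun_eqI)
      (simp add: f'[OF U(2)] bounded_linear_Blinfun_apply m(1)[unfolded linear_conv_bounded_linear] fun_eq_iff)
  from inverse_function_theorem[OF U(1) der cont U(2) this]
  obtain U' V g g' where loc: "open U'" "U' \<subseteq> U" "u0 \<in> U'" "open V" "homeomorphism U' V (\<lambda>u. j (f u)) g"
    and dg: "\<And>y. y \<in> V \<Longrightarrow> (g has_derivative g' y) (at y)"
    by metis
  define W where "W = j -` V"
  have W: "open W" unfolding W_def
    using loc(4) bj by (simp add: continuous_open_vimage linear_continuous_at)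
  have gV: "g ` V = U'" "\<And>u. u \<in> U' \<Longrightarrow> j (f u) \<in> V" "\<And>u. u \<in> U' \<Longrightarrow> g (j (f u)) = u"
    "\<And>y. y \<in> V \<Longrightarrow> j (f (g y)) = y" "\<And>y. y \<in> V \<Longrightarrow> g y \<in> U'"
    using loc(5) unfolding homeomorphism_def by auto
  have fg: "f (g (j z)) = z" if "z \<in> W" for z
    using gV(4)[of "j z"] that jk(3) unfolding W_def vimage_def by (metis mem_Collect_eq)
  have dgj: "((\<lambda>z. g (j z)) has_derivative (\<lambda>w. g' (j z) (j w))) (at z)" if "z \<in> W" for z
    using has_derivative_compose[OF bounded_linear_imp_has_derivative[OF bj] dg[of "j z"]] that
    by (simp add: W_def)
  have inU: "g (j z) \<in> U" if "z \<in> W" for z using gV(5) loc(2) that by (auto simp: W_def)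
  have inv: "D f (g (j z)) (D (\<lambda>z. g (j z)) z w) = w" if "z \<in> W" for z w
  proof -
    have "((\<lambda>z. f (g (j z))) has_derivative (\<lambda>w. D f (g (j z)) (D (\<lambda>z. g (j z)) z w))) (at z)"
      using has_derivative_compose[OF dgj[OF that] smooth_on_has_derivative[OF f inU[OF that]]]
      by (simp add: D_eqI[OF dgj[OF that]])
    moreover have "((\<lambda>z. f (g (j z))) has_derivative (\<lambda>w. w)) (at z)"
      by (rule has_derivative_transform_within_open[OF has_derivative_ident W that]) (simp add: fg)
    ultimately show ?thesis by (metis has_derivative_unique)
  qed
  have "Ck_on i W (\<lambda>z. g (j z))" for i
  proof (induction i)
    case 0
    show ?case using dgj by (auto intro!: continuous_at_imp_continuous_on has_derivative_continuous)
  next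
    case (Suc i)
    have "Ck_on i W (\<lambda>z. D (\<lambda>z. g (j z)) z w)" for w
    proof (rule Ck_on_linear_system[where B = "\<lambda>z. D f (g (j z))" and r = "\<lambda>z. w"])
      show "Ck_on i W (\<lambda>z. D f (g (j z)) v)" for v
        using smooth_on_D[OF f, of v] by (intro Ck_on_compose[OF W U(1) _ Suc]) (auto simp: inU smooth_on_def)
    qed (use W inU lin inj inv Ck_on_const in auto)
    then show ?case using dgj by (auto intro: differentiableI)
  qed
  then have "smooth_on W (\<lambda>z. g (j z))" by (simp add: smooth_on_def)
  moreover have "f ` U' = W"
  proof
    show "f ` U' \<subseteq> W" using gV(2) by (auto simp: W_def)
    have "z \<in> f ` U'" if "z \<in> W" for z
      using fg[OF that] gV(5)[of "j z"] that by (metis W_def imageI vimageE)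
    then show "W \<subseteq> f ` U'" by blast
  qed
  moreover have "(\<lambda>z. g (j z)) ` W = U'"
  proof
    show "(\<lambda>z. g (j z)) ` W \<subseteq> U'" using gV(5) by (auto simp: W_def)
    have "u \<in> (\<lambda>z. g (j z)) ` W" if "u \<in> U'" for u
      using gV(2,3)[OF that] by (metis W_def imageI vimageI)
    then show "U' \<subseteq> (\<lambda>z. g (j z)) ` W" by blast
  qed
  ultimately show ?thesis using that[of U' W "\<lambda>z. g (j z)"] loc W fg gV(3) by blast
qed

section \<open>Bilinear forms and traces\<close>

lemma bilinear_sum_left: "bilinear h \<Longrightarrow> h (sum f I) w = (\<Sum>i\<in>I. h (f i) w)"
  using linear_sum[of "\<lambda>x. h x w" f I] by (simp add: bilinear_def)

text \<open>On the line \<open>s *\<^sub>R v0 + w\<close> the quadratic form is affine in s, because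
  its value at v0 is zero. With a nonzero slope it would take the value -1, which is the choice of s
  below.\<close>

lemma psd_form_kernel:
  fixes Q :: "'a::real_vector \<Rightarrow> 'a \<Rightarrow> real"
  assumes Q: "bilinear Q" "\<And>v w. Q v w = Q w v" and V: "subspace V" "v0 \<in> V" "w \<in> V"
    and psd: "\<And>v. v \<in> V \<Longrightarrow> Q v v \<ge> 0" and zero: "Q v0 v0 = 0"
  shows "Q v0 w = 0"
proof (rule ccontr)
  assume ne: "Q v0 w \<noteq> 0"
  have expand: "Q (s *\<^sub>R v0 + w) (s *\<^sub>R v0 + w) = 2 * s * Q v0 w + Q w w" for s
    using Q(2)[of w v0] zero
    by (simp add: bilinear_ladd[OF Q(1)] bilinear_radd[OF Q(1)] bilinear_lmul[OF Q(1)] bilinear_rmul[OF Q(1)])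
  define s where "s = - (Q w w + 1) / (2 * Q v0 w)"
  have "2 * s * Q v0 w = - (Q w w + 1)" using ne by (simp add: s_def)
  then have "2 * s * Q v0 w + Q w w = -1" by linarith
  moreover have "s *\<^sub>R v0 + w \<in> V" using V by (simp add: subspace_add subspace_scale)
  ultimately show False using psd[of "s *\<^sub>R v0 + w"] expand[of s] by simp
qed

text \<open>Let r be the maximum of the quotient \<sigma> v v / h v v over the unit sphere of V,
  attained at v0. Then r h - \<sigma> is nonnegative on V and vanishes at v0, so
  \<open>psd_form_kernel\<close> makes v0 an eigenvector; its h-orthogonal complement in V is
  handled by induction on the dimension.\<close>

lemma simultaneous_diagonalization:
  fixes h \<sigma> :: "'a::euclidean_space \<Rightarrow> 'a \<Rightarrow> real"
  assumes h: "bilinear h" "\<And>v w. h v w = h w v" "\<And>v. v = 0 \<or> h v v > 0"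
    and \<sigma>: "bilinear \<sigma>" "\<And>v w. \<sigma> v w = \<sigma> w v"
    and "subspace V"
  shows "\<exists>B. finite B \<and> B \<subseteq> V \<and> (\<forall>b\<in>B. \<forall>c\<in>B. h b c = (if b = c then 1 else 0)) \<and>
    (\<forall>b\<in>B. \<forall>c\<in>B. b \<noteq> c \<longrightarrow> \<sigma> b c = 0) \<and> (\<forall>v\<in>V. v = (\<Sum>b\<in>B. h v b *\<^sub>R b))"
  using assms(6)
proof (induction "dim V" arbitrary: V rule: less_induct)
  case less
  have h_pos: "h v v > 0" if "v \<noteq> 0" for v using h(3)[of v] that by simp
  show ?case
  proof (cases "V \<subseteq> {0}")
    case True
    then show ?thesis by (intro exI[of _ "{}"]) auto
  next
    case False
    then obtain v1 where v1: "v1 \<in> V" "v1 \<noteq> 0" by auto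
    define Sp where "Sp = sphere 0 1 \<inter> V"
    have "compact Sp" unfolding Sp_def using closed_subspace[OF less.prems] by (simp add: compact_Int_closed)
    moreover have "(1 / norm v1) *\<^sub>R v1 \<in> Sp" using v1 less.prems by (simp add: Sp_def subspace_scale)
    then have "Sp \<noteq> {}" by auto
    moreover have "continuous_on Sp (\<lambda>v. \<sigma> v v / h v v)"
    proof (rule continuous_on_divide; (intro ballI)?)
      show c2: "continuous_on Sp (\<lambda>v. h v v)" and c1: "continuous_on Sp (\<lambda>v. \<sigma> v v)"
        using bounded_bilinear.continuous_on[OF h(1)[unfolded bilinear_conv_bounded_bilinear] continuous_on_id continuous_on_id]
          bounded_bilinear.continuous_on[OF \<sigma>(1)[unfolded bilinear_conv_bounded_bilinear] continuous_on_id continuous_on_id] .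
      show "h v v \<noteq> 0" if "v \<in> Sp" for v
      proof -
        have "v \<noteq> 0" using that by (auto simp: Sp_def)
        then show ?thesis using h_pos[of v] by simp
      qed
    qed
    ultimately obtain v0 where v0: "v0 \<in> Sp" "\<And>v. v \<in> Sp \<Longrightarrow> \<sigma> v v / h v v \<le> \<sigma> v0 v0 / h v0 v0"
      using continuous_attains_sup[of Sp "\<lambda>v. \<sigma> v v / h v v"] by blast
    define r where "r = \<sigma> v0 v0 / h v0 v0"
    have v0': "v0 \<noteq> 0" "v0 \<in> V" using v0(1) by (auto simp: Sp_def)
    define Q where "Q v w = r * h v w - \<sigma> v w" for v w
    have Qb: "bilinear Q"
      unfolding bilinear_def
      by (intro conjI allI linearI)
        (simp_all add: Q_def algebra_simps bilinear_ladd[OF h(1)] bilinear_radd[OF h(1)] bilinear_lmul[OF h(1)]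
          bilinear_rmul[OF h(1)] bilinear_ladd[OF \<sigma>(1)] bilinear_radd[OF \<sigma>(1)] bilinear_lmul[OF \<sigma>(1)]
          bilinear_rmul[OF \<sigma>(1)])
    have psd: "Q v v \<ge> 0" if "v \<in> V" for v
    proof (cases "v = 0")
      case False
      let ?w = "(1 / norm v) *\<^sub>R v"
      have w: "?w \<in> Sp" using that False less.prems by (simp add: Sp_def subspace_scale)
      then have "?w \<noteq> 0" by (auto simp: Sp_def)
      then have "h ?w ?w > 0" by (rule h_pos)
      then have "\<sigma> ?w ?w \<le> r * h ?w ?w" using v0(2)[OF w] by (simp only: r_def[symmetric] pos_divide_le_eq)
      then have "Q ?w ?w \<ge> 0" by (simp add: Q_def)
      moreover have "Q ?w ?w = (1 / norm v) * (1 / norm v) * Q v v"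
        by (simp only: bilinear_lmul[OF Qb] bilinear_rmul[OF Qb] real_scaleR_def mult.assoc)
      moreover have "(1 / norm v) * (1 / norm v) > 0" using False by simp
      ultimately show ?thesis by (metis mult_pos_neg not_le)
    qed (simp add: bilinear_lzero[OF Qb])
    have "Q v0 v0 = 0" using h_pos[OF v0'(1)] by (simp add: Q_def r_def)
    then have ker: "Q v0 w = 0" if "w \<in> V" for w
      using psd_form_kernel[OF Qb _ less.prems v0'(2) that psd] by (simp add: Q_def h(2) \<sigma>(2))
    define e where "e = (1 / sqrt (h v0 v0)) *\<^sub>R v0"
    have hv0: "h v0 v0 > 0" by (rule h_pos[OF v0'(1)])
    have e: "e \<in> V" "h e e = 1" 
      using v0' hv0 less.prems by (auto simp: e_def subspace_scale bilinear_lmul[OF h(1)] bilinear_rmul[OF h(1)])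
    have \<sigma>e: "\<sigma> e w = r * h e w" if "w \<in> V" for w
      using ker[OF that] by (simp add: e_def Q_def bilinear_lmul[OF h(1)] bilinear_lmul[OF \<sigma>(1)])
    define V' where "V' = {v \<in> V. h v e = 0}"
    have sub: "subspace V'"
      using less.prems unfolding V'_def subspace_def
      by (auto simp: bilinear_lzero[OF h(1)] bilinear_ladd[OF h(1)] bilinear_lmul[OF h(1)])
    have "e \<notin> V'" "V' \<subseteq> V" using e by (auto simp: V'_def)
    then have "V' \<subset> V" using e(1) by blast
    then have "dim V' < dim V"
      using sub less.prems by (metis dim_psubset span_eq_iff)
    from less.hyps[OF this sub] obtain B where B: "finite B" "B \<subseteq> V'"
      "\<And>b c. b \<in> B \<Longrightarrow> c \<in> B \<Longrightarrow> h b c = (if b = c then 1 else 0)"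
      "\<And>b c. b \<in> B \<Longrightarrow> c \<in> B \<Longrightarrow> b \<noteq> c \<Longrightarrow> \<sigma> b c = 0"
      "\<And>v. v \<in> V' \<Longrightarrow> v = (\<Sum>b\<in>B. h v b *\<^sub>R b)" by metis
    have BV: "b \<in> V" "h b e = 0" "h e b = 0" if "b \<in> B" for b using B(2) that h(2) by (auto simp: V'_def)
    have eB: "e \<notin> B" using BV(2)[of e] e(2) by auto
    show ?thesis
    proof (intro exI[of _ "insert e B"] conjI ballI impI)
      fix v assume v: "v \<in> V"
      let ?v = "v - h v e *\<^sub>R e"
      have "?v \<in> V'"
        using v e less.prems by (simp add: V'_def subspace_diff subspace_scale bilinear_lsub[OF h(1)] bilinear_lmul[OF h(1)])
      from B(5)[OF this] have "?v = (\<Sum>b\<in>B. h ?v b *\<^sub>R b)" .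
      also have "\<dots> = (\<Sum>b\<in>B. h v b *\<^sub>R b)"
        by (intro sum.cong refl) (simp add: bilinear_lsub[OF h(1)] bilinear_lmul[OF h(1)] BV)
      finally show "v = (\<Sum>b\<in>insert e B. h v b *\<^sub>R b)" using B(1) eB by (simp add: algebra_simps)
    next
      fix b c assume "b \<in> insert e B" "c \<in> insert e B" "b \<noteq> c"
      then show "\<sigma> b c = 0"
        using \<sigma>e[of c] \<sigma>e[of b] BV B(4) \<sigma>(2)[of b e] by auto
    qed (use B(1,2,3) BV e eB in \<open>auto simp: V'_def\<close>)
  qed
qed

text \<open>The trace is taken over the Euclidean \<open>Basis\<close> although h is unrelated to
  the inner product: expanding b in the frame and \<open>A (e i)\<close> in \<open>Basis\<close>
  leads to the same double sum.\<close>

lemma trace_frame: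
  fixes A :: "'a::euclidean_space \<Rightarrow> 'a" and h :: "'a \<Rightarrow> 'a \<Rightarrow> real"
  assumes A: "linear A" and h: "bilinear h" and rep: "\<And>v. v = (\<Sum>i\<in>I. h v (e i) *\<^sub>R e i)"
  shows "(\<Sum>b\<in>Basis. A b \<bullet> b) = (\<Sum>i\<in>I. h (A (e i)) (e i))"
proof -
  have "A b \<bullet> b = (\<Sum>i\<in>I. h ((A (e i) \<bullet> b) *\<^sub>R b) (e i))" for b
  proof -
    have "A b = (\<Sum>i\<in>I. h b (e i) *\<^sub>R A (e i))"
      using arg_cong[OF rep[of b], of A] by (simp add: linear_sum[OF A] linear_scale[OF A])
    then have "A b \<bullet> b = (\<Sum>i\<in>I. h b (e i) * (A (e i) \<bullet> b))" by (simp add: inner_sum_left)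
    then show ?thesis by (simp add: bilinear_lmul[OF h] mult.commute)
  qed
  then have "(\<Sum>b\<in>Basis. A b \<bullet> b) = (\<Sum>i\<in>I. \<Sum>b\<in>Basis. h ((A (e i) \<bullet> b) *\<^sub>R b) (e i))"
    by (simp only: sum.swap[of _ I Basis])
  then show ?thesis by (simp add: bilinear_sum_left[OF h, symmetric] euclidean_representation)
qed

text \<open>Serves to remove the commutator of \<open>L u w\<close> and \<open>K u v\<close> when
  the Codazzi equation is traced in \<open>\<theta>_closed\<close>.\<close>

lemma trace_mult_commute:
  fixes A B :: "'a::euclidean_space \<Rightarrow> 'a"
  assumes "linear A" "linear B"
  shows "(\<Sum>b\<in>Basis. A (B b) \<bullet> b) = (\<Sum>b\<in>Basis. B (A b) \<bullet> b)"
proof -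
  have "A (B b) \<bullet> b = (\<Sum>c\<in>Basis. (B b \<bullet> c) * (A c \<bullet> b))" if "linear A" for A B :: "'a \<Rightarrow> 'a" and b
    by (simp add: linear_sum_Basis[OF that, of "B b"] inner_sum_left)
  note this[OF assms(1), of B] this[OF assms(2), of A]
  moreover have "(\<Sum>b\<in>(Basis::'a set). \<Sum>c\<in>Basis. (B b \<bullet> c) * (A c \<bullet> b)) = (\<Sum>c\<in>Basis. \<Sum>b\<in>Basis. (A c \<bullet> b) * (B b \<bullet> c))"
    by (subst sum.swap) (simp only: mult.commute)
  ultimately show ?thesis by simp
qed

lemma orthonormal_frame_representation:
  fixes h :: "'a::euclidean_space \<Rightarrow> 'a \<Rightarrow> real"
  assumes h: "bilinear h"
    and on: "\<And>i j. i < DIM('a) \<Longrightarrow> j < DIM('a) \<Longrightarrow> h (e i) (e j) = (if i = j then 1 else 0)"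
  shows "v = (\<Sum>i<DIM('a). h v (e i) *\<^sub>R e i)"
proof -
  let ?n = "DIM('a)"
  have comb: "h (\<Sum>i<?n. c i *\<^sub>R e i) (e j) = c j" if "j < ?n" for c j
    using that by (simp add: bilinear_sum_left[OF h] bilinear_lmul[OF h] on if_distrib[of "\<lambda>x. _ * x"] sum.delta
        cong: if_cong)
  have inj: "inj_on e {..<?n}"
    by (intro inj_onI) (metis on lessThan_iff zero_neq_one)
  have "independent (e ` {..<?n})"
  proof (rule independent_if_scalars_zero)
    fix f x assume f: "(\<Sum>x\<in>e ` {..<?n}. f x *\<^sub>R x) = 0" and "x \<in> e ` {..<?n}"
    then obtain j where j: "j < ?n" "x = e j" by auto
    have "(\<Sum>i<?n. f (e i) *\<^sub>R e i) = 0" using f by (simp add: sum.reindex[OF inj])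
    then show "f x = 0" using comb[OF j(1), of "\<lambda>i. f (e i)"] j(2) by (simp add: bilinear_lzero[OF h])
  qed simp
  moreover have "card (e ` {..<?n}) = ?n" by (simp add: card_image[OF inj])
  ultimately have "v \<in> span (e ` {..<?n})"
    using card_ge_dim_independent[of "e ` {..<?n}" UNIV] by (simp add: dim_UNIV) blast
  then obtain c where "v = (\<Sum>x\<in>e ` {..<?n}. c x *\<^sub>R x)" by (auto simp: span_finite)
  then have v: "v = (\<Sum>i<?n. c (e i) *\<^sub>R e i)" by (simp add: sum.reindex[OF inj])
  then have "h v (e j) = c (e j)" if "j < ?n" for j using comb[OF that, of "\<lambda>i. c (e i)"] by simp
  then show ?thesis using v by simp
qed

section \<open>The hypersurface in a chart\<close>

text \<open>In a chart, G and L are the coefficient maps of the induced and of the Levi-Civita connection: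
  the derivative of a field Y along v is D Y u v + G u v (Y u), respectively D Y u v + L u v (Y u).\<close>

locale centroaffine_chart =
  fixes \<Omega> :: "'a::euclidean_space set" and x :: "'a \<Rightarrow> 'f::euclidean_space" and \<epsilon> :: real
    and h :: "'a \<Rightarrow> 'a \<Rightarrow> 'a \<Rightarrow> real" and G L :: "'a \<Rightarrow> 'a \<Rightarrow> 'a \<Rightarrow> 'a" and T :: "'a \<Rightarrow> 'a" and \<alpha> :: "'a \<Rightarrow> real"
  assumes open_\<Omega>: "open \<Omega>" and dim_a: "DIM('a) \<ge> 3" and \<epsilon>: "\<epsilon> \<noteq> 0"
    and smooth_x: "smooth_on \<Omega> x" and smooth_h: "smooth_on \<Omega> (\<lambda>y. h y v w)"
    and smooth_G: "smooth_on \<Omega> (\<lambda>y. G y v w)" and smooth_L: "smooth_on \<Omega> (\<lambda>y. L y v w)"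
    and smooth_T: "smooth_on \<Omega> T" and smooth_\<alpha>: "smooth_on \<Omega> \<alpha>"
    and bil_h: "u \<in> \<Omega> \<Longrightarrow> bilinear (h u)" and bil_G: "u \<in> \<Omega> \<Longrightarrow> bilinear (G u)"
    and bil_L: "u \<in> \<Omega> \<Longrightarrow> bilinear (L u)"
    and h_pos: "u \<in> \<Omega> \<Longrightarrow> v \<noteq> 0 \<Longrightarrow> h u v v > 0"
    and transversal: "u \<in> \<Omega> \<Longrightarrow> D x u v = s *\<^sub>R x u \<Longrightarrow> v = 0 \<and> s = 0"
    and gauss: "u \<in> \<Omega> \<Longrightarrow> D (\<lambda>y. D x y v) u w = D x u (G u w v) - (\<epsilon> * h u w v) *\<^sub>R x u"
    and L_sym: "u \<in> \<Omega> \<Longrightarrow> L u v w = L u w v"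
    and metric: "u \<in> \<Omega> \<Longrightarrow> D (\<lambda>y. h y v w) u z = h u (L u z v) w + h u v (L u z w)"
    and tchebychev: "u \<in> \<Omega> \<Longrightarrow> \<exists>e. (\<forall>i<DIM('a). \<forall>j<DIM('a). h u (e i) (e j) = (if i = j then 1 else 0)) \<and>
      real DIM('a) *\<^sub>R T u = (\<Sum>i<DIM('a). G u (e i) (e i) - L u (e i) (e i))"
    and T_nz: "u \<in> \<Omega> \<Longrightarrow> T u \<noteq> 0"
    and K_T_perp: "u \<in> \<Omega> \<Longrightarrow> h u v (T u) = 0 \<Longrightarrow>
      G u (T u) v - L u (T u) v = \<alpha> u *\<^sub>R v \<and> D \<alpha> u v = 0"
    and K_T_T: "u \<in> \<Omega> \<Longrightarrow> G u (T u) (T u) - L u (T u) (T u) = (2 * \<alpha> u) *\<^sub>R T u"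
begin

definition K where "K u v w = G u v w - L u v w"
text \<open>The cubic form. The derivative of h under the induced connection is -2 C, as fact
  \<open>Dh\<close> in the proof of \<open>codazzi_C\<close> shows.\<close>

definition C where "C u v w z = h u (K u v w) z"
definition \<theta> where "\<theta> u v = h u (T u) v"
definition q where "q u = h u (T u) (T u)"
definition S where "S u v = D T u v + L u v (T u)"
definition \<sigma> where "\<sigma> u v w = h u (S u v) w"

text \<open>N u w is the Levi-Civita derivative of the cubic form C in the direction w.\<close>

definition N where "N u w v z c = D (\<lambda>y. C y v z c) u w - C u (L u w v) z c - C u v (L u w z) c - C u v z (L u w c)"

lemma bil_K: "u \<in> \<Omega> \<Longrightarrow> bilinear (K u)"
  using bil_G bil_L unfolding bilinear_def K_def by (auto intro!: linear_compose_sub)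

lemmas lin_h = bilinear_ladd[OF bil_h] bilinear_radd[OF bil_h] bilinear_lsub[OF bil_h] bilinear_rsub[OF bil_h]
  bilinear_lmul[OF bil_h] bilinear_rmul[OF bil_h] bilinear_lzero[OF bil_h] bilinear_rzero[OF bil_h]
  bilinear_lneg[OF bil_h] bilinear_rneg[OF bil_h]
lemmas lin_K = bilinear_ladd[OF bil_K] bilinear_radd[OF bil_K] bilinear_lsub[OF bil_K] bilinear_rsub[OF bil_K]
  bilinear_lmul[OF bil_K] bilinear_rmul[OF bil_K] bilinear_lzero[OF bil_K] bilinear_rzero[OF bil_K]
  bilinear_lneg[OF bil_K] bilinear_rneg[OF bil_K]
lemmas lin_L = bilinear_ladd[OF bil_L] bilinear_radd[OF bil_L] bilinear_lsub[OF bil_L] bilinear_rsub[OF bil_L]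
  bilinear_lmul[OF bil_L] bilinear_rmul[OF bil_L] bilinear_lzero[OF bil_L] bilinear_rzero[OF bil_L]
  bilinear_lneg[OF bil_L] bilinear_rneg[OF bil_L]

lemma linear_h: "u \<in> \<Omega> \<Longrightarrow> linear (h u v)" "u \<in> \<Omega> \<Longrightarrow> linear (\<lambda>v. h u v w)"
  using bil_h by (auto simp: bilinear_def)

lemma linear_L: "u \<in> \<Omega> \<Longrightarrow> linear (L u v)" "u \<in> \<Omega> \<Longrightarrow> linear (\<lambda>v. L u v w)"
  using bil_L by (auto simp: bilinear_def)

lemma linear_K: "u \<in> \<Omega> \<Longrightarrow> linear (K u v)" "u \<in> \<Omega> \<Longrightarrow> linear (\<lambda>v. K u v w)"
  using bil_K by (auto simp: bilinear_def)

lemma lin_C: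
  assumes "u \<in> \<Omega>"
  shows "C u (v + v') w z = C u v w z + C u v' w z" "C u (v - v') w z = C u v w z - C u v' w z"
    "C u (r *\<^sub>R v) w z = r * C u v w z" "C u 0 w z = 0"
    "C u v (w + w') z = C u v w z + C u v w' z" "C u v (w - w') z = C u v w z - C u v w' z"
    "C u v (r *\<^sub>R w) z = r * C u v w z" "C u v 0 z = 0"
    "C u v w (z + z') = C u v w z + C u v w z'" "C u v w (z - z') = C u v w z - C u v w z'"
    "C u v w (r *\<^sub>R z) = r * C u v w z" "C u v w 0 = 0"
  using assms by (simp_all add: C_def lin_K lin_h)

lemma smooth_K: "smooth_on \<Omega> (\<lambda>y. K y v w)"
  unfolding K_def by (intro smooth_on_diff open_\<Omega> smooth_G smooth_L)

lemma smooth_h_left: "smooth_on \<Omega> A \<Longrightarrow> smooth_on \<Omega> (\<lambda>y. h y (A y) w)"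
  by (rule smooth_on_linear_field[OF open_\<Omega> linear_h(2) smooth_h])

lemma smooth_h_field: "smooth_on \<Omega> A \<Longrightarrow> smooth_on \<Omega> B \<Longrightarrow> smooth_on \<Omega> (\<lambda>y. h y (A y) (B y))"
  by (rule smooth_on_linear_field[OF open_\<Omega> linear_h(1) smooth_h_left])

lemma smooth_C: "smooth_on \<Omega> (\<lambda>y. C y v w z)"
  unfolding C_def by (intro smooth_h_left smooth_K)

lemma smooth_L_field: "smooth_on \<Omega> A \<Longrightarrow> smooth_on \<Omega> (\<lambda>y. L y v (A y))"
  by (rule smooth_on_linear_field[OF open_\<Omega> linear_L(1) smooth_L])

lemma smooth_S: "smooth_on \<Omega> (\<lambda>y. S y v)"
  unfolding S_def by (intro smooth_on_add open_\<Omega> smooth_on_D smooth_L_field smooth_T)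

lemma smooth_\<theta>: "smooth_on \<Omega> (\<lambda>y. \<theta> y v)"
  unfolding \<theta>_def by (intro smooth_h_left smooth_T)

lemma smooth_\<sigma>: "smooth_on \<Omega> (\<lambda>y. \<sigma> y v w)"
  unfolding \<sigma>_def by (intro smooth_h_left smooth_S)

lemma smooth_q: "smooth_on \<Omega> q"
  unfolding q_def[abs_def] by (intro smooth_h_field smooth_T)

lemma smooth_differentiable: "smooth_on \<Omega> f \<Longrightarrow> u \<in> \<Omega> \<Longrightarrow> f differentiable (at u)"
  by (rule smooth_on_differentiable)

lemma linear_Dx: "u \<in> \<Omega> \<Longrightarrow> linear (D x u)"
  by (rule smooth_on_linear_D[OF smooth_x])

lemma Dx_inj:
  assumes u: "u \<in> \<Omega>" and eq: "D x u v - r *\<^sub>R x u = D x u w - s *\<^sub>R x u"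
  shows "v = w" "r = s"
proof -
  have "D x u (v - w) = (r - s) *\<^sub>R x u"
    using eq by (simp add: linear_diff[OF linear_Dx[OF u]] algebra_simps)
  from transversal[OF u this] show "v = w" "r = s" by auto
qed

text \<open>Both symmetries come from the symmetry of the second derivative of the immersion, split
  into its tangential part (no torsion) and its part along x.\<close>

lemma h_sym: "u \<in> \<Omega> \<Longrightarrow> h u v w = h u w v" and G_sym: "u \<in> \<Omega> \<Longrightarrow> G u v w = G u w v"
proof -
  assume u: "u \<in> \<Omega>"
  have "D x u (G u v w) - (\<epsilon> * h u v w) *\<^sub>R x u = D x u (G u w v) - (\<epsilon> * h u w v) *\<^sub>R x u"
    using D_commute[OF open_\<Omega> u smooth_x, of w v] by (simp add: gauss[OF u])
  from Dx_inj[OF u this] \<epsilon> show "h u v w = h u w v" "G u v w = G u w v" by auto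
qed

lemma K_sym: "u \<in> \<Omega> \<Longrightarrow> K u v w = K u w v"
  by (simp add: K_def G_sym[of u v w] L_sym[of u v w])

lemma D_h_left:
  assumes u: "u \<in> \<Omega>" and A: "smooth_on \<Omega> A"
  shows "D (\<lambda>y. h y (A y) w) u z = h u (D A u z + L u z (A u)) w + h u (A u) (L u z w)"
  using D_linear_field[OF open_\<Omega> u linear_h(2) smooth_h A, of w z]
  by (simp add: metric[OF u] lin_h[OF u])

lemma D_h_field:
  assumes u: "u \<in> \<Omega>" and A: "smooth_on \<Omega> A" and B: "smooth_on \<Omega> B"
  shows "D (\<lambda>y. h y (A y) (B y)) u z =
    h u (D A u z + L u z (A u)) (B u) + h u (A u) (D B u z + L u z (B u))"
  using D_linear_field[OF open_\<Omega> u linear_h(1) smooth_h_left[OF A] B, of z]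
  by (simp add: D_h_left[OF u A] lin_h[OF u])

text \<open>The tangential and the transversal part of the symmetry of the third derivatives of the
  immersion: the Gauss and the Codazzi equation of the flat ambient connection.\<close>

lemma third_derivative_symmetry:
  assumes u: "u \<in> \<Omega>"
  shows "D (\<lambda>y. G y l i) u m + G u m (G u l i) - (\<epsilon> * h u l i) *\<^sub>R m =
      D (\<lambda>y. G y m i) u l + G u l (G u m i) - (\<epsilon> * h u m i) *\<^sub>R l"
    and "D (\<lambda>y. h y l i) u m + h u m (G u l i) = D (\<lambda>y. h y m i) u l + h u l (G u m i)"
proof -
  let ?P = "\<lambda>m l. D (\<lambda>y. G y l i) u m + G u m (G u l i) - (\<epsilon> * h u l i) *\<^sub>R m"
  let ?Q = "\<lambda>m l. D (\<lambda>y. h y l i) u m + h u m (G u l i)"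
  have "D (\<lambda>y. D (\<lambda>z. D x z i) y l) u m = D x u (?P m l) - (\<epsilon> * ?Q m l) *\<^sub>R x u" for m l
  proof -
    have sB: "smooth_on \<Omega> (\<lambda>y. D x y (G y l i))"
      by (rule smooth_on_linear_field[OF open_\<Omega> linear_Dx smooth_on_D[OF smooth_x] smooth_G])
    have sh: "smooth_on \<Omega> (\<lambda>y. \<epsilon> * h y l i)"
      by (intro smooth_on_mult open_\<Omega> smooth_on_const smooth_h)
    have "D (\<lambda>y. D (\<lambda>z. D x z i) y l) u m = D (\<lambda>y. D x y (G y l i) - (\<epsilon> * h y l i) *\<^sub>R x y) u m"
      by (rule fun_cong[OF D_cong[OF open_\<Omega> u gauss]])
    also have "\<dots> = D (\<lambda>y. D x y (G y l i)) u m - D (\<lambda>y. (\<epsilon> * h y l i) *\<^sub>R x y) u m"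
      by (intro D_diff smooth_differentiable[OF _ u] sB smooth_on_scaleR open_\<Omega> sh smooth_x)
    also have "D (\<lambda>y. D x y (G y l i)) u m = D (\<lambda>y. D x y (G u l i)) u m + D x u (D (\<lambda>y. G y l i) u m)"
      by (rule D_linear_field[OF open_\<Omega> u linear_Dx smooth_on_D[OF smooth_x] smooth_G])
    also have "D (\<lambda>y. (\<epsilon> * h y l i) *\<^sub>R x y) u m =
        (\<epsilon> * h u l i) *\<^sub>R D x u m + (\<epsilon> * D (\<lambda>y. h y l i) u m) *\<^sub>R x u"
      using D_scaleR[OF smooth_differentiable[OF sh u] smooth_differentiable[OF smooth_x u]]
        D_mult[OF differentiable_const smooth_differentiable[OF smooth_h u], of \<epsilon> l i m] by simp
    finally show ?thesis
      by (simp add: gauss[OF u] linear_add[OF linear_Dx[OF u]] linear_diff[OF linear_Dx[OF u]]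
          linear_scale[OF linear_Dx[OF u]] algebra_simps)
  qed
  then have "D x u (?P m l) - (\<epsilon> * ?Q m l) *\<^sub>R x u = D x u (?P l m) - (\<epsilon> * ?Q l m) *\<^sub>R x u"
    using D_commute[OF open_\<Omega> u smooth_on_D[OF smooth_x], of i l m] by simp
  from Dx_inj[OF u this] \<epsilon> show "?P m l = ?P l m" "?Q m l = ?Q l m" by auto
qed

text \<open>The exchange of the outer arguments is the transversal part of
  \<open>third_derivative_symmetry\<close>: once \<open>metric\<close> replaces the derivatives of
  h, the Levi-Civita terms cancel and \<open>h u z (K u v w) = h u v (K u z w)\<close>
  remains.\<close>

lemma C_sym:
  assumes u: "u \<in> \<Omega>"
  shows "C u v w z = C u w v z" "C u v w z = C u z w v" "C u v w z = C u v z w"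
proof -
  show 1: "C u v w z = C u w v z" for v w z by (simp add: C_def K_sym[OF u, of v w])
  show 2: "C u v w z = C u z w v" for v w z
  proof -
    have "h u (L u z v) w + h u v (L u z w) + h u z (G u v w) = h u (L u v z) w + h u z (L u v w) + h u v (G u z w)"
      using third_derivative_symmetry(2)[OF u, of v w z] by (simp add: metric[OF u])
    then show ?thesis
      by (simp add: C_def K_def lin_h[OF u] L_sym[OF u, of z v] h_sym[OF u, of z] h_sym[OF u, of v])
  qed
  show "C u v w z = C u v z w" by (metis 1 2)
qed

lemma N_sym1:
  assumes u: "u \<in> \<Omega>"
  shows "N u w a b c = N u w b a c" "N u w a b c = N u w a c b"
proof -
  have "D (\<lambda>y. C y a b c) u w = D (\<lambda>y. C y b a c) u w" "D (\<lambda>y. C y a b c) u w = D (\<lambda>y. C y a c b) u w"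
    by (rule fun_cong[OF D_cong[OF open_\<Omega> u]], metis C_sym)+
  then show "N u w a b c = N u w b a c" "N u w a b c = N u w a c b"
    unfolding N_def
    using C_sym(1)[OF u, of "L u w a" b c] C_sym(1)[OF u, of a "L u w b" c] C_sym(1)[OF u, of a b "L u w c"]
      C_sym(3)[OF u, of "L u w a" b c] C_sym(3)[OF u, of a "L u w b" c] C_sym(3)[OF u, of a b "L u w c"] by auto
qed

text \<open>The Codazzi equation with respect to the induced connection. By \<open>Dh\<close>, 2 C
  is a combination of terms h G and of one derivative of h. After a further differentiation the
  second derivatives of h cancel by symmetry, those of G by the tangential part of
  \<open>third_derivative_symmetry\<close>, and the terms with \<epsilon> by adding the versions
  with i and j exchanged.\<close>

lemma codazzi_C:
  assumes u: "u \<in> \<Omega>"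
  shows "D (\<lambda>y. C y l i j) u m + C u m (G u l i) j + C u m (G u l j) i =
    D (\<lambda>y. C y m i j) u l + C u l (G u m i) j + C u l (G u m j) i"
proof -
  have Dh: "D (\<lambda>y. h y a b) y m = h y (G y m a) b + h y a (G y m b) - 2 * C y m a b"
    if "y \<in> \<Omega>" for y a b m
  proof -
    have "h y a (K y m b) = C y m a b"
      using h_sym[OF that, of a "K y m b"] C_sym(3)[OF that, of m b a] by (simp add: C_def)
    moreover have "L y v w = G y v w - K y v w" for v w by (simp add: K_def)
    ultimately show ?thesis by (simp add: metric[OF that] lin_h[OF that] C_def)
  qed
  have eq: "2 * D (\<lambda>y. C y l i j) u m =
     (h u (D (\<lambda>y. G y l i) u m + G u m (G u l i)) j + h u (G u l i) (G u m j) - 2 * C u m (G u l i) j)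
   + (h u (D (\<lambda>y. G y l j) u m + G u m (G u l j)) i + h u (G u l j) (G u m i) - 2 * C u m (G u l j) i)
   - D (\<lambda>y. D (\<lambda>z. h z i j) y l) u m" for l m
  proof -
    have DhG: "D (\<lambda>y. h y (G y l a) b) u m =
        h u (D (\<lambda>y. G y l a) u m + G u m (G u l a)) b + h u (G u l a) (G u m b) - 2 * C u m (G u l a) b" for a b
      using D_linear_field[OF open_\<Omega> u linear_h(2) smooth_h smooth_G, of l a b m]
      by (simp add: Dh[OF u] lin_h[OF u])
    have sG: "smooth_on \<Omega> (\<lambda>y. h y (G y l a) b)" for a b by (intro smooth_h_left smooth_G)
    have "2 * D (\<lambda>y. C y l i j) u m = D (\<lambda>y. 2 * C y l i j) u m"
      by (rule D_bounded_linear[OF bounded_linear_mult_right smooth_differentiable[OF smooth_C u], symmetric])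
    also have "\<dots> =
        D (\<lambda>y. h y (G y l i) j + h y (G y l j) i - D (\<lambda>z. h z i j) y l) u m"
      by (rule fun_cong[OF D_cong[OF open_\<Omega> u]]) (simp add: Dh h_sym[of _ i])
    also have "\<dots> = D (\<lambda>y. h y (G y l i) j) u m + D (\<lambda>y. h y (G y l j) i) u m - D (\<lambda>y. D (\<lambda>z. h z i j) y l) u m"
      by (simp add: D_diff D_add smooth_differentiable[OF _ u] sG smooth_on_D smooth_h smooth_on_add open_\<Omega>)
    finally show ?thesis
      by (simp only: DhG)
  qed
  have P: "h u (D (\<lambda>y. G y l i) u m + G u m (G u l i)) j - \<epsilon> * h u l i * h u m j =
      h u (D (\<lambda>y. G y m i) u l + G u l (G u m i)) j - \<epsilon> * h u m i * h u l j" for i j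
    using arg_cong[OF third_derivative_symmetry(1)[OF u, of l i m], of "\<lambda>v. h u v j"]
    by (simp add: lin_h[OF u])
  show ?thesis
    using eq[of l m] eq[of m l] P[of i j] P[of j i] D_commute[OF open_\<Omega> u smooth_h, of i j l m]
      h_sym[OF u, of "G u l i" "G u m j"] h_sym[OF u, of "G u l j" "G u m i"]
    by (simp add: algebra_simps)
qed

text \<open>Replacing G by L + K in \<open>codazzi_C\<close> produces quadratic terms of the shape
  \<open>h u (K u l i) (K u m j)\<close>, which occur on both sides, so the equation persists for
  the Levi-Civita derivative.\<close>

lemma N_sym2:
  assumes u: "u \<in> \<Omega>"
  shows "N u m l i j = N u l m i j"
proof -
  have CK: "C u m (K u l i) j = C u l (K u m j) i" for m l i j
    using C_sym(3)[OF u, of m "K u l i" j] C_sym(3)[OF u, of l "K u m j" i]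
    by (simp add: C_def h_sym[OF u, of "K u m j"])
  have G: "G u v w = L u v w + K u v w" for v w by (simp add: K_def)
  show ?thesis
    using codazzi_C[OF u, of l i j m] CK[of m l i j] CK[of m l j i]
      C_sym(3)[OF u, of l i "L u m j"] C_sym(3)[OF u, of m i "L u l j"]
    by (simp add: N_def G lin_C[OF u] L_sym[OF u, of l m])
qed

lemma D_C_field:
  assumes u: "u \<in> \<Omega>" and A: "smooth_on \<Omega> A"
  shows "D (\<lambda>y. C y (A y) v c) u w =
    N u w (A u) v c + C u (D A u w + L u w (A u)) v c + C u (A u) (L u w v) c + C u (A u) v (L u w c)"
proof -
  have "linear (\<lambda>a. C y a v c)" if "y \<in> \<Omega>" for y using that by (auto intro!: linearI simp: lin_C)
  from D_linear_field[OF open_\<Omega> u this smooth_C A, of w] show ?thesis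
    by (simp add: N_def lin_C[OF u])
qed

text \<open>The total symmetry of C moves v to the last slot, where the frame sum of
  \<open>K u (e i) (e i)\<close> is n times T by definition of the Tchebychev field.\<close>

lemma trace_K: "u \<in> \<Omega> \<Longrightarrow> (\<Sum>b\<in>Basis. K u v b \<bullet> b) = real DIM('a) * \<theta> u v"
proof -
  assume u: "u \<in> \<Omega>"
  obtain e where e: "\<And>i j. i < DIM('a) \<Longrightarrow> j < DIM('a) \<Longrightarrow> h u (e i) (e j) = (if i = j then 1 else 0)"
    and T: "real DIM('a) *\<^sub>R T u = (\<Sum>i<DIM('a). K u (e i) (e i))"
    using tchebychev[OF u] unfolding K_def by metis
  have "(\<Sum>b\<in>Basis. K u v b \<bullet> b) = (\<Sum>i<DIM('a). h u (K u v (e i)) (e i))"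
    by (rule trace_frame[OF linear_K(1)[OF u] bil_h[OF u] orthonormal_frame_representation[OF bil_h[OF u] e]])
  also have "\<dots> = (\<Sum>i<DIM('a). h u (K u (e i) (e i)) v)"
    using C_sym[OF u] unfolding C_def by (intro sum.cong refl) metis
  also have "\<dots> = h u (real DIM('a) *\<^sub>R T u) v" by (simp add: T bilinear_sum_left[OF bil_h[OF u]])
  finally show ?thesis by (simp add: lin_h[OF u] \<theta>_def)
qed

lemma D_\<theta>: "u \<in> \<Omega> \<Longrightarrow> D (\<lambda>y. \<theta> y v) u w = \<sigma> u w v + \<theta> u (L u w v)"
  using D_h_left[OF _ smooth_T, of u v w] by (simp add: \<theta>_def \<sigma>_def S_def)

text \<open>\<open>KK\<close> is the Levi-Civita derivative of K, symmetric in its first two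
  arguments by \<open>N_sym2\<close>. Its trace over the last argument is n times the Levi-Civita
  derivative of \<theta>, as the commutator of \<open>L u w\<close> and \<open>K u v\<close> has
  trace zero.\<close>

lemma \<theta>_closed:
  assumes u: "u \<in> \<Omega>"
  shows "D (\<lambda>y. \<theta> y v) u w = D (\<lambda>y. \<theta> y w) u v"
proof -
  define KK where "KK w v z = D (\<lambda>y. K y v z) u w + L u w (K u v z) - K u (L u w v) z - K u v (L u w z)" for w v z
  have "h u (KK w v z) c = N u w v z c" for w v z c
    using D_h_left[OF u smooth_K, of v z c w] by (simp add: KK_def N_def C_def lin_h[OF u])
  then have "h u (KK w v z - KK v w z) c = 0" for w v z c using N_sym2[OF u] by (simp add: lin_h[OF u])
  then have KK: "KK w v z = KK v w z" for w v z
    using h_pos[OF u, of "KK w v z - KK v w z"] by (metis eq_iff_diff_eq_0 less_irrefl)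
  have "(\<Sum>b\<in>Basis. KK w v b \<bullet> b) = real DIM('a) * (D (\<lambda>y. \<theta> y v) u w - \<theta> u (L u w v))" for w v
  proof -
    have "(\<Sum>b\<in>Basis. D (\<lambda>y. K y v b) u w \<bullet> b) = D (\<lambda>y. \<Sum>b\<in>Basis. K y v b \<bullet> b) u w"
      by (simp add: D_sum D_bounded_linear[OF bounded_linear_inner_left] smooth_differentiable[OF smooth_K u]
          smooth_on_linear[OF bounded_linear_inner_left open_\<Omega> smooth_K] smooth_differentiable[OF _ u])
    also have "\<dots> = D (\<lambda>y. real DIM('a) * \<theta> y v) u w"
      by (rule fun_cong[OF D_cong[OF open_\<Omega> u trace_K]])
    also have "\<dots> = real DIM('a) * D (\<lambda>y. \<theta> y v) u w"
      by (rule D_bounded_linear[OF bounded_linear_mult_right smooth_differentiable[OF smooth_\<theta> u]])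
    finally show ?thesis
      using trace_mult_commute[OF linear_L(1)[OF u] linear_K(1)[OF u], of w v] trace_K[OF u, of "L u w v"]
      by (simp add: KK_def inner_add_left inner_diff_left sum.distrib sum_subtractf algebra_simps)
  qed
  from this[of w v] this[of v w] show ?thesis
    by (simp add: KK[of w v] L_sym[OF u, of w v])
qed

lemma \<sigma>_sym: "u \<in> \<Omega> \<Longrightarrow> \<sigma> u v w = \<sigma> u w v"
  using \<theta>_closed[of u v w] L_sym[of u v w] by (simp add: D_\<theta>)


section \<open>The Levi-Civita derivative of T\<close>

definition a where "a = real DIM('a) / (real DIM('a) + 1)"

text \<open>S' u w is the Levi-Civita derivative of S in the direction w.\<close>

definition S' where "S' u w z = D (\<lambda>y. S y z) u w + L u w (S u z) - S u (L u w z)"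
text \<open>Written as a normalised trace so that smoothness is immediate. As S annihilates T,
  division by n - 1 makes it the mean eigenvalue of S on the complement; \<open>S_eq\<close> shows
  that it is the only one.\<close>

definition \<mu> where "\<mu> u = (\<Sum>b\<in>Basis. S u b \<bullet> b) / (real DIM('a) - 1)"

lemma a_pos: "a > 0"
  by (simp add: a_def)

lemma q_pos: "u \<in> \<Omega> \<Longrightarrow> q u > 0"
  unfolding q_def by (intro h_pos T_nz)

lemma \<theta>_T: "\<theta> u (T u) = q u"
  by (simp add: \<theta>_def q_def)

lemma linear_\<theta>: "u \<in> \<Omega> \<Longrightarrow> linear (\<theta> u)"
  unfolding \<theta>_def[abs_def] by (rule linear_h(1))

lemma lin_\<theta>: "u \<in> \<Omega> \<Longrightarrow> \<theta> u (v + w) = \<theta> u v + \<theta> u w" "u \<in> \<Omega> \<Longrightarrow> \<theta> u (v - w) = \<theta> u v - \<theta> u w"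
  "u \<in> \<Omega> \<Longrightarrow> \<theta> u (r *\<^sub>R v) = r * \<theta> u v" "u \<in> \<Omega> \<Longrightarrow> \<theta> u 0 = 0"
  by (simp_all add: \<theta>_def lin_h)

lemma linear_S: "u \<in> \<Omega> \<Longrightarrow> linear (S u)"
  unfolding S_def[abs_def]
  by (intro linear_compose_add linear_L(2) smooth_on_linear_D[OF smooth_T])

lemma bil_\<sigma>: "u \<in> \<Omega> \<Longrightarrow> bilinear (\<sigma> u)"
  unfolding bilinear_def \<sigma>_def
  using linear_compose[OF linear_S linear_h(2)] linear_h(1) by (auto simp: o_def)

lemmas lin_\<sigma> = bilinear_ladd[OF bil_\<sigma>] bilinear_radd[OF bil_\<sigma>] bilinear_lsub[OF bil_\<sigma>] bilinear_rsub[OF bil_\<sigma>]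
  bilinear_lmul[OF bil_\<sigma>] bilinear_rmul[OF bil_\<sigma>] bilinear_lzero[OF bil_\<sigma>] bilinear_rzero[OF bil_\<sigma>]

text \<open>The eigenvalue 2\<alpha> on T exceeds the eigenvalue \<alpha> on the complement by
  \<alpha>, which accounts for the second summand.\<close>

lemma K_T_decomposed:
  assumes u: "u \<in> \<Omega>"
  shows "K u (T u) v = \<alpha> u *\<^sub>R v + (\<alpha> u * \<theta> u v / q u) *\<^sub>R T u"
proof -
  let ?w = "v - (\<theta> u v / q u) *\<^sub>R T u"
  have "h u ?w (T u) = 0"
    using q_pos[OF u] h_sym[OF u, of v "T u"] by (simp add: lin_h[OF u] \<theta>_def q_def)
  then have "K u (T u) ?w = \<alpha> u *\<^sub>R ?w" using K_T_perp[OF u] by (simp add: K_def)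
  moreover have "K u (T u) (T u) = (2 * \<alpha> u) *\<^sub>R T u" using K_T_T[OF u] by (simp add: K_def)
  ultimately have "K u (T u) v = \<alpha> u *\<^sub>R ?w + (\<theta> u v / q u) *\<^sub>R (2 * \<alpha> u) *\<^sub>R T u"
    by (simp add: lin_K[OF u] algebra_simps)
  also have "\<dots> = \<alpha> u *\<^sub>R v + (\<alpha> u * \<theta> u v / q u) *\<^sub>R T u"
    by (simp add: algebra_simps flip: scaleR_add_left)
  finally show ?thesis .
qed

lemma \<alpha>_eq: assumes u: "u \<in> \<Omega>" shows "\<alpha> u = a * q u"
proof -
  have "real DIM('a) * q u = (\<Sum>b\<in>Basis. K u (T u) b \<bullet> b)"
    using trace_K[OF u, of "T u"] by (simp add: \<theta>_T)
  also have "\<dots> = (\<Sum>b\<in>(Basis::'a set). \<alpha> u) + \<alpha> u / q u * (\<Sum>b\<in>Basis. (T u \<bullet> b) *\<^sub>R \<theta> u b)"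
    by (simp add: K_T_decomposed[OF u] inner_add_left sum.distrib sum_distrib_left algebra_simps)
  also have "(\<Sum>b\<in>Basis. (T u \<bullet> b) *\<^sub>R \<theta> u b) = q u"
    using linear_sum_Basis[OF linear_\<theta>[OF u], of "T u"] by (simp add: \<theta>_T)
  finally have "real DIM('a) * q u = \<alpha> u * (real DIM('a) + 1)"
    using q_pos[OF u] by (simp add: algebra_simps)
  then show ?thesis by (simp add: a_def field_simps)
qed

lemma K_T: "u \<in> \<Omega> \<Longrightarrow> K u (T u) v = (a * q u) *\<^sub>R v + (a * \<theta> u v) *\<^sub>R T u"
  using q_pos[of u] by (simp add: K_T_decomposed \<alpha>_eq)

lemma C_T: "u \<in> \<Omega> \<Longrightarrow> C u (T u) v w = a * (q u * h u v w + \<theta> u v * \<theta> u w)"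
  by (simp add: C_def K_T lin_h \<theta>_def[of u w] algebra_simps)

text \<open>The eigenvectors of S on the complement of T, found by diagonalising \<sigma> there.
  Adding the normalised T gives an orthonormal frame of the whole space, hence the trace formula;
  applied to the identity map it yields the number of frame vectors.\<close>

lemma perp_frame:
  assumes u: "u \<in> \<Omega>"
  obtains B where "finite B" "real (card B) = real DIM('a) - 1" "\<And>b. b \<in> B \<Longrightarrow> \<theta> u b = 0"
    "\<And>b c. b \<in> B \<Longrightarrow> c \<in> B \<Longrightarrow> h u b c = (if b = c then 1 else 0)"
    "\<And>b c. b \<in> B \<Longrightarrow> c \<in> B \<Longrightarrow> b \<noteq> c \<Longrightarrow> \<sigma> u b c = 0"
    "\<And>v. v = (\<theta> u v / q u) *\<^sub>R T u + (\<Sum>b\<in>B. h u v b *\<^sub>R b)"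
    "\<And>A. linear A \<Longrightarrow> (\<Sum>b\<in>Basis. A b \<bullet> b) = h u (A (T u)) (T u) / q u + (\<Sum>b\<in>B. h u (A b) b)"
proof -
  have "subspace {v. \<theta> u v = 0}" by (simp add: subspace_def lin_\<theta>[OF u])
  have "v = 0 \<or> h u v v > 0" for v using h_pos[OF u] by blast
  note simultaneous_diagonalization[OF bil_h[OF u] h_sym[OF u] this bil_\<sigma>[OF u] \<sigma>_sym[OF u] \<open>subspace _\<close>]
  then obtain B where B0: "finite B" "B \<subseteq> {v. \<theta> u v = 0}" "\<forall>b\<in>B. \<forall>c\<in>B. h u b c = (if b = c then 1 else 0)"
    "\<forall>b\<in>B. \<forall>c\<in>B. b \<noteq> c \<longrightarrow> \<sigma> u b c = 0" "\<forall>v\<in>{v. \<theta> u v = 0}. v = (\<Sum>b\<in>B. h u v b *\<^sub>R b)"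
    by (elim exE conjE) (rule that; assumption)
  have B: "finite B" "\<And>b. b \<in> B \<Longrightarrow> \<theta> u b = 0"
    "\<And>b c. b \<in> B \<Longrightarrow> c \<in> B \<Longrightarrow> h u b c = (if b = c then 1 else 0)"
    "\<And>b c. b \<in> B \<Longrightarrow> c \<in> B \<Longrightarrow> b \<noteq> c \<Longrightarrow> \<sigma> u b c = 0"
    "\<And>v. \<theta> u v = 0 \<Longrightarrow> v = (\<Sum>b\<in>B. h u v b *\<^sub>R b)"
  proof -
    show "v = (\<Sum>b\<in>B. h u v b *\<^sub>R b)" if "\<theta> u v = 0" for v
      using bspec[OF B0(5), of v] that by blast
  qed (use B0 in auto)
  have hT: "h u (T u) b = 0" if "b \<in> B" for b using B(2)[OF that] by (simp add: \<theta>_def)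
  have rep: "v = (\<theta> u v / q u) *\<^sub>R T u + (\<Sum>b\<in>B. h u v b *\<^sub>R b)" for v
  proof -
    let ?w = "v - (\<theta> u v / q u) *\<^sub>R T u"
    have "\<theta> u ?w = 0" using q_pos[OF u] by (simp add: lin_\<theta>[OF u] \<theta>_T)
    then have "?w = (\<Sum>b\<in>B. h u ?w b *\<^sub>R b)" by (rule B(5))
    also have "\<dots> = (\<Sum>b\<in>B. h u v b *\<^sub>R b)" by (intro sum.cong refl) (simp add: lin_h[OF u] hT)
    finally show ?thesis by (simp add: algebra_simps)
  qed
  define t where "t = (1 / sqrt (q u)) *\<^sub>R T u"
  have tB: "t \<notin> B" using B(2)[of t] q_pos[OF u] by (auto simp: t_def lin_\<theta>[OF u] \<theta>_T)
  have rep': "v = (\<Sum>b\<in>insert t B. h u v b *\<^sub>R b)" for v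
  proof -
    have "h u v t *\<^sub>R t = (\<theta> u v / q u) *\<^sub>R T u"
      using q_pos[OF u] by (simp add: t_def lin_h[OF u] \<theta>_def h_sym[OF u, of v "T u"])
    then have "(\<Sum>b\<in>insert t B. h u v b *\<^sub>R b) = (\<theta> u v / q u) *\<^sub>R T u + (\<Sum>b\<in>B. h u v b *\<^sub>R b)"
      using B(1) tB by simp
    then show ?thesis using rep[of v] by simp
  qed
  have tr: "(\<Sum>b\<in>Basis. A b \<bullet> b) = h u (A (T u)) (T u) / q u + (\<Sum>b\<in>B. h u (A b) b)" if A: "linear A" for A
  proof -
    have "h u (A t) t = h u (A (T u)) (T u) / q u"
      using q_pos[OF u] by (simp add: t_def lin_h[OF u] linear_scale[OF A])
    then show ?thesis using trace_frame[OF A bil_h[OF u] rep'] B(1) tB by simp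
  qed
  have "real DIM('a) = 1 + real (card B)"
    using tr[OF linear_ident] q_pos[OF u] B(3) by (simp add: q_def)
  then show ?thesis using that[OF B(1) _ B(2-4) rep tr] by simp
qed

lemma D_q: "u \<in> \<Omega> \<Longrightarrow> D q u v = 2 * \<sigma> u v (T u)"
  using D_h_field[of u T T v] h_sym[of u "T u" "S u v"]
  by (simp add: q_def[abs_def] smooth_T \<sigma>_def S_def)

text \<open>As \<alpha> is a positive multiple of q, the hypothesis that \<alpha> is stationary
  across T says the same of q.\<close>

lemma \<sigma>_T_perp:
  assumes u: "u \<in> \<Omega>" and v: "\<theta> u v = 0"
  shows "\<sigma> u v (T u) = 0"
proof -
  have "h u v (T u) = 0" using v h_sym[OF u] by (simp add: \<theta>_def)
  then have "D \<alpha> u v = 0" using K_T_perp[OF u] by simp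
  moreover have "D \<alpha> u v = D (\<lambda>y. a * q y) u v"
    by (rule fun_cong[OF D_cong[OF open_\<Omega> u \<alpha>_eq]])
  moreover have "\<dots> = a * D q u v"
    by (rule D_bounded_linear[OF bounded_linear_mult_right smooth_differentiable[OF smooth_q u]])
  ultimately show ?thesis using a_pos by (simp add: D_q[OF u])
qed

text \<open>The identity \<open>C_T\<close> differentiated along z. The correction by
  \<open>C u (S u z) v w\<close> appears because the entry T is itself differentiated.\<close>

lemma N_T:
  assumes u: "u \<in> \<Omega>"
  shows "N u z (T u) v w =
    a * (2 * \<sigma> u z (T u) * h u v w + \<sigma> u z v * \<theta> u w + \<theta> u v * \<sigma> u z w) - C u (S u z) v w"
proof -
  have "D (\<lambda>y. C y (T y) v w) u z = D (\<lambda>y. a * (q y * h y v w + \<theta> y v * \<theta> y w)) u z"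
    by (rule fun_cong[OF D_cong[OF open_\<Omega> u C_T]])
  also have "\<dots> = a * D (\<lambda>y. q y * h y v w + \<theta> y v * \<theta> y w) u z"
    by (intro D_bounded_linear bounded_linear_mult_right smooth_differentiable[OF _ u] smooth_on_add smooth_on_mult
        open_\<Omega> smooth_q smooth_h smooth_\<theta>)
  also have "\<dots> = a * (D (\<lambda>y. q y * h y v w) u z + D (\<lambda>y. \<theta> y v * \<theta> y w) u z)"
    by (intro arg_cong[of _ _ "\<lambda>r. a * r"] D_add smooth_differentiable[OF _ u] smooth_on_mult open_\<Omega> smooth_q smooth_h smooth_\<theta>)
  finally have "D (\<lambda>y. C y (T y) v w) u z = a * (q u * (h u (L u z v) w + h u v (L u z w)) + 2 * \<sigma> u z (T u) * h u v w
     + \<theta> u v * (\<sigma> u z w + \<theta> u (L u z w)) + (\<sigma> u z v + \<theta> u (L u z v)) * \<theta> u w)"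
    by (simp add: D_mult smooth_differentiable[OF _ u] smooth_q smooth_h smooth_\<theta> D_q[OF u] metric[OF u] D_\<theta>[OF u])
  then show ?thesis
    using D_C_field[OF u smooth_T, of v w z, folded S_def]
    by (simp add: C_T[OF u] algebra_simps)
qed

lemma N_T_sym: "u \<in> \<Omega> \<Longrightarrow> N u z (T u) v w = N u v (T u) z w"
  using N_sym1(1)[of u z "T u" v w] N_sym2[of u z v "T u" w] N_sym1(1)[of u v z "T u" w] by simp

text \<open>By \<open>\<sigma>_T_perp\<close> only \<open>\<sigma> u (T u) (T u)\<close> is in
  question. For a unit vector z orthogonal to T the two contributions to
  \<open>N u z (T u) (T u) z\<close> are both a q \<open>\<sigma> u z z\<close> and cancel. By
  \<open>N_T_sym\<close> this number is also \<open>N u (T u) (T u) z z\<close>, which comes out as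
  a times \<open>\<sigma> u (T u) (T u)\<close>.\<close>

lemma \<sigma>_T: assumes u: "u \<in> \<Omega>" shows "\<sigma> u v (T u) = 0"
proof -
  obtain B where B: "finite B" "real (card B) = real DIM('a) - 1" "\<And>b. b \<in> B \<Longrightarrow> \<theta> u b = 0"
    "\<And>b c. b \<in> B \<Longrightarrow> c \<in> B \<Longrightarrow> h u b c = (if b = c then 1 else 0)"
    "\<And>v. v = (\<theta> u v / q u) *\<^sub>R T u + (\<Sum>b\<in>B. h u v b *\<^sub>R b)"
    by (rule perp_frame[OF u], rule that)
  have "card B \<noteq> 0" using B(2) dim_a by auto
  then obtain z where z: "z \<in> B" by fastforce
  have zz: "\<theta> u z = 0" "h u z z = 1" "\<sigma> u z (T u) = 0" using B(3,4) z \<sigma>_T_perp[OF u] by auto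
  have "h u (S u (T u)) b = 0" if "b \<in> B" for b
    using \<sigma>_T_perp[OF u B(3)[OF that]] \<sigma>_sym[OF u] by (simp add: \<sigma>_def)
  then have ST: "S u (T u) = (\<sigma> u (T u) (T u) / q u) *\<^sub>R T u"
    using B(5)[of "S u (T u)"] h_sym[OF u, of "T u" "S u (T u)"] by (simp add: \<theta>_def \<sigma>_def)
  have "N u z (T u) (T u) z = a * (q u * \<sigma> u z z) - C u (T u) (S u z) z"
    using C_sym(1)[OF u, of "S u z" "T u" z] by (simp add: N_T[OF u] zz \<theta>_T)
  also have "\<dots> = 0" by (simp add: C_T[OF u] zz \<sigma>_def)
  finally have "N u (T u) (T u) z z = 0" using N_T_sym[OF u, of z "T u" z] by simp
  moreover have "N u (T u) (T u) z z = a * (2 * \<sigma> u (T u) (T u)) - a * \<sigma> u (T u) (T u)"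
    using q_pos[OF u] by (simp add: N_T[OF u] zz ST lin_C[OF u] C_T[OF u])
  ultimately have TT: "\<sigma> u (T u) (T u) = 0" using a_pos by simp
  let ?w = "v - (\<theta> u v / q u) *\<^sub>R T u"
  have "\<theta> u ?w = 0" using q_pos[OF u] by (simp add: lin_\<theta>[OF u] \<theta>_T)
  from \<sigma>_T_perp[OF u this] show ?thesis by (simp add: lin_\<sigma>[OF u] TT)
qed

lemma S_T: assumes u: "u \<in> \<Omega>" shows "S u (T u) = 0"
proof -
  have "h u (S u (T u)) (S u (T u)) = \<sigma> u (T u) (S u (T u))" by (simp add: \<sigma>_def)
  then have "h u (S u (T u)) (S u (T u)) = 0" by (metis \<sigma>_sym[OF u] \<sigma>_T[OF u])
  then show ?thesis using h_pos[OF u, of "S u (T u)"] by fastforce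
qed

text \<open>For z, v, w orthogonal to T this is the commutation of K with S. The terms in \<theta>
  vanish there but are kept, since the identity is differentiated next and their derivatives do not
  vanish.\<close>

lemma S_C_commute:
  assumes u: "u \<in> \<Omega>"
  shows "C u (S u z) v w - a * \<theta> u v * \<sigma> u z w = C u (S u v) z w - a * \<theta> u z * \<sigma> u v w"
  using N_T_sym[OF u, of z v w] \<sigma>_sym[OF u, of z v]
  by (simp add: N_T[OF u] \<sigma>_T[OF u] algebra_simps)

text \<open>The products of two values of \<sigma> are the derivatives of the terms in \<theta>.
  They are the only quadratic terms of S that survive at vectors orthogonal to T, and they decide
  \<open>eigenvalues_equal\<close>.\<close>

lemma S_C_commute_derivative:
  assumes u: "u \<in> \<Omega>" and perp: "\<theta> u z = 0" "\<theta> u v = 0"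
  shows "N u w (S u z) v c + C u (S' u w z) v c - a * \<sigma> u w v * \<sigma> u z c =
    N u w (S u v) z c + C u (S' u w v) z c - a * \<sigma> u w z * \<sigma> u v c"
proof -
  have linC: "linear (\<lambda>b. C y b v c)" if "y \<in> \<Omega>" for y v c using that by (auto intro!: linearI simp: lin_C)
  have sCS: "smooth_on \<Omega> (\<lambda>y. C y (S y z) v c)" for z v
    by (rule smooth_on_linear_field[OF open_\<Omega> linC smooth_C smooth_S])
  have s2: "smooth_on \<Omega> (\<lambda>y. \<theta> y v * \<sigma> y z c)" for z v
    by (intro smooth_on_mult open_\<Omega> smooth_\<theta> smooth_\<sigma>)
  have der: "D (\<lambda>y. C y (S y z) v c - a * (\<theta> y v * \<sigma> y z c)) u w =
      N u w (S u z) v c + C u (S' u w z) v c + C u (S u (L u w z)) v c + C u (S u z) (L u w v) c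
      + C u (S u z) v (L u w c) - a * (\<sigma> u w v + \<theta> u (L u w v)) * \<sigma> u z c"
    if "\<theta> u v = 0" for z v
  proof -
    have eqS: "D (\<lambda>y. S y z) u w + L u w (S u z) = S' u w z + S u (L u w z)" by (simp add: S'_def)
    have "D (\<lambda>y. C y (S y z) v c - a * (\<theta> y v * \<sigma> y z c)) u w =
        D (\<lambda>y. C y (S y z) v c) u w - a * D (\<lambda>y. \<theta> y v * \<sigma> y z c) u w"
      by (simp add: D_diff D_bounded_linear[OF bounded_linear_mult_right] smooth_differentiable[OF _ u] sCS s2
          smooth_on_linear[OF bounded_linear_mult_right open_\<Omega>])
    also have "D (\<lambda>y. \<theta> y v * \<sigma> y z c) u w = (\<sigma> u w v + \<theta> u (L u w v)) * \<sigma> u z c"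
      by (simp add: D_mult smooth_differentiable[OF _ u] smooth_\<theta> smooth_\<sigma> D_\<theta>[OF u] that)
    finally show ?thesis
      by (simp add: D_C_field[OF u smooth_S] eqS lin_C[OF u])
  qed
  have "D (\<lambda>y. C y (S y z) v c - a * (\<theta> y v * \<sigma> y z c)) u w =
      D (\<lambda>y. C y (S y v) z c - a * (\<theta> y z * \<sigma> y v c)) u w"
    by (rule fun_cong[OF D_cong[OF open_\<Omega> u]]) (use S_C_commute in \<open>simp add: mult.assoc\<close>)
  \<comment> \<open>The terms in which L acts on one of the arguments z, v, c satisfy the
    undifferentiated identity and drop out.\<close>
  then show ?thesis
    using der[OF perp(2), of z] der[OF perp(1), of v]
      S_C_commute[OF u, of "L u w z" v c] S_C_commute[OF u, of z "L u w v" c] S_C_commute[OF u, of z v "L u w c"]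
    by (simp add: perp algebra_simps)
qed

text \<open>The image of S is orthogonal to T at every point; differentiating this, the derivative
  of T contributes \<open>S u w\<close>.\<close>

lemma \<theta>_S': assumes u: "u \<in> \<Omega>" shows "\<theta> u (S' u w z) = - h u (S u z) (S u w)"
proof -
  have "D (\<lambda>y. h y (S y z) (T y)) u w = D (\<lambda>y. 0) u w"
    by (rule fun_cong[OF D_cong[OF open_\<Omega> u]]) (metis \<sigma>_T \<sigma>_def)
  then have "h u (D (\<lambda>y. S y z) u w + L u w (S u z)) (T u) + h u (S u z) (S u w) = 0"
    by (simp add: D_h_field[OF u smooth_S smooth_T, folded S_def])
  moreover have "D (\<lambda>y. S y z) u w + L u w (S u z) = S' u w z + S u (L u w z)" by (simp add: S'_def)
  moreover have "h u (S u (L u w z)) (T u) = 0" using \<sigma>_T[OF u] by (simp add: \<sigma>_def)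
  ultimately show ?thesis
    using h_sym[OF u, of "T u"] by (simp add: lin_h[OF u] \<theta>_def)
qed

lemma N_scale: "u \<in> \<Omega> \<Longrightarrow> N u w (r *\<^sub>R v) z c = r * N u w v z c"
proof -
  assume u: "u \<in> \<Omega>"
  have "D (\<lambda>y. C y (r *\<^sub>R v) z c) u w = D (\<lambda>y. r * C y v z c) u w"
    by (rule fun_cong[OF D_cong[OF open_\<Omega> u]]) (simp add: lin_C)
  also have "\<dots> = r * D (\<lambda>y. C y v z c) u w"
    by (rule D_bounded_linear[OF bounded_linear_mult_right smooth_differentiable[OF smooth_C u]])
  finally show ?thesis by (simp add: N_def lin_C[OF u] lin_L[OF u] algebra_simps)
qed

text \<open>If S had two distinct eigenvalues on the complement of T, the Codazzi equation, summed over a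
  pair of its eigenspaces, would force their difference to vanish: K restricts to a trace-free
  tensor on each eigenspace, so every other term drops out.\<close>

lemma eigenvalues_equal:
  assumes u: "u \<in> \<Omega>" and B: "finite B" "\<And>b. b \<in> B \<Longrightarrow> \<theta> u b = 0"
    "\<And>b c. b \<in> B \<Longrightarrow> c \<in> B \<Longrightarrow> h u b c = (if b = c then 1 else 0)"
    "\<And>b c. b \<in> B \<Longrightarrow> c \<in> B \<Longrightarrow> b \<noteq> c \<Longrightarrow> \<sigma> u b c = 0"
    "\<And>v. v = (\<theta> u v / q u) *\<^sub>R T u + (\<Sum>b\<in>B. h u v b *\<^sub>R b)"
    "\<And>A. linear A \<Longrightarrow> (\<Sum>b\<in>Basis. A b \<bullet> b) = h u (A (T u)) (T u) / q u + (\<Sum>b\<in>B. h u (A b) b)"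
    and bc: "b0 \<in> B" "c0 \<in> B"
  shows "\<sigma> u b0 b0 = \<sigma> u c0 c0"
proof (rule ccontr)
  define lam where "lam b = \<sigma> u b b" for b
  assume "\<sigma> u b0 b0 \<noteq> \<sigma> u c0 c0"
  then have ne0: "lam b0 \<noteq> lam c0" by (simp add: lam_def)
  have S: "S u b = lam b *\<^sub>R b" if b: "b \<in> B" for b
  proof -
    have "\<theta> u (S u b) = 0" using \<sigma>_T[OF u, of b] h_sym[OF u] by (simp add: \<sigma>_def \<theta>_def)
    moreover have "(\<Sum>c\<in>B. h u (S u b) c *\<^sub>R c) = (\<Sum>c\<in>B. if c = b then lam b *\<^sub>R b else 0)"
      using B(4)[OF b] by (intro sum.cong refl) (auto simp: lam_def \<sigma>_def)
    ultimately show ?thesis using B(5)[of "S u b"] b B(1) by simp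
  qed
  have comm: "C u b c w = 0" if "b \<in> B" "c \<in> B" "lam b \<noteq> lam c" for b c w
  proof -
    have "lam b * C u b c w = lam c * C u b c w"
      using S_C_commute[OF u, of b c w] that C_sym(1)[OF u, of c b w] by (simp add: B(2) S lin_C[OF u])
    then show ?thesis using that(3) by simp
  qed
  define P where "P l = {b \<in> B. lam b = l}" for l
  have P: "finite (P l)" "P l \<subseteq> B" for l using B(1) by (auto simp: P_def)
  \<comment> \<open>Only the T-component of v contributes. For a frame vector b, the trace of
    \<open>K u b\<close> is n times \<open>\<theta> u b\<close>, hence zero, its entry at T vanishes
    by \<open>C_T\<close>, and by \<open>comm\<close> all other entries lie in the eigenspace of
    b.\<close>
  have block: "(\<Sum>c\<in>P l. C u v c c) = a * \<theta> u v * real (card (P l))" for l v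
  proof -
    have b0: "(\<Sum>c\<in>P l. C u b c c) = 0" if b: "b \<in> B" for b
    proof (cases "lam b = l")
      case True
      have "C u b (T u) (T u) = 0"
        using C_sym(1)[OF u, of b "T u" "T u"] by (simp add: C_T[OF u] B(2)[OF b] h_sym[OF u, of b] \<theta>_def[symmetric])
      then have "(\<Sum>c\<in>B. C u b c c) = 0"
        using B(6)[OF linear_K(1)[OF u], of b] trace_K[OF u, of b] by (simp add: B(2)[OF b] C_def)
      moreover have "(\<Sum>c\<in>B. C u b c c) = (\<Sum>c\<in>P l. C u b c c)"
      proof (rule sum.mono_neutral_right[OF B(1) P(2)], rule ballI)
        fix c assume "c \<in> B - P l"
        then show "C u b c c = 0" using comm[OF b, of c] True by (auto simp: P_def)
      qed
      ultimately show ?thesis by simp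
    next
      case False
      then show ?thesis using comm[OF b] by (intro sum.neutral) (auto simp: P_def)
    qed
    have T0: "(\<Sum>c\<in>P l. C u (T u) c c) = a * q u * real (card (P l))"
    proof -
      have "(\<Sum>c\<in>P l. C u (T u) c c) = (\<Sum>c\<in>P l. a * q u)"
        by (intro sum.cong refl) (auto simp: P_def C_T[OF u] B(2,3))
      then show ?thesis by simp
    qed
    have linv: "linear (\<lambda>v. \<Sum>c\<in>P l. C u v c c)"
      by (intro linear_compose_sum ballI) (auto intro!: linearI simp: lin_C[OF u])
    have "(\<Sum>c\<in>P l. C u v c c) = (\<theta> u v / q u) * (\<Sum>c\<in>P l. C u (T u) c c) + (\<Sum>b\<in>B. h u v b * (\<Sum>c\<in>P l. C u b c c))"
      using arg_cong[OF B(5)[of v], of "\<lambda>v. \<Sum>c\<in>P l. C u v c c"]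
      by (simp add: linear_add[OF linv] linear_scale[OF linv] linear_sum[OF linv])
    also have "\<dots> = a * \<theta> u v * real (card (P l))" using b0 T0 q_pos[OF u] by simp
    finally show ?thesis .
  qed
  have pair: "C u (S' u b b) c c + C u (S' u c c) b b = - 2 * a * lam b * lam c"
    if b: "b \<in> B" and c: "c \<in> B" and ne: "lam b \<noteq> lam c" for b c
  proof -
    have "(lam b - lam c) * N u b b c c = - C u (S' u b b) c c - a * lam b * lam c"
      if b: "b \<in> B" and c: "c \<in> B" and ne: "lam b \<noteq> lam c" for b c
    proof -
      have "C u (S' u b c) b c = 0"
        using comm[OF b c ne] C_sym[OF u] by metis
      moreover have "\<sigma> u b c = 0" using B(4)[OF b c] ne by auto
      moreover have "N u b c b c = N u b b c c" by (rule N_sym1(1)[OF u])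
      ultimately show ?thesis
        using S_C_commute_derivative[OF u B(2)[OF b] B(2)[OF c], of b c]
        by (simp add: S[OF b] S[OF c] N_scale[OF u] lam_def algebra_simps)
    qed
    \<comment> \<open>Exchanging b and c reverses the sign of the factor of N, while N takes the
      same value by its symmetries, so that the sum of both equations no longer contains N.\<close>
    note this[OF b c ne] this[OF c b ne[symmetric]]
    moreover have "N u c c b b = N u b b c c" by (metis N_sym1[OF u] N_sym2[OF u])
    ultimately show ?thesis by (simp add: algebra_simps)
  qed
  let ?l = "lam b0" and ?m = "lam c0"
  let ?k = "real (card (P ?l)) * real (card (P ?m))"
  have half: "(\<Sum>b\<in>P l. \<Sum>c\<in>P m. C u (S' u b b) c c) = - a * l^2 * (real (card (P l)) * real (card (P m)))" for l m
  proof -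
    have "(\<Sum>b\<in>P l. \<Sum>c\<in>P m. C u (S' u b b) c c) = (\<Sum>b\<in>P l. - a * l^2 * real (card (P m)))"
    proof (intro sum.cong refl)
      fix b assume "b \<in> P l"
      then have "b \<in> B" "lam b = l" by (auto simp: P_def)
      then show "(\<Sum>c\<in>P m. C u (S' u b b) c c) = - a * l^2 * real (card (P m))"
        by (simp add: block \<theta>_S'[OF u] S lin_h[OF u] B(3) power2_eq_square)
    qed
    then show ?thesis by simp
  qed
  have "(\<Sum>b\<in>P ?l. \<Sum>c\<in>P ?m. C u (S' u b b) c c + C u (S' u c c) b b) = (\<Sum>b\<in>P ?l. \<Sum>c\<in>P ?m. - 2 * a * ?l * ?m)"
    by (intro sum.cong refl) (use pair ne0 in \<open>auto simp: P_def\<close>)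
  moreover have "(\<Sum>b\<in>P ?l. \<Sum>c\<in>P ?m. C u (S' u c c) b b) = (\<Sum>c\<in>P ?m. \<Sum>b\<in>P ?l. C u (S' u c c) b b)"
    by (rule sum.swap)
  \<comment> \<open>With k the product of the two multiplicities, the sums read - a k (l^2 + m^2) =
    - 2 a k l m.\<close>
  ultimately have "a * ?k * (?l - ?m)^2 = 0"
    by (simp add: sum.distrib half power2_eq_square algebra_simps)
  moreover have "P ?l \<noteq> {}" "P ?m \<noteq> {}" using bc by (auto simp: P_def)
  then have "card (P ?l) \<noteq> 0" "card (P ?m) \<noteq> 0" using P(1) by auto
  ultimately show False using a_pos ne0 by simp
qed

lemma S_eq:
  assumes u: "u \<in> \<Omega>"
  shows "S u v = \<mu> u *\<^sub>R (v - (\<theta> u v / q u) *\<^sub>R T u)"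
proof -
  obtain B where B: "finite B" "real (card B) = real DIM('a) - 1" "\<And>b. b \<in> B \<Longrightarrow> \<theta> u b = 0"
    "\<And>b c. b \<in> B \<Longrightarrow> c \<in> B \<Longrightarrow> h u b c = (if b = c then 1 else 0)"
    "\<And>b c. b \<in> B \<Longrightarrow> c \<in> B \<Longrightarrow> b \<noteq> c \<Longrightarrow> \<sigma> u b c = 0"
    "\<And>v. v = (\<theta> u v / q u) *\<^sub>R T u + (\<Sum>b\<in>B. h u v b *\<^sub>R b)"
    "\<And>A. linear A \<Longrightarrow> (\<Sum>b\<in>Basis. A b \<bullet> b) = h u (A (T u)) (T u) / q u + (\<Sum>b\<in>B. h u (A b) b)"
    by (rule perp_frame[OF u], rule that)
  have cB: "real (card B) > 0" using B(2) dim_a by simp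
  then obtain b0 where b0: "b0 \<in> B" by fastforce
  have lam: "\<sigma> u b b = \<sigma> u b0 b0" if "b \<in> B" for b
    using eigenvalues_equal[OF u B(1,3-7) that b0] .
  have "(\<Sum>b\<in>Basis. S u b \<bullet> b) = (\<Sum>b\<in>B. \<sigma> u b0 b0)"
    using B(7)[OF linear_S[OF u]] lam by (simp add: S_T[OF u] lin_h[OF u] \<sigma>_def)
  then have \<mu>: "\<mu> u = \<sigma> u b0 b0" using cB B(2) by (simp add: \<mu>_def)
  have Sb: "S u b = \<mu> u *\<^sub>R b" if b: "b \<in> B" for b
  proof -
    have "\<theta> u (S u b) = 0" using \<sigma>_T[OF u, of b] h_sym[OF u] by (simp add: \<sigma>_def \<theta>_def)
    moreover have "(\<Sum>c\<in>B. h u (S u b) c *\<^sub>R c) = (\<Sum>c\<in>B. if c = b then \<mu> u *\<^sub>R b else 0)"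
      using B(5)[OF b] lam[OF b] by (intro sum.cong refl) (auto simp: \<mu> \<sigma>_def)
    ultimately show ?thesis using B(6)[of "S u b"] b B(1) by simp
  qed
  have "S u v = (\<theta> u v / q u) *\<^sub>R S u (T u) + (\<Sum>b\<in>B. h u v b *\<^sub>R S u b)"
    using arg_cong[OF B(6)[of v], of "S u"] linear_S[OF u]
    by (simp add: linear_add linear_scale linear_sum)
  also have "\<dots> = \<mu> u *\<^sub>R (\<Sum>b\<in>B. h u v b *\<^sub>R b)"
    by (simp add: S_T[OF u] Sb scaleR_sum_right mult.commute)
  also have "(\<Sum>b\<in>B. h u v b *\<^sub>R b) = v - (\<theta> u v / q u) *\<^sub>R T u"
    using B(6)[of v] by (simp add: algebra_simps)
  finally show ?thesis .
qed

lemma smooth_\<mu>: "smooth_on \<Omega> \<mu>"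
  unfolding \<mu>_def[abs_def] divide_inverse
  by (intro smooth_on_mult smooth_on_sum smooth_on_linear[OF bounded_linear_inner_left] open_\<Omega> smooth_S smooth_on_const)

end

section \<open>Integration of the structure equations\<close>

lemma zero_derivative_constant:
  fixes f :: "'a::real_normed_vector \<Rightarrow> 'b::real_normed_vector"
  assumes "convex S" "open S" "\<And>u. u \<in> S \<Longrightarrow> (f has_derivative (\<lambda>v. 0)) (at u)" "u \<in> S" "u' \<in> S"
  shows "f u = f u'"
proof -
  obtain c where "\<And>x. x \<in> S \<Longrightarrow> f x = c"
    using has_derivative_zero_constant[OF assms(1), of f] assms(3) has_derivative_at_withinI by metis
  then show ?thesis using assms(4,5) by simp
qed

text \<open>P is the quotient by the plane of v and w, l a coordinate on that plane, and the joint
  kernel is the line of v. With v = \<xi> and w = x at the base point, P / l is an affine chart for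
  rays modulo the direction of \<xi>.\<close>

lemma exists_linear_quotient:
  fixes v w :: "'f::euclidean_space"
  assumes dim: "DIM('f) = DIM('b::euclidean_space) + 2"
    and indep: "v \<noteq> 0" "\<And>r. w \<noteq> r *\<^sub>R v"
  obtains P :: "'f \<Rightarrow> 'b::euclidean_space" and l :: "'f \<Rightarrow> real" where "linear P" "linear l" "P v = 0" "P w = 0" "l v = 0" "l w = 1"
    "\<And>z. P z = 0 \<Longrightarrow> l z = 0 \<Longrightarrow> z \<in> span {v}"
proof -
  have "w \<notin> span {v}" using indep(2) by (auto simp: span_singleton)
  then have vw: "v \<noteq> w" by (auto simp: span_base)
  have "independent (insert w {v})"
    by (rule independent_insertI[OF \<open>w \<notin> span {v}\<close>]) (simp add: indep(1))
  then have ind: "independent {v, w}" by (simp add: insert_commute)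
  obtain Bf where Bf: "{v, w} \<subseteq> Bf" "independent Bf" "span Bf = (UNIV :: 'f set)"
    using maximal_independent_subset_extend[OF subset_UNIV ind] by (metis top.extremum_uniqueI)
  define B' where "B' = Bf - {v, w}"
  have fin: "finite Bf" using Bf(2) independent_imp_finite by blast
  have "card Bf = DIM('f)" using Bf(2,3) dim_UNIV by (metis dim_span dim_eq_card_independent)
  then have card: "card B' = card (Basis :: 'b set)"
    using dim fin Bf(1) vw by (simp add: B'_def card_Diff_subset)
  obtain j where j: "bij_betw j B' (Basis :: 'b set)"
    using finite_same_card_bij[of B' "Basis :: 'b set"] card fin by (auto simp: B'_def)
  obtain P where P: "linear P" "\<And>b. b \<in> Bf \<Longrightarrow> P b = (if b \<in> B' then j b else (0::'b))"
    using linear_independent_extend[OF Bf(2), of "\<lambda>b. if b \<in> B' then j b else (0::'b)"] by metis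
  obtain l where l: "linear l" "\<And>b. b \<in> Bf \<Longrightarrow> l b = (if b = w then 1 else (0::real))"
    using linear_independent_extend[OF Bf(2), of "\<lambda>b. if b = w then 1 else (0::real)"] by metis
  have vals: "P v = 0" "P w = 0" "l v = 0" "l w = 1" using P(2) l(2) Bf(1) vw by (auto simp: B'_def)
  have PB: "P ` B' = Basis" "inj_on P B'"
  proof -
    have eq: "P b = j b" if "b \<in> B'" for b using P(2) that by (simp add: B'_def)
    then show "P ` B' = Basis" using j by (simp add: bij_betw_def cong: image_cong)
    show "inj_on P B'" using j eq by (simp add: bij_betw_def cong: inj_on_cong)
  qed
  have injP: "inj_on P (span B')"
    using linear_inj_on_span_iff_independent_image[OF P(1), of B'] PB independent_Basis by simp
  show ?thesis
  proof (rule that[OF P(1) l(1) vals])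
    fix z assume z: "P z = 0" "l z = 0"
    have "Bf = {v, w} \<union> B'" using Bf(1) by (auto simp: B'_def)
    then have "z \<in> span ({v, w} \<union> B')" using Bf(3) by simp
    then obtain z1 z2 where z12: "z1 \<in> span {v, w}" "z2 \<in> span B'" "z = z1 + z2"
      unfolding span_Un by blast
    obtain r where r: "z1 - r *\<^sub>R w \<in> span {v}"
      using z12(1) span_breakdown_eq[of z1 w "{v}"] by (auto simp: insert_commute)
    then obtain s where s: "z1 - r *\<^sub>R w = s *\<^sub>R v" by (auto simp: span_singleton)
    then have z1: "z1 = s *\<^sub>R v + r *\<^sub>R w" by (simp add: algebra_simps)
    have "P z1 = 0" by (simp add: z1 linear_add[OF P(1)] linear_scale[OF P(1)] vals)
    then have "P z2 = P 0" using z(1) by (simp add: z12(3) linear_add[OF P(1)] linear_0[OF P(1)])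
    then have "z2 = 0" using injP z12(2) span_zero by (metis inj_onD)
    moreover have "l z1 = r" by (simp add: z1 linear_add[OF l(1)] linear_scale[OF l(1)] vals)
    ultimately show "z \<in> span {v}" using z(2) z12(3) r by simp
  qed
qed

context centroaffine_chart begin

definition \<tau> where "\<tau> u = D x u (T u)"
text \<open>The factor by which the sum of \<open>S u\<close> and \<open>K u (T u)\<close> acts on
  the complement of T.\<close>

definition m where "m u = \<mu> u + a * q u"
text \<open>The coefficient of \<theta> left over in the derivative of \<tau>, see
  \<open>D_\<tau>\<close>; the part with \<epsilon> stems from the transversal term of the Gauss
  formula.\<close>

definition \<zeta> where "\<zeta> u = (a - \<mu> u / q u) *\<^sub>R \<tau> u - \<epsilon> *\<^sub>R x u"
definition \<xi> where "\<xi> u = \<tau> u - m u *\<^sub>R x u"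

lemma D_q_zero: "u \<in> \<Omega> \<Longrightarrow> D q u v = 0"
  by (simp add: D_q \<sigma>_T)

lemma smooth_\<tau>: "smooth_on \<Omega> \<tau>"
  unfolding \<tau>_def[abs_def] by (rule smooth_on_linear_field[OF open_\<Omega> linear_Dx smooth_on_D[OF smooth_x] smooth_T])

lemma smooth_m: "smooth_on \<Omega> m"
  unfolding m_def[abs_def] by (intro smooth_on_add smooth_on_mult smooth_on_const open_\<Omega> smooth_\<mu> smooth_q)

lemma smooth_\<zeta>: "smooth_on \<Omega> \<zeta>"
  unfolding \<zeta>_def[abs_def] using q_pos
  by (intro smooth_on_diff smooth_on_scaleR smooth_on_const smooth_on_divide open_\<Omega> smooth_\<mu> smooth_q smooth_\<tau> smooth_x)
    fastforce

lemma smooth_\<xi>: "smooth_on \<Omega> \<xi>"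
  unfolding \<xi>_def[abs_def] by (intro smooth_on_diff smooth_on_scaleR open_\<Omega> smooth_\<tau> smooth_x smooth_m)

lemma D_m: "u \<in> \<Omega> \<Longrightarrow> D m u v = D \<mu> u v"
  unfolding m_def[abs_def]
  by (simp add: D_add D_bounded_linear[OF bounded_linear_mult_right] smooth_differentiable smooth_\<mu> smooth_q D_q_zero
      smooth_on_linear[OF bounded_linear_mult_right open_\<Omega>])

lemma D_\<tau>:
  assumes u: "u \<in> \<Omega>"
  shows "D \<tau> u v = m u *\<^sub>R D x u v + \<theta> u v *\<^sub>R \<zeta> u"
proof -
  have "D \<tau> u v = D x u (G u v (T u)) - (\<epsilon> * h u v (T u)) *\<^sub>R x u + D x u (D T u v)"
    using D_linear_field[OF open_\<Omega> u linear_Dx smooth_on_D[OF smooth_x] smooth_T, of v]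
    by (simp add: \<tau>_def[abs_def] gauss[OF u])
  moreover have "G u v (T u) = L u v (T u) + K u (T u) v"
    unfolding K_sym[OF u, of "T u" v] by (simp add: K_def)
  ultimately have "D \<tau> u v = D x u (S u v + K u (T u) v) - (\<epsilon> * \<theta> u v) *\<^sub>R x u"
    using h_sym[OF u, of v "T u"] by (simp add: S_def \<theta>_def linear_add[OF linear_Dx[OF u]])
  also have "S u v + K u (T u) v = m u *\<^sub>R v + (\<theta> u v * (a - \<mu> u / q u)) *\<^sub>R T u"
    by (simp add: S_eq[OF u] K_T[OF u] m_def algebra_simps)
  also have "D x u (m u *\<^sub>R v + (\<theta> u v * (a - \<mu> u / q u)) *\<^sub>R T u) - (\<epsilon> * \<theta> u v) *\<^sub>R x u =
      m u *\<^sub>R D x u v + (\<theta> u v * (a - \<mu> u / q u)) *\<^sub>R \<tau> u - (\<epsilon> * \<theta> u v) *\<^sub>R x u"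
    by (simp only: linear_add[OF linear_Dx[OF u]] linear_scale[OF linear_Dx[OF u]] \<tau>_def)
  finally show ?thesis
    by (simp add: \<zeta>_def scaleR_diff_right mult.commute)
qed

lemma D_\<zeta>:
  assumes u: "u \<in> \<Omega>"
  shows "D \<zeta> u w = (a - \<mu> u / q u) *\<^sub>R D \<tau> u w - (D \<mu> u w / q u) *\<^sub>R \<tau> u - \<epsilon> *\<^sub>R D x u w"
proof -
  have sq: "smooth_on \<Omega> (\<lambda>y. inverse (q y))"
    using q_pos by (intro smooth_on_inverse open_\<Omega> smooth_q) fastforce
  have "(q has_derivative (\<lambda>v. 0)) (at u)"
    using smooth_on_has_derivative[OF smooth_q u] D_q_zero[OF u] by (metis (no_types, lifting) ext)
  then have "((\<lambda>y. inverse (q y)) has_derivative (\<lambda>v. - (inverse (q u) * 0 * inverse (q u)))) (at u)"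
    using q_pos[OF u] by (intro Deriv.has_derivative_inverse) auto
  then have Dq: "D (\<lambda>y. inverse (q y)) u w = 0" by (simp add: D_eqI)
  have s1: "smooth_on \<Omega> (\<lambda>y. \<mu> y * inverse (q y))" by (intro smooth_on_mult open_\<Omega> smooth_\<mu> sq)
  have s2: "smooth_on \<Omega> (\<lambda>y. a - \<mu> y * inverse (q y))" by (intro smooth_on_diff smooth_on_const open_\<Omega> s1)
  have "D \<zeta> u w = D (\<lambda>y. (a - \<mu> y * inverse (q y)) *\<^sub>R \<tau> y) u w - D (\<lambda>y. \<epsilon> *\<^sub>R x y) u w"
    unfolding \<zeta>_def[abs_def] divide_inverse
    by (intro D_diff smooth_differentiable[OF _ u] smooth_on_scaleR s2 smooth_\<tau> smooth_x open_\<Omega> smooth_on_const)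
  also have "D (\<lambda>y. \<epsilon> *\<^sub>R x y) u w = \<epsilon> *\<^sub>R D x u w"
    by (rule D_bounded_linear[OF bounded_linear_scaleR_right smooth_differentiable[OF smooth_x u]])
  also have "D (\<lambda>y. (a - \<mu> y * inverse (q y)) *\<^sub>R \<tau> y) u w =
      (a - \<mu> u * inverse (q u)) *\<^sub>R D \<tau> u w + D (\<lambda>y. a - \<mu> y * inverse (q y)) u w *\<^sub>R \<tau> u"
    by (rule D_scaleR[OF smooth_differentiable[OF s2 u] smooth_differentiable[OF smooth_\<tau> u]])
  also have "D (\<lambda>y. a - \<mu> y * inverse (q y)) u w = - (D \<mu> u w * inverse (q u))"
    by (simp add: D_diff D_mult smooth_differentiable[OF _ u] s1 smooth_\<mu> sq Dq)
  finally show ?thesis by (simp add: divide_inverse)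
qed

text \<open>Symmetry of the second derivative of \<tau>. The closedness of \<theta> and the symmetry
  of the second derivative of x remove all terms except those that differentiate \<mu> and
  \<zeta>.\<close>

lemma D_\<tau>_integrability:
  assumes u: "u \<in> \<Omega>"
  shows "D \<mu> u w *\<^sub>R D x u v + \<theta> u v *\<^sub>R D \<zeta> u w = D \<mu> u v *\<^sub>R D x u w + \<theta> u w *\<^sub>R D \<zeta> u v"
proof -
  have "D (\<lambda>y. D \<tau> y v) u w = m u *\<^sub>R D (\<lambda>y. D x y v) u w + D \<mu> u w *\<^sub>R D x u v
      + (\<theta> u v *\<^sub>R D \<zeta> u w + D (\<lambda>y. \<theta> y v) u w *\<^sub>R \<zeta> u)" for v w
  proof -
    have "D (\<lambda>y. D \<tau> y v) u w = D (\<lambda>y. m y *\<^sub>R D x y v + \<theta> y v *\<^sub>R \<zeta> y) u w"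
      by (rule fun_cong[OF D_cong[OF open_\<Omega> u D_\<tau>]])
    also have "\<dots> = D (\<lambda>y. m y *\<^sub>R D x y v) u w + D (\<lambda>y. \<theta> y v *\<^sub>R \<zeta> y) u w"
      by (intro D_add smooth_differentiable[OF _ u] smooth_on_scaleR open_\<Omega> smooth_m smooth_on_D smooth_x smooth_\<theta> smooth_\<zeta>)
    finally show ?thesis
      by (simp add: D_scaleR smooth_differentiable[OF _ u] smooth_m smooth_on_D smooth_x smooth_\<theta> smooth_\<zeta> D_m[OF u])
  qed
  from this[of v w] this[of w v] show ?thesis
    using D_commute[OF open_\<Omega> u smooth_\<tau>, of v w] D_commute[OF open_\<Omega> u smooth_x, of v w] \<theta>_closed[OF u, of v w]
    by simp
qed

text \<open>Two independent vectors orthogonal to T in \<open>D_\<tau>_integrability\<close> show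
  that \<mu> is stationary across T; T together with one such vector determines its derivative along
  T.\<close>

lemma D_\<mu>:
  assumes u: "u \<in> \<Omega>"
  shows "D \<mu> u v = ((a * q u)\<^sup>2 - (\<mu> u)\<^sup>2 - \<epsilon> * q u) / q u * \<theta> u v"
proof -
  obtain B where B: "finite B" "real (card B) = real DIM('a) - 1" "\<And>b. b \<in> B \<Longrightarrow> \<theta> u b = 0"
    "\<And>b c. b \<in> B \<Longrightarrow> c \<in> B \<Longrightarrow> h u b c = (if b = c then 1 else 0)"
    "\<And>v. v = (\<theta> u v / q u) *\<^sub>R T u + (\<Sum>b\<in>B. h u v b *\<^sub>R b)"
    by (rule perp_frame[OF u], rule that)
  have lin\<mu>: "linear (D \<mu> u)" by (rule smooth_on_linear_D[OF smooth_\<mu> u])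
  have inj: "v = w" if "D x u v = D x u w" for v w
    using Dx_inj(1)[OF u, of v 0 w 0] that by simp
  have perp: "D \<mu> u b = 0" if b: "b \<in> B" for b
  proof -
    \<comment> \<open>A second frame vector exists because n \<ge> 3.\<close>
    have "card B > 1" using B(2) dim_a by linarith
    then obtain c where c: "c \<in> B" "c \<noteq> b" using B(1) b by (metis card_1_singleton_iff card_le_Suc0_iff_eq One_nat_def not_le)
    have "D x u (D \<mu> u b *\<^sub>R c) = D x u (D \<mu> u c *\<^sub>R b)"
      using D_\<tau>_integrability[OF u, of b c] B(3) b c by (simp add: linear_scale[OF linear_Dx[OF u]])
    then have "D \<mu> u b *\<^sub>R c = D \<mu> u c *\<^sub>R b" by (rule inj)
    then have "h u (D \<mu> u b *\<^sub>R c) c = h u (D \<mu> u c *\<^sub>R b) c" by simp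
    then show ?thesis using B(4) b c by (simp add: lin_h[OF u])
  qed
  have "card B \<noteq> 0" using B(2) dim_a by auto
  then obtain b where b: "b \<in> B" by fastforce
  define c where "c = a - \<mu> u / q u"
  have "D \<mu> u (T u) *\<^sub>R D x u b = q u *\<^sub>R (c *\<^sub>R (m u *\<^sub>R D x u b) - \<epsilon> *\<^sub>R D x u b)"
    using D_\<tau>_integrability[OF u, of "T u" b] perp[OF b] B(3)[OF b]
    by (simp add: \<theta>_T D_\<zeta>[OF u] D_\<tau>[OF u] c_def)
  also have "\<dots> = (q u * (c * m u - \<epsilon>)) *\<^sub>R D x u b" by (simp add: algebra_simps)
  finally have "D x u (D \<mu> u (T u) *\<^sub>R b) = D x u ((q u * ((a - \<mu> u / q u) * m u - \<epsilon>)) *\<^sub>R b)"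
    by (simp only: linear_scale[OF linear_Dx[OF u]] c_def)
  then have "D \<mu> u (T u) *\<^sub>R b = (q u * ((a - \<mu> u / q u) * m u - \<epsilon>)) *\<^sub>R b" by (rule inj)
  moreover have "b \<noteq> 0" using B(4)[OF b b] by (auto simp: lin_h[OF u])
  ultimately have "D \<mu> u (T u) = q u * ((a - \<mu> u / q u) * m u - \<epsilon>)" by simp
  also have "\<dots> = (a * q u)\<^sup>2 - (\<mu> u)\<^sup>2 - \<epsilon> * q u"
    using q_pos[OF u] by (simp add: m_def field_simps power2_eq_square)
  finally have DT: "D \<mu> u (T u) = (a * q u)\<^sup>2 - (\<mu> u)\<^sup>2 - \<epsilon> * q u" .
  have "D \<mu> u v = (\<theta> u v / q u) * D \<mu> u (T u) + (\<Sum>b\<in>B. h u v b * D \<mu> u b)"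
    using arg_cong[OF B(5)[of v], of "D \<mu> u"] by (simp add: linear_add[OF lin\<mu>] linear_scale[OF lin\<mu>] linear_sum[OF lin\<mu>])
  then show ?thesis using perp by (simp add: DT)
qed

text \<open>Subtracting m x from \<tau> cancels the term m D x, and what remains is a multiple of
  \<theta> with values in the span of \<tau> and x. The derivative of \<mu> found in
  \<open>D_\<mu>\<close> gives this combination the same ratio of coefficients as \<xi>.\<close>

lemma D_\<xi>:
  assumes u: "u \<in> \<Omega>"
  shows "D \<xi> u v = (\<theta> u v * ((a * q u - \<mu> u) / q u)) *\<^sub>R \<xi> u"
proof -
  have "D \<xi> u v = D \<tau> u v - (m u *\<^sub>R D x u v + D \<mu> u v *\<^sub>R x u)"
    unfolding \<xi>_def[abs_def]
    by (simp add: D_diff D_scaleR D_m[OF u] smooth_differentiable[OF _ u] smooth_on_scaleR open_\<Omega> smooth_m smooth_x smooth_\<tau>)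
  also have "\<dots> = \<theta> u v *\<^sub>R (\<zeta> u - (((a * q u)\<^sup>2 - (\<mu> u)\<^sup>2 - \<epsilon> * q u) / q u) *\<^sub>R x u)"
    by (simp add: D_\<tau>[OF u] D_\<mu>[OF u] algebra_simps)
  also have "\<zeta> u - (((a * q u)\<^sup>2 - (\<mu> u)\<^sup>2 - \<epsilon> * q u) / q u) *\<^sub>R x u = ((a * q u - \<mu> u) / q u) *\<^sub>R \<xi> u"
  proof -
    have 1: "a - \<mu> u / q u = (a * q u - \<mu> u) / q u" using q_pos[OF u] by (simp add: field_simps)
    have 2: "\<epsilon> + ((a * q u)\<^sup>2 - (\<mu> u)\<^sup>2 - \<epsilon> * q u) / q u = (a * q u - \<mu> u) / q u * m u"
      using q_pos[OF u] by (simp add: m_def field_simps power2_eq_square)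
    have "\<zeta> u - (((a * q u)\<^sup>2 - (\<mu> u)\<^sup>2 - \<epsilon> * q u) / q u) *\<^sub>R x u =
        (a - \<mu> u / q u) *\<^sub>R \<tau> u - (\<epsilon> + ((a * q u)\<^sup>2 - (\<mu> u)\<^sup>2 - \<epsilon> * q u) / q u) *\<^sub>R x u"
      by (simp only: \<zeta>_def scaleR_add_left diff_diff_add)
    also have "\<dots> = ((a * q u - \<mu> u) / q u) *\<^sub>R \<xi> u"
      by (simp only: 1 2 \<xi>_def scaleR_diff_right scaleR_scaleR)
    finally show ?thesis .
  qed
  finally show ?thesis by simp
qed


text \<open>Because q is constant, the unit form \<theta> / sqrt q inherits closedness from \<theta>
  and has a primitive on the convex set.\<close>

lemma exists_time_function:
  assumes B: "open B" "convex B" "B \<subseteq> \<Omega>" and u0: "u0 \<in> B"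
  obtains t where "smooth_on B t" "\<And>u. u \<in> B \<Longrightarrow> (t has_derivative (\<lambda>v. \<theta> u v / sqrt (q u0))) (at u)"
    "\<And>u. u \<in> B \<Longrightarrow> q u = q u0"
proof -
  have B\<Omega>: "u \<in> \<Omega>" if "u \<in> B" for u using B(3) that by auto
  have q: "q u = q u0" if "u \<in> B" for u
  proof (rule zero_derivative_constant[OF B(2,1) _ that u0])
    fix y assume "y \<in> B"
    then show "(q has_derivative (\<lambda>v. 0)) (at y)"
      using smooth_on_has_derivative[OF smooth_q B\<Omega>] D_q_zero[OF B\<Omega>] by (metis (no_types, lifting) ext)
  qed
  have lin: "linear (\<lambda>v. \<theta> u v / sqrt (q u0))" if "u \<in> B" for u
    using linear_compose_scale_right[OF linear_\<theta>[OF B\<Omega>[OF that]], of "1 / sqrt (q u0)"] by simp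
  have smo: "smooth_on B (\<lambda>u. \<theta> u v / sqrt (q u0))" for v
    using smooth_on_linear[OF bounded_linear_mult_left[of "1 / sqrt (q u0)"] B(1) smooth_on_subset[OF smooth_\<theta> B(3), of v]]
    by simp
  have Dq: "D (\<lambda>u. \<theta> u v / sqrt (q u0)) u w = D (\<lambda>u. \<theta> u v) u w / sqrt (q u0)" if "u \<in> B" for u v w
    using D_bounded_linear[OF bounded_linear_mult_left[of "1 / sqrt (q u0)"] smooth_differentiable[OF smooth_\<theta> B\<Omega>[OF that]], of v w]
    by simp
  obtain t where t: "\<And>u. u \<in> B \<Longrightarrow> (t has_derivative (\<lambda>v. \<theta> u v / sqrt (q u0))) (at u)"
    by (rule closed_form_exact[OF B(1,2) lin smo]) (auto simp: Dq \<theta>_closed[OF B\<Omega>])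
  show ?thesis by (rule that[OF smooth_onI[OF B(1) t smo] t q])
qed

lemma \<xi>_nonzero: "u \<in> \<Omega> \<Longrightarrow> \<xi> u \<noteq> 0"
  using transversal[of u "T u" "m u"] T_nz[of u] by (auto simp: \<xi>_def \<tau>_def)

text \<open>By \<open>D_\<xi>\<close> the vector \<xi> and its component along
  \<open>\<xi> u0\<close> have the same logarithmic derivative, so their quotient is a constant
  vector.\<close>

lemma \<xi>_constant_direction:
  assumes B: "open B" "convex B" "B \<subseteq> \<Omega>" and u0: "u0 \<in> B" and pos: "\<And>u. u \<in> B \<Longrightarrow> \<xi> u \<bullet> \<xi> u0 \<noteq> 0"
    and u: "u \<in> B"
  shows "\<xi> u = ((\<xi> u \<bullet> \<xi> u0) / (\<xi> u0 \<bullet> \<xi> u0)) *\<^sub>R \<xi> u0"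
proof -
  define f where "f y = \<xi> y \<bullet> \<xi> u0" for y
  have "(1 / f u) *\<^sub>R \<xi> u = (1 / f u0) *\<^sub>R \<xi> u0"
  proof (rule zero_derivative_constant[OF B(2,1) _ u u0])
    fix y assume y: "y \<in> B"
    then have y': "y \<in> \<Omega>" using B(3) by auto
    let ?c = "\<lambda>v. \<theta> y v * ((a * q y - \<mu> y) / q y)"
    have d\<xi>: "(\<xi> has_derivative (\<lambda>v. ?c v *\<^sub>R \<xi> y)) (at y)"
      using smooth_on_has_derivative[OF smooth_\<xi> y'] D_\<xi>[OF y'] by (metis (no_types, lifting) ext)
    have df: "(f has_derivative (\<lambda>v. ?c v * f y)) (at y)"
      using has_derivative_inner_left[OF d\<xi>, of "\<xi> u0"] by (simp add: f_def[abs_def])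
    have fy: "f y \<noteq> 0" using pos[OF y] by (simp add: f_def)
    have "((\<lambda>y. inverse (f y) *\<^sub>R \<xi> y) has_derivative
        (\<lambda>v. inverse (f y) *\<^sub>R (?c v *\<^sub>R \<xi> y) + (- (inverse (f y) * (?c v * f y) * inverse (f y))) *\<^sub>R \<xi> y)) (at y)"
      by (rule has_derivative_scaleR[OF Deriv.has_derivative_inverse[OF fy df] d\<xi>])
    moreover have "inverse (f y) *\<^sub>R (?c v *\<^sub>R \<xi> y) + (- (inverse (f y) * (?c v * f y) * inverse (f y))) *\<^sub>R \<xi> y = 0" for v
    proof -
      have "inverse r * (k * r) * inverse r = inverse r * k" if "r \<noteq> 0" for r k :: real
        using that by (simp add: field_simps)
      from this[OF fy] have "inverse (f y) * (?c v * f y) * inverse (f y) = inverse (f y) * ?c v" .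
      then show ?thesis by (simp only: scaleR_scaleR scaleR_minus_left) simp
    qed
    ultimately have "((\<lambda>y. inverse (f y) *\<^sub>R \<xi> y) has_derivative (\<lambda>v. 0)) (at y)"
      by (simp only:)
    then show "((\<lambda>y. (1 / f y) *\<^sub>R \<xi> y) has_derivative (\<lambda>v. 0)) (at y)"
      by (simp add: inverse_eq_divide)
  qed
  then have "f u *\<^sub>R ((1 / f u) *\<^sub>R \<xi> u) = f u *\<^sub>R ((1 / f u0) *\<^sub>R \<xi> u0)" by simp
  then show ?thesis using pos[OF u] by (simp add: f_def)
qed

text \<open>The chart (t, y): y records the ray of x modulo the constant line spanned by \<xi>, and it is
  constant along T because T x is a combination of x and \<xi>.\<close>

lemma exists_adapted_chart:
  assumes u0: "u0 \<in> \<Omega>" and dimb: "DIM('a) = DIM('b::euclidean_space) + 1" and dimf: "DIM('f) = DIM('a) + 1"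
  obtains U and \<Phi> :: "'a \<Rightarrow> real \<times> 'b::euclidean_space" where "open U" "u0 \<in> U" "U \<subseteq> \<Omega>" "smooth_on U \<Phi>" "\<And>u. u \<in> U \<Longrightarrow> inj (D \<Phi> u)"
    "\<And>u v. u \<in> U \<Longrightarrow> fst (D \<Phi> u v) = \<theta> u v / sqrt (q u)" "\<And>u. u \<in> U \<Longrightarrow> snd (D \<Phi> u (T u)) = 0"
    "\<And>u. u \<in> U \<Longrightarrow> q u = q u0"
proof -
  \<comment> \<open>If x were r times \<xi>, then r times x_*(T) would be a multiple of x;
    transversality forces r = 0 and then 1 = 0.\<close>
  have u0x: "x u0 \<noteq> r *\<^sub>R \<xi> u0" for r
  proof
    assume eq: "x u0 = r *\<^sub>R \<xi> u0"
    have "D x u0 (r *\<^sub>R T u0) = r *\<^sub>R (\<xi> u0 + m u0 *\<^sub>R x u0)"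
      by (simp add: linear_scale[OF linear_Dx[OF u0]] \<xi>_def \<tau>_def)
    also have "\<dots> = (1 + r * m u0) *\<^sub>R x u0" by (simp add: scaleR_add_right scaleR_add_left flip: eq)
    finally have "r *\<^sub>R T u0 = 0 \<and> 1 + r * m u0 = 0" by (rule transversal[OF u0])
    then show False using T_nz[OF u0] by auto
  qed
  have dim: "DIM('f) = DIM('b) + 2" using dimb dimf by simp
  obtain P :: "'f \<Rightarrow> 'b" and l :: "'f \<Rightarrow> real" where Pl: "linear P" "linear l" "P (\<xi> u0) = 0" "P (x u0) = 0"
    "l (\<xi> u0) = 0" "l (x u0) = 1" "\<And>z. P z = 0 \<Longrightarrow> l z = 0 \<Longrightarrow> z \<in> span {\<xi> u0}"
    by (rule exists_linear_quotient[OF dim \<xi>_nonzero[OF u0] u0x], rule that)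
  have bP: "bounded_linear P" and bl: "bounded_linear l" using Pl by (auto simp: linear_conv_bounded_linear)
  \<comment> \<open>The set where the two denominators used below do not vanish. It contains u0,
    since \<open>l (x u0) = 1\<close>.\<close>
  define A where "A = {u \<in> \<Omega>. \<xi> u \<bullet> \<xi> u0 \<noteq> 0 \<and> l (x u) \<noteq> 0}"
  have "open A"
  proof -
    have "continuous_on \<Omega> (\<lambda>u. (\<xi> u \<bullet> \<xi> u0) * l (x u))"
      by (intro continuous_intros smooth_on_continuous smooth_\<xi> bounded_linear.continuous_on[OF bl] smooth_x)
    then have "open (\<Omega> \<inter> (\<lambda>u. (\<xi> u \<bullet> \<xi> u0) * l (x u)) -` (- {0}))"
      by (intro continuous_open_preimage open_\<Omega>) auto
    moreover have "\<Omega> \<inter> (\<lambda>u. (\<xi> u \<bullet> \<xi> u0) * l (x u)) -` (- {0}) = A" by (auto simp: A_def)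
    ultimately show ?thesis by simp
  qed
  moreover have "u0 \<in> A" using u0 \<xi>_nonzero[OF u0] Pl(6) by (simp add: A_def)
  ultimately obtain r where r: "r > 0" "ball u0 r \<subseteq> A" using openE by blast
  define U where "U = ball u0 r"
  have U: "open U" "convex U" "u0 \<in> U" "U \<subseteq> \<Omega>" using r by (auto simp: U_def A_def)
  have UA: "u \<in> \<Omega>" "\<xi> u \<bullet> \<xi> u0 \<noteq> 0" "l (x u) \<noteq> 0" if "u \<in> U" for u
    using r(2) that by (auto simp: U_def A_def)
  obtain t where t: "smooth_on U t" "\<And>u. u \<in> U \<Longrightarrow> (t has_derivative (\<lambda>v. \<theta> u v / sqrt (q u0))) (at u)"
    "\<And>u. u \<in> U \<Longrightarrow> q u = q u0"
    by (rule exists_time_function[OF U(1,2,4,3)], rule that)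
  have \<xi>u: "P (\<xi> u) = 0" "l (\<xi> u) = 0" if u: "u \<in> U" for u
  proof -
    obtain c where "\<xi> u = c *\<^sub>R \<xi> u0" using \<xi>_constant_direction[OF U(1,2,4,3) UA(2) u] by blast
    then show "P (\<xi> u) = 0" "l (\<xi> u) = 0"
      by (simp_all add: linear_scale[OF Pl(1)] linear_scale[OF Pl(2)] Pl(3,5))
  qed
  define y where "y u = (1 / l (x u)) *\<^sub>R P (x u)" for u
  have slx: "smooth_on U (\<lambda>u. l (x u))" and sPx: "smooth_on U (\<lambda>u. P (x u))"
    using smooth_on_linear[OF bl U(1) smooth_on_subset[OF smooth_x U(4)]]
      smooth_on_linear[OF bP U(1) smooth_on_subset[OF smooth_x U(4)]] .
  have sinv: "smooth_on U (\<lambda>u. 1 / l (x u))"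
    by (intro smooth_on_divide smooth_on_const U(1) slx UA(3))
  have smy: "smooth_on U y" unfolding y_def[abs_def] by (intro smooth_on_scaleR U(1) sinv sPx)
  \<comment> \<open>A quotient rule, obtained by differentiating
    \<open>l (x u) *\<^sub>R y u = P (x u)\<close>.\<close>
  have Dy: "D y u v = (1 / l (x u)) *\<^sub>R P (D x u v - (l (D x u v) / l (x u)) *\<^sub>R x u)" if u: "u \<in> U" for u v
  proof -
    have dx: "x differentiable (at u)" using smooth_differentiable[OF smooth_x UA(1)[OF u]] .
    have "D (\<lambda>u. l (x u) *\<^sub>R y u) u v = l (x u) *\<^sub>R D y u v + l (D x u v) *\<^sub>R y u"
      using D_scaleR[OF smooth_on_differentiable[OF slx u] smooth_on_differentiable[OF smy u]] D_bounded_linear[OF bl dx] by simp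
    moreover have "D (\<lambda>u. l (x u) *\<^sub>R y u) u v = P (D x u v)"
    proof -
      have "D (\<lambda>u. l (x u) *\<^sub>R y u) u v = D (\<lambda>u. P (x u)) u v"
        by (rule fun_cong[OF D_cong[OF U(1) u]]) (simp add: y_def UA(3))
      then show ?thesis using D_bounded_linear[OF bP dx] by simp
    qed
    ultimately have "l (x u) *\<^sub>R D y u v = P (D x u v) - l (D x u v) *\<^sub>R y u" by simp
    then have "(1 / l (x u)) *\<^sub>R (l (x u) *\<^sub>R D y u v) = (1 / l (x u)) *\<^sub>R (P (D x u v) - l (D x u v) *\<^sub>R y u)" by simp
    then have "D y u v = (1 / l (x u)) *\<^sub>R (P (D x u v) - l (D x u v) *\<^sub>R y u)" using UA(3)[OF u] by simp
    then show ?thesis by (simp add: y_def linear_diff[OF Pl(1)] linear_scale[OF Pl(1)])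
  qed
  define \<Phi> where "\<Phi> u = (t u, y u)" for u
  have sm\<Phi>: "smooth_on U \<Phi>" unfolding \<Phi>_def[abs_def] by (intro smooth_on_Pair U(1) t(1) smy)
  have D\<Phi>: "D \<Phi> u v = (\<theta> u v / sqrt (q u0), D y u v)" if "u \<in> U" for u v
    using D_eqI[OF has_derivative_Pair[OF t(2)[OF that] smooth_on_has_derivative[OF smy that]]]
    by (simp add: \<Phi>_def[abs_def])
  have DyT: "D y u (T u) = 0" if u: "u \<in> U" for u
  proof -
    have Dx: "D x u (T u) = \<xi> u + m u *\<^sub>R x u" by (simp add: \<xi>_def \<tau>_def)
    have "l (D x u (T u)) = m u * l (x u)" by (simp add: Dx linear_add[OF Pl(2)] linear_scale[OF Pl(2)] \<xi>u[OF u])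
    then have "D y u (T u) = (1 / l (x u)) *\<^sub>R P (\<xi> u)" using UA(3)[OF u] by (simp add: Dy[OF u] Dx)
    then show ?thesis by (simp add: \<xi>u[OF u])
  qed
  have inj: "inj (D \<Phi> u)" if u: "u \<in> U" for u
  proof -
    have lin: "linear (D \<Phi> u)" by (rule smooth_on_linear_D[OF sm\<Phi> u])
    have "v = 0" if v: "D \<Phi> u v = 0" for v
    proof -
      have th: "\<theta> u v = 0" and Dy0: "D y u v = 0"
        using v q_pos[OF u0] by (auto simp: D\<Phi>[OF u] zero_prod_def)
      let ?c = "l (D x u v) / l (x u)"
      \<comment> \<open>A vanishing derivative of y puts x_*(v) into the plane of x and \<xi>.
        Subtracting a multiple of T from v leaves a vector mapped to a multiple of x; by
        transversality v is a multiple of T, and \<open>\<theta> u v = 0\<close> makes it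
        zero.\<close>
      have "P (D x u v - ?c *\<^sub>R x u) = 0" using Dy0 UA(3)[OF u] by (simp add: Dy[OF u])
      moreover have "l (D x u v - ?c *\<^sub>R x u) = 0"
        using UA(3)[OF u] by (simp add: linear_diff[OF Pl(2)] linear_scale[OF Pl(2)])
      ultimately obtain s where s: "D x u v - ?c *\<^sub>R x u = s *\<^sub>R \<xi> u0"
        using Pl(7) by (auto simp: span_singleton)
      have "\<xi> u0 = ((\<xi> u0 \<bullet> \<xi> u0) / (\<xi> u \<bullet> \<xi> u0)) *\<^sub>R \<xi> u"
      proof -
        have "((\<xi> u0 \<bullet> \<xi> u0) / (\<xi> u \<bullet> \<xi> u0)) *\<^sub>R \<xi> u =
            ((\<xi> u0 \<bullet> \<xi> u0) / (\<xi> u \<bullet> \<xi> u0)) *\<^sub>R (((\<xi> u \<bullet> \<xi> u0) / (\<xi> u0 \<bullet> \<xi> u0)) *\<^sub>R \<xi> u0)"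
          by (rule arg_cong[OF \<xi>_constant_direction[OF U(1,2,4,3) UA(2) u]])
        also have "\<dots> = \<xi> u0" using UA(2)[OF u] \<xi>_nonzero[OF u0] by simp
        finally show ?thesis by simp
      qed
      then obtain s' where s': "D x u v - ?c *\<^sub>R x u = s' *\<^sub>R \<xi> u" using s by (metis scaleR_scaleR)
      then have "D x u (v - s' *\<^sub>R T u) = (?c - s' * m u) *\<^sub>R x u"
        by (simp add: linear_diff[OF linear_Dx[OF UA(1)[OF u]]] linear_scale[OF linear_Dx[OF UA(1)[OF u]]]
            \<xi>_def \<tau>_def algebra_simps)
      from transversal[OF UA(1)[OF u] this] have vs: "v = s' *\<^sub>R T u" by simp
      then have "s' = 0" using th q_pos[OF UA(1)[OF u]] by (simp add: lin_\<theta>[OF UA(1)[OF u]] \<theta>_T)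
      then show ?thesis by (simp add: vs)
    qed
    then show ?thesis using linear_injective_0[OF lin] by blast
  qed
  show ?thesis
    by (rule that[OF U(1,3,4) sm\<Phi> inj]) (simp_all add: D\<Phi> DyT t(3))
qed


text \<open>In the inverse \<Psi> of the adapted chart the first coordinate field is the unit field
  along T and is orthogonal to the others, which gives dt^2 without mixed terms. The other entries
  of h all obey one linear equation in t, so they share a common factor depending on t.\<close>

theorem warped_product_coordinates:
  assumes u0: "u0 \<in> \<Omega>" and dimb: "DIM('a) = DIM('b::euclidean_space) + 1" and dimf: "DIM('f) = DIM('a) + 1"
  obtains I :: "real set" and J :: "'b::euclidean_space set" and \<rho> :: "real \<Rightarrow> real" and g :: "'b \<Rightarrow> 'b \<Rightarrow> 'b \<Rightarrow> real"
    and \<Psi> :: "real \<times> 'b \<Rightarrow> 'a" and \<Phi> :: "'a \<Rightarrow> real \<times> 'b"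
  where "open I" "is_interval I" "open J" "smooth_on I \<rho>" "\<And>t. t \<in> I \<Longrightarrow> \<rho> t > 0"
    "smooth_on (I \<times> J) \<Psi>" "\<Psi> ` (I \<times> J) \<subseteq> \<Omega>" "open (\<Psi> ` (I \<times> J))" "u0 \<in> \<Psi> ` (I \<times> J)"
    "smooth_on (\<Psi> ` (I \<times> J)) \<Phi>" "\<And>z. z \<in> I \<times> J \<Longrightarrow> \<Phi> (\<Psi> z) = z"
    "\<And>z v w. z \<in> I \<times> J \<Longrightarrow> h (\<Psi> z) (D \<Psi> z v) (D \<Psi> z w) =
      fst v * fst w + (\<rho> (fst z))\<^sup>2 * g (snd z) (snd v) (snd w)"
    "\<And>y. y \<in> J \<Longrightarrow> bilinear (g y)" "\<And>y v w. y \<in> J \<Longrightarrow> g y v w = g y w v"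
    "\<And>y v. y \<in> J \<Longrightarrow> v \<noteq> 0 \<Longrightarrow> g y v v > 0" "\<And>v w. smooth_on J (\<lambda>y. g y v w)"
proof -
  obtain U and \<Phi> :: "'a \<Rightarrow> real \<times> 'b" where U: "open U" "u0 \<in> U" "U \<subseteq> \<Omega>" "smooth_on U \<Phi>"
    and inj: "\<And>u. u \<in> U \<Longrightarrow> inj (D \<Phi> u)"
    and fstD: "\<And>u v. u \<in> U \<Longrightarrow> fst (D \<Phi> u v) = \<theta> u v / sqrt (q u)"
    and sndT: "\<And>u. u \<in> U \<Longrightarrow> snd (D \<Phi> u (T u)) = 0" and qU: "\<And>u. u \<in> U \<Longrightarrow> q u = q u0"
    by (rule exists_adapted_chart[OF u0 dimb dimf], rule that)
  have dimp: "DIM('a) = DIM(real \<times> 'b)" using dimb by simp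
  obtain U' V \<Psi> where loc: "open U'" "U' \<subseteq> U" "u0 \<in> U'" "open V" "\<Phi> ` U' = V" "\<Psi> ` V = U'"
    "\<And>u. u \<in> U' \<Longrightarrow> \<Psi> (\<Phi> u) = u" "\<And>z. z \<in> V \<Longrightarrow> \<Phi> (\<Psi> z) = z" and sm\<Psi>V: "smooth_on V \<Psi>"
    by (rule smooth_local_inverse[OF U(1,2,4) _ dimp], erule inj, rule that)
  define t0 where "t0 = fst (\<Phi> u0)"
  define y0 where "y0 = snd (\<Phi> u0)"
  have "(t0, y0) \<in> V" using loc(3,5) by (auto simp: t0_def y0_def)
  \<comment> \<open>The domain shrinks to a product of balls; convexity of each factor is what later
    turns vanishing derivatives in t or in y into constancy.\<close>
  then obtain A1 A2 where "open A1" "open A2" "t0 \<in> A1" "y0 \<in> A2" "A1 \<times> A2 \<subseteq> V"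
    using open_prod_elim[OF loc(4)] by (metis mem_Sigma_iff)
  moreover then obtain r1 r2 where "r1 > 0" "ball t0 r1 \<subseteq> A1" "r2 > 0" "ball y0 r2 \<subseteq> A2"
    using openE by metis
  ultimately have r: "r1 > 0" "r2 > 0" "ball t0 r1 \<times> ball y0 r2 \<subseteq> V" by blast+
  define I where "I = ball t0 r1"
  define J where "J = ball y0 r2"
  have IJ: "open I" "convex I" "t0 \<in> I" "open J" "convex J" "y0 \<in> J" "I \<times> J \<subseteq> V" "open (I \<times> J)"
    using r by (auto simp: I_def J_def intro: open_Times)
  have zV: "z \<in> V" "\<Psi> z \<in> U'" "\<Psi> z \<in> U" "\<Psi> z \<in> \<Omega>" if "z \<in> I \<times> J" for z
    using IJ(7) loc(2,6) U(3) that by blast+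
  have sm\<Psi>: "smooth_on (I \<times> J) \<Psi>" by (rule smooth_on_subset[OF sm\<Psi>V IJ(7)])
  have lin\<Psi>: "linear (D \<Psi> z)" if "z \<in> I \<times> J" for z by (rule smooth_on_linear_D[OF sm\<Psi> that])
  have img: "\<Psi> ` (I \<times> J) = U' \<inter> \<Phi> -` (I \<times> J)"
    using loc(7) zV loc(8) by (auto simp: image_iff) (metis mem_Sigma_iff)
  have "continuous_on U' \<Phi>" by (rule smooth_on_continuous[OF smooth_on_subset[OF U(4) loc(2)]])
  then have openimg: "open (\<Psi> ` (I \<times> J))"
    unfolding img by (intro continuous_open_preimage loc(1) IJ(8))
  have imgU: "\<Psi> ` (I \<times> J) \<subseteq> U" using zV by blast
  have u0img: "u0 \<in> \<Psi> ` (I \<times> J)"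
    unfolding img using loc(3) IJ(3,6) by (simp add: t0_def y0_def mem_Times_iff)
  have DD: "D \<Phi> (\<Psi> z) (D \<Psi> z v) = v" if z: "z \<in> I \<times> J" for z v
  proof -
    have "D (\<lambda>z. \<Phi> (\<Psi> z)) z v = D \<Phi> (\<Psi> z) (D \<Psi> z v)"
      by (rule D_compose[OF smooth_on_differentiable[OF U(4) zV(3)[OF z]] smooth_on_differentiable[OF sm\<Psi> z]])
    moreover have "D (\<lambda>z. \<Phi> (\<Psi> z)) z v = D (\<lambda>z. z) z v"
      by (rule fun_cong[OF D_cong[OF IJ(8) z]]) (simp add: loc(8) zV(1))
    ultimately show ?thesis by simp
  qed
  define Q where "Q = q u0"
  have Q: "Q > 0" unfolding Q_def by (rule q_pos[OF u0])
  have qz: "q (\<Psi> z) = Q" if "z \<in> I \<times> J" for z using qU[OF zV(3)[OF that]] by (simp add: Q_def)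
  have \<theta>D: "\<theta> (\<Psi> z) (D \<Psi> z v) = sqrt Q * fst v" if z: "z \<in> I \<times> J" for z v
    using fstD[OF zV(3)[OF z], of "D \<Psi> z v"] Q by (simp add: DD[OF z] qz[OF z] field_simps)
  have D10: "D \<Psi> z (1, 0) = (1 / sqrt Q) *\<^sub>R T (\<Psi> z)" if z: "z \<in> I \<times> J" for z
  proof -
    have lin: "linear (D \<Phi> (\<Psi> z))" by (rule smooth_on_linear_D[OF U(4) zV(3)[OF z]])
    have "fst (D \<Phi> (\<Psi> z) (T (\<Psi> z))) = sqrt Q"
      using Q fstD[OF zV(3)[OF z], of "T (\<Psi> z)"] by (simp add: \<theta>_T qz[OF z] real_div_sqrt)
    then have "D \<Phi> (\<Psi> z) ((1 / sqrt Q) *\<^sub>R T (\<Psi> z)) = (1, 0)"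
      using Q sndT[OF zV(3)[OF z]] by (intro prod_eqI) (simp_all add: linear_scale[OF lin])
    then have "D \<Phi> (\<Psi> z) ((1 / sqrt Q) *\<^sub>R T (\<Psi> z)) = D \<Phi> (\<Psi> z) (D \<Psi> z (1, 0))" by (simp add: DD[OF z])
    then show ?thesis using inj[OF zV(3)[OF z]] by (simp add: inj_eq)
  qed
  define Y where "Y \<eta> z = D \<Psi> z (0, \<eta>)" for \<eta> z
  have smY: "smooth_on (I \<times> J) (Y \<eta>)" for \<eta> unfolding Y_def by (rule smooth_on_D[OF sm\<Psi>])
  have split: "D \<Psi> z v = (fst v / sqrt Q) *\<^sub>R T (\<Psi> z) + Y (snd v) z" if z: "z \<in> I \<times> J" for z v
  proof -
    have "v = fst v *\<^sub>R (1, 0) + (0, snd v)" by (simp add: prod_eq_iff)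
    then have "D \<Psi> z v = fst v *\<^sub>R D \<Psi> z (1, 0) + D \<Psi> z (0, snd v)"
      by (metis linear_add[OF lin\<Psi>[OF z]] linear_scale[OF lin\<Psi>[OF z]])
    then show ?thesis by (simp add: D10[OF z] Y_def)
  qed
  have YT: "\<theta> (\<Psi> z) (Y \<eta> z) = 0" if "z \<in> I \<times> J" for z \<eta> using \<theta>D[OF that] by (simp add: Y_def)
  have Ynz: "Y \<eta> z \<noteq> 0" if z: "z \<in> I \<times> J" and "\<eta> \<noteq> 0" for z \<eta>
  proof
    assume "Y \<eta> z = 0"
    then have "D \<Phi> (\<Psi> z) (Y \<eta> z) = 0"
      using linear_0[OF smooth_on_linear_D[OF U(4) zV(3)[OF z]]] by simp
    then show False using DD[OF z, of "(0, \<eta>)"] that(2) by (simp add: Y_def zero_prod_def)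
  qed
  define H where "H \<eta> \<eta>' z = h (\<Psi> z) (Y \<eta> z) (Y \<eta>' z)" for \<eta> \<eta>' z
  have metricH: "h (\<Psi> z) (D \<Psi> z v) (D \<Psi> z w) = fst v * fst w + H (snd v) (snd w) z" if z: "z \<in> I \<times> J" for z v w
  proof -
    have hT: "h (\<Psi> z) (T (\<Psi> z)) (Y \<eta> z) = 0" "h (\<Psi> z) (Y \<eta> z) (T (\<Psi> z)) = 0" for \<eta>
      using YT[OF z, of \<eta>] h_sym[OF zV(4)[OF z]] by (simp_all add: \<theta>_def)
    have hTT: "h (\<Psi> z) (T (\<Psi> z)) (T (\<Psi> z)) = Q" using qz[OF z] by (simp add: q_def)
    show ?thesis using Q by (simp add: split[OF z] lin_h[OF zV(4)[OF z]] hT hTT H_def)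
  qed
  have sm_h\<Psi>: "smooth_on (I \<times> J) (\<lambda>z. h (\<Psi> z) v w)" for v w
    by (rule smooth_on_compose[OF IJ(8) open_\<Omega> _ sm\<Psi> smooth_h]) (use zV(4) in blast)
  have sm_hY: "smooth_on (I \<times> J) (\<lambda>z. h (\<Psi> z) (Y \<eta> z) w)" for \<eta> w
    by (rule smooth_on_linear_field[OF IJ(8) linear_h(2)[OF zV(4)] sm_h\<Psi> smY])
  have smH: "smooth_on (I \<times> J) (H \<eta> \<eta>')" for \<eta> \<eta>'
    unfolding H_def[abs_def] by (rule smooth_on_linear_field[OF IJ(8) linear_h(1)[OF zV(4)] sm_hY smY])
  \<comment> \<open>Without torsion, the Levi-Civita derivative of Y along the first coordinate
    field T / sqrt Q equals that of T / sqrt Q along Y, and \<open>S_eq\<close> evaluates it since Y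
    is orthogonal to T.\<close>
  have DY: "D (Y \<eta>) z (1, 0) + L (\<Psi> z) (D \<Psi> z (1, 0)) (Y \<eta> z) = (\<mu> (\<Psi> z) / sqrt Q) *\<^sub>R Y \<eta> z"
    if z: "z \<in> I \<times> J" for z \<eta>
  proof -
    note z4 = zV(4)[OF z]
    have dT\<Psi>: "(\<lambda>z. T (\<Psi> z)) differentiable (at z)"
      by (rule differentiable_compose[OF smooth_on_differentiable[OF smooth_T z4] smooth_on_differentiable[OF sm\<Psi> z]])
    have "D (Y \<eta>) z (1, 0) = D (\<lambda>z. D \<Psi> z (1, 0)) z (0, \<eta>)"
      unfolding Y_def by (rule D_commute[OF IJ(8) z sm\<Psi>])
    also have "\<dots> = D (\<lambda>z. (1 / sqrt Q) *\<^sub>R T (\<Psi> z)) z (0, \<eta>)"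
      by (rule fun_cong[OF D_cong[OF IJ(8) z D10]])
    also have "\<dots> = (1 / sqrt Q) *\<^sub>R D T (\<Psi> z) (Y \<eta> z)"
      by (simp add: D_bounded_linear[OF bounded_linear_scaleR_right dT\<Psi>] Y_def
          D_compose[OF smooth_on_differentiable[OF smooth_T z4] smooth_on_differentiable[OF sm\<Psi> z]])
    finally have "D (Y \<eta>) z (1, 0) + L (\<Psi> z) (D \<Psi> z (1, 0)) (Y \<eta> z) = (1 / sqrt Q) *\<^sub>R S (\<Psi> z) (Y \<eta> z)"
      by (simp add: D10[OF z] lin_L[OF z4] S_def scaleR_add_right L_sym[OF z4, of "T (\<Psi> z)"])
    then show ?thesis by (simp add: S_eq[OF z4] YT[OF z])
  qed
  have DH: "D (H \<eta> \<eta>') z (1, 0) = 2 * (\<mu> (\<Psi> z) / sqrt Q) * H \<eta> \<eta>' z" if z: "z \<in> I \<times> J" for z \<eta> \<eta>'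
  proof -
    note z4 = zV(4)[OF z]
    have Dh: "D (\<lambda>z. h (\<Psi> z) v w) z e = h (\<Psi> z) (L (\<Psi> z) (D \<Psi> z e) v) w + h (\<Psi> z) v (L (\<Psi> z) (D \<Psi> z e) w)" for v w e
      using D_compose[OF smooth_on_differentiable[OF smooth_h z4] smooth_on_differentiable[OF sm\<Psi> z], of v w e]
      by (simp add: metric[OF z4])
    have "D (H \<eta> \<eta>') z e = h (\<Psi> z) (D (Y \<eta>) z e + L (\<Psi> z) (D \<Psi> z e) (Y \<eta> z)) (Y \<eta>' z)
        + h (\<Psi> z) (Y \<eta> z) (D (Y \<eta>') z e + L (\<Psi> z) (D \<Psi> z e) (Y \<eta>' z))" for e
      using D_linear_field[OF IJ(8) z linear_h(1)[OF zV(4)] sm_hY smY, of \<eta> \<eta>' e]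
        D_linear_field[OF IJ(8) z linear_h(2)[OF zV(4)] sm_h\<Psi> smY, of \<eta> "Y \<eta>' z" e]
      by (simp add: H_def[abs_def] Dh lin_h[OF z4])
    then have "D (H \<eta> \<eta>') z (1, 0) = h (\<Psi> z) ((\<mu> (\<Psi> z) / sqrt Q) *\<^sub>R Y \<eta> z) (Y \<eta>' z)
        + h (\<Psi> z) (Y \<eta> z) ((\<mu> (\<Psi> z) / sqrt Q) *\<^sub>R Y \<eta>' z)"
      by (simp only: DY[OF z])
    then show ?thesis by (simp add: lin_h[OF z4] H_def)
  qed
  have Hpos: "H \<eta> \<eta> z > 0" if "z \<in> I \<times> J" "\<eta> \<noteq> 0" for z \<eta>
    unfolding H_def by (rule h_pos[OF zV(4)[OF that(1)] Ynz[OF that]])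
  \<comment> \<open>By \<open>D_\<mu>\<close> the derivative of \<mu> is a multiple of \<theta>,
    which vanishes on the y-directions. Hence the factor in \<open>DH\<close> depends on t
    alone.\<close>
  have \<mu>J: "\<mu> (\<Psi> (t, y)) = \<mu> (\<Psi> (t, y0))" if t: "t \<in> I" and y: "y \<in> J" for t y
  proof (rule zero_derivative_constant[OF IJ(5,4) _ y IJ(6)])
    fix y assume "y \<in> J"
    then have z: "(t, y) \<in> I \<times> J" using t by simp
    have d1: "((\<lambda>y. (t, y)) has_derivative (\<lambda>\<eta>. (0, \<eta>))) (at y)"
      by (intro has_derivative_Pair has_derivative_const has_derivative_ident)
    have d2: "((\<lambda>z. \<mu> (\<Psi> z)) has_derivative (\<lambda>v. D \<mu> (\<Psi> (t, y)) (D \<Psi> (t, y) v))) (at (t, y))"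
      by (rule has_derivative_compose[OF smooth_on_has_derivative[OF sm\<Psi> z] smooth_on_has_derivative[OF smooth_\<mu> zV(4)[OF z]]])
    have "D \<mu> (\<Psi> (t, y)) (D \<Psi> (t, y) (0, \<eta>)) = 0" for \<eta>
      using YT[OF z, of \<eta>] by (simp add: D_\<mu>[OF zV(4)[OF z]] Y_def)
    then show "((\<lambda>y. \<mu> (\<Psi> (t, y))) has_derivative (\<lambda>\<eta>. 0)) (at y)"
      using has_derivative_compose[OF d1 d2] by simp
  qed
  \<comment> \<open>All entries of H solve the same linear equation in t; the entry at one fixed
    nonzero vector and at y0 represents their common profile and is positive.\<close>
  obtain \<eta>0 :: 'b where \<eta>0: "\<eta>0 \<noteq> 0" using nonzero_Basis nonempty_Basis by blast
  define R where "R t = H \<eta>0 \<eta>0 (t, y0)" for t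
  have smslice: "smooth_on I (\<lambda>t. H \<eta> \<eta>' (t, y))" if "y \<in> J" for y \<eta> \<eta>'
    by (rule smooth_on_compose[OF IJ(1,8) _ _ smH]) (use that IJ(1) in \<open>auto intro: smooth_on_Pair smooth_on_id smooth_on_const\<close>)
  have Rpos: "R t > 0" if "t \<in> I" for t unfolding R_def using that IJ(6) by (intro Hpos \<eta>0) auto
  have dslice: "((\<lambda>t. H \<eta> \<eta>' (t, y)) has_real_derivative 2 * (\<mu> (\<Psi> (t, y0)) / sqrt Q) * H \<eta> \<eta>' (t, y)) (at t)"
    if t: "t \<in> I" and y: "y \<in> J" for t y \<eta> \<eta>'
  proof -
    have z: "(t, y) \<in> I \<times> J" using t y by simp
    have "(H \<eta> \<eta>') differentiable (at ((0, y) + t *\<^sub>R (1, 0)))"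
      using smooth_on_differentiable[OF smH z] by simp
    from has_real_derivative_line[OF this] show ?thesis by (simp add: DH[OF z] \<mu>J[OF t y])
  qed
  have ratio: "H \<eta> \<eta>' (t, y) / R t = H \<eta> \<eta>' (t0, y) / R t0" if t: "t \<in> I" and y: "y \<in> J" for t y \<eta> \<eta>'
  proof (rule zero_derivative_constant[OF IJ(2,1) _ t IJ(3)])
    fix s assume s: "s \<in> I"
    define k where "k = 2 * (\<mu> (\<Psi> (s, y0)) / sqrt Q)"
    have "((\<lambda>t. H \<eta> \<eta>' (t, y) / R t) has_real_derivative
        (k * H \<eta> \<eta>' (s, y) * R s - H \<eta> \<eta>' (s, y) * (k * R s)) / (R s * R s)) (at s)"
      using dslice[OF s y, of \<eta> \<eta>'] dslice[OF s IJ(6), of \<eta>0 \<eta>0] Rpos[OF s] unfolding R_def k_def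
      by (intro DERIV_divide) auto
    then show "((\<lambda>t. H \<eta> \<eta>' (t, y) / R t) has_derivative (\<lambda>v. 0)) (at s)"
      by (simp add: has_field_derivative_def mult.commute mult.left_commute lambda_zero)
  qed
  \<comment> \<open>By \<open>ratio\<close> the quotient of H by R does not depend on t, so its
    value at t0 serves as the metric of the fibre.\<close>
  define \<rho> where "\<rho> t = sqrt (R t)" for t
  define g where "g y v w = H v w (t0, y) / R t0" for y v w
  have z0: "(t0, y) \<in> I \<times> J" if "y \<in> J" for y using that IJ(3) by simp
  show ?thesis
  proof (rule that[where I = I and J = J and \<rho> = \<rho> and g = g and \<Psi> = \<Psi> and \<Phi> = \<Phi>])
    show "is_interval I" using IJ(2) by (simp add: is_interval_convex_1)
    show "smooth_on I \<rho>" unfolding \<rho>_def[abs_def] R_def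
      by (intro smooth_on_sqrt IJ(1) smslice IJ(6)) (use Rpos in \<open>simp add: R_def\<close>)
    show "\<rho> t > 0" if "t \<in> I" for t using Rpos[OF that] by (simp add: \<rho>_def)
    show "\<Psi> ` (I \<times> J) \<subseteq> \<Omega>" using zV(4) by blast
    show "smooth_on (\<Psi> ` (I \<times> J)) \<Phi>" by (rule smooth_on_subset[OF U(4) imgU])
    show "\<Phi> (\<Psi> z) = z" if "z \<in> I \<times> J" for z by (rule loc(8)[OF zV(1)[OF that]])
    show "h (\<Psi> z) (D \<Psi> z v) (D \<Psi> z w) = fst v * fst w + (\<rho> (fst z))\<^sup>2 * g (snd z) (snd v) (snd w)"
      if z: "z \<in> I \<times> J" for z v w
    proof -
      obtain t y where ty: "z = (t, y)" "t \<in> I" "y \<in> J" using z by auto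
      have "(\<rho> t)\<^sup>2 * g y (snd v) (snd w) = R t * (H (snd v) (snd w) (t, y) / R t)"
        using Rpos[OF ty(2)] by (simp only: g_def ratio[OF ty(2,3)] \<rho>_def) simp
      also have "\<dots> = H (snd v) (snd w) z" using Rpos[OF ty(2)] by (simp add: ty(1))
      finally show ?thesis using metricH[OF z, of v w] by (simp add: ty(1))
    qed
    fix y assume y: "y \<in> J"
    note z = z0[OF y]
    show "bilinear (g y)"
      unfolding bilinear_def
    proof (intro conjI allI linearI)
      have Yadd: "Y (v + w) (t0, y) = Y v (t0, y) + Y w (t0, y)" for v w
        using linear_add[OF lin\<Psi>[OF z], of "(0, v)" "(0, w)"] by (simp add: Y_def)
      have Ysc: "Y (c *\<^sub>R v) (t0, y) = c *\<^sub>R Y v (t0, y)" for c v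
        using linear_scale[OF lin\<Psi>[OF z], of c "(0, v)"] by (simp add: Y_def)
      show "g y v (w + w') = g y v w + g y v w'" "g y v (c *\<^sub>R w) = c *\<^sub>R g y v w"
        "g y (v + v') w = g y v w + g y v' w" "g y (c *\<^sub>R v) w = c *\<^sub>R g y v w" for v v' w w' c
        by (simp_all add: g_def H_def Yadd Ysc lin_h[OF zV(4)[OF z]] add_divide_distrib)
    qed
    show "g y v w = g y w v" for v w by (simp add: g_def H_def h_sym[OF zV(4)[OF z], of "Y v _"])
    show "g y v v > 0" if "v \<noteq> 0" for v using Hpos[OF z that] Rpos[OF IJ(3)] by (simp add: g_def)
  next
    show "smooth_on J (\<lambda>y. g y v w)" for v w unfolding g_def divide_inverse
    proof (intro smooth_on_mult IJ(4) smooth_on_const)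
      show "smooth_on J (\<lambda>y. H v w (t0, y))"
        by (rule smooth_on_compose[OF IJ(4,8) _ _ smH])
          (use IJ in \<open>auto intro: smooth_on_Pair smooth_on_id smooth_on_const\<close>)
    qed
  qed (use IJ sm\<Psi> openimg u0img in auto)
qed

end

section \<open>Charts of a smooth manifold\<close>

locale manifold_chart =
  fixes M :: "('m, 'a::euclidean_space) manifold" and U :: "'m set" and \<phi> :: "'m \<Rightarrow> 'a"
  assumes manifold: "smooth_manifold M" and chart: "(U, \<phi>) \<in> charts M"
begin

abbreviation "\<psi> \<equiv> inv_into U \<phi>"

lemma open_chart: "openin (mtop M) U" and open_image: "open (\<phi> ` U)"
  and homeo: "homeomorphic_map (subtopology (mtop M) U) (top_of_set (\<phi> ` U)) \<phi>"
  using manifold chart by (auto simp: smooth_manifold_def)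

lemma U_subset: "U \<subseteq> topspace (mtop M)"
  by (rule openin_subset[OF open_chart])

lemma inj: "inj_on \<phi> U"
  using homeomorphic_imp_injective_map[OF homeo] U_subset by (simp add: topspace_subtopology Int_absorb1)

lemma inv [simp]: "p \<in> U \<Longrightarrow> \<psi> (\<phi> p) = p"
  by (simp add: inv_into_f_f inj)

lemma inv_in: "u \<in> \<phi> ` U \<Longrightarrow> \<psi> u \<in> U" and inv_right: "u \<in> \<phi> ` U \<Longrightarrow> \<phi> (\<psi> u) = u"
  by (simp_all add: inv_into_into f_inv_into_f)

lemma open_image_subset:
  assumes "openin (mtop M) W" shows "open (\<phi> ` (U \<inter> W))"
proof -
  have "openin (subtopology (mtop M) U) (U \<inter> W)"
    using assms by (auto simp: openin_subtopology_alt)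
  then have "openin (top_of_set (\<phi> ` U)) (\<phi> ` (U \<inter> W))"
    using homeomorphic_imp_open_map[OF homeo] by (simp add: open_map_def)
  then show ?thesis using open_image by (simp add: openin_open_eq)
qed

lemma open_image_sub: "openin (mtop M) W \<Longrightarrow> W \<subseteq> U \<Longrightarrow> open (\<phi> ` W)"
  using open_image_subset[of W] by (simp add: Int_absorb1)

lemma open_inv_image:
  assumes "open A" "A \<subseteq> \<phi> ` U"
  shows "openin (mtop M) (\<psi> ` A)"
proof -
  have "openin (top_of_set (\<phi> ` U)) A" using assms open_image by (simp add: openin_open_eq)
  then have "openin (subtopology (mtop M) U) {p \<in> topspace (subtopology (mtop M) U). \<phi> p \<in> A}"
    by (rule openin_continuous_map_preimage[OF homeomorphic_imp_continuous_map[OF homeo]])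
  moreover have "{p \<in> topspace (subtopology (mtop M) U). \<phi> p \<in> A} = \<psi> ` A"
  proof
    show "{p \<in> topspace (subtopology (mtop M) U). \<phi> p \<in> A} \<subseteq> \<psi> ` A"
    proof
      fix p assume "p \<in> {p \<in> topspace (subtopology (mtop M) U). \<phi> p \<in> A}"
      then have "p \<in> U" "\<phi> p \<in> A" by (auto simp: topspace_subtopology)
      then show "p \<in> \<psi> ` A" by (metis inv imageI)
    qed
    show "\<psi> ` A \<subseteq> {p \<in> topspace (subtopology (mtop M) U). \<phi> p \<in> A}"
    proof
      fix p assume "p \<in> \<psi> ` A"
      then obtain u where u: "u \<in> A" "u \<in> \<phi> ` U" "p = \<psi> u" using assms(2) by auto
      then show "p \<in> {p \<in> topspace (subtopology (mtop M) U). \<phi> p \<in> A}"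
        using U_subset inv_in[OF u(2)] inv_right[OF u(2)] by (auto simp: topspace_subtopology)
    qed
  qed
  ultimately have "openin (subtopology (mtop M) U) (\<psi> ` A)" by simp
  then show ?thesis using open_chart by (rule openin_trans_full)
qed

lemma smooth_fun_on_chartD:
  "smooth_fun_on M W f \<Longrightarrow> smooth_on (\<phi> ` (U \<inter> W)) (\<lambda>u. f (\<psi> u))"
  using chart by (auto simp: smooth_fun_on_def o_def)

lemma transition:
  assumes "(V, \<kappa>) \<in> charts M"
  shows "smooth_on (\<kappa> ` (V \<inter> U)) (\<lambda>u. \<phi> (inv_into V \<kappa> u))" "smooth_on (\<phi> ` (U \<inter> V)) (\<lambda>u. \<kappa> (\<psi> u))"
  using manifold chart assms by (auto simp: smooth_manifold_def o_def)

text \<open>Smoothness is demanded in every chart of the atlas; the transition maps reduce it to the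
  given one.\<close>

lemma smooth_fun_on_chartI:
  assumes W: "openin (mtop M) W" "W \<subseteq> U" and f: "smooth_on (\<phi> ` W) (\<lambda>u. f (\<psi> u))"
  shows "smooth_fun_on M W f"
  unfolding smooth_fun_on_def
proof clarify
  fix V \<kappa> assume V: "(V, \<kappa>) \<in> charts M"
  interpret V: manifold_chart M V \<kappa> by standard (use manifold V in auto)
  have op: "open (\<kappa> ` (V \<inter> W))" by (rule V.open_image_subset[OF W(1)])
  have "smooth_on (\<kappa> ` (V \<inter> W)) (\<lambda>u. f (\<psi> (\<phi> (V.\<psi> u))))"
  proof (rule smooth_on_compose[OF op open_image_sub[OF W]  _ _ f])
    show "(\<lambda>u. \<phi> (V.\<psi> u)) ` (\<kappa> ` (V \<inter> W)) \<subseteq> \<phi> ` W" by auto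
    show "smooth_on (\<kappa> ` (V \<inter> W)) (\<lambda>u. \<phi> (V.\<psi> u))"
      by (rule smooth_on_subset[OF transition(1)[OF V]]) (use W(2) in auto)
  qed
  then show "smooth_on (\<kappa> ` (V \<inter> W)) (f \<circ> V.\<psi>)"
    by (rule smooth_on_cong[OF _ op]) (use W(2) in \<open>auto simp: subset_iff\<close>)
qed

lemma smooth_fun_on_iff:
  "openin (mtop M) W \<Longrightarrow> W \<subseteq> U \<Longrightarrow> smooth_fun_on M W f \<longleftrightarrow> smooth_on (\<phi> ` W) (\<lambda>u. f (\<psi> u))"
  using smooth_fun_on_chartI smooth_fun_on_chartD[of W f] by (auto simp: Int_absorb1)

lemma smooth_fun_on_subset:
  "smooth_fun_on M W f \<Longrightarrow> W' \<subseteq> W \<Longrightarrow> smooth_fun_on M W' f"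
  unfolding smooth_fun_on_def by (fastforce intro: smooth_on_subset)

lemma smooth_atI: "openin (mtop M) W \<Longrightarrow> smooth_fun_on M W f \<Longrightarrow> p \<in> W \<Longrightarrow> smooth_at M p f"
  by (auto simp: smooth_at_def)

lemma smooth_at_local:
  assumes "smooth_at M p f" "p \<in> U"
  obtains W where "openin (mtop M) W" "W \<subseteq> U" "p \<in> W" "smooth_on (\<phi> ` W) (\<lambda>u. f (\<psi> u))"
proof -
  obtain W where W: "openin (mtop M) W" "p \<in> W" "smooth_fun_on M W f" using assms(1) by (auto simp: smooth_at_def)
  show ?thesis
    by (rule that[of "U \<inter> W"]) (use W assms(2) smooth_fun_on_chartD[OF W(3)] open_chart in auto)
qed

lemma smooth_at_differentiable:
  assumes "smooth_at M p f" "p \<in> U" shows "(\<lambda>u. f (\<psi> u)) differentiable (at (\<phi> p))"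
proof -
  obtain W where "p \<in> W" "smooth_on (\<phi> ` W) (\<lambda>u. f (\<psi> u))" by (rule smooth_at_local[OF assms])
  then show ?thesis by (intro smooth_on_differentiable) auto
qed

definition coord :: "'m \<Rightarrow> 'a \<Rightarrow> 'm tvec" where "coord p v = coord_tvec M (U, \<phi>) p v"
text \<open>A derivation is recovered from its values on the coordinate functions; on tangent
  vectors this inverts \<open>coord\<close>.\<close>

definition components :: "'m tvec \<Rightarrow> 'a" where "components X = (\<Sum>b\<in>Basis. X (\<lambda>q. \<phi> q \<bullet> b) *\<^sub>R b)"

lemma coord_eq: "coord p v f = (if smooth_at M p f then D (\<lambda>u. f (\<psi> u)) (\<phi> p) v else 0)"
  by (simp add: coord_def coord_tvec_def o_def)

lemma coord_apply:
  "openin (mtop M) W \<Longrightarrow> smooth_fun_on M W f \<Longrightarrow> p \<in> W \<Longrightarrow> coord p v f = D (\<lambda>u. f (\<psi> u)) (\<phi> p) v"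
  by (simp add: coord_eq smooth_atI)

lemma linear_coord: "p \<in> U \<Longrightarrow> linear (\<lambda>v. coord p v f)"
  using smooth_at_differentiable[of p f]
  by (cases "smooth_at M p f") (auto simp: coord_eq[abs_def] frechet_derivative_works has_derivative_linear linear_zero)

lemma coord_add: "p \<in> U \<Longrightarrow> coord p (v + w) = (\<lambda>f. coord p v f + coord p w f)"
  and coord_scale: "p \<in> U \<Longrightarrow> coord p (r *\<^sub>R v) = (\<lambda>f. r * coord p v f)"
  and coord_diff: "p \<in> U \<Longrightarrow> coord p (v - w) = (\<lambda>f. coord p v f - coord p w f)"
  and coord_zero: "p \<in> U \<Longrightarrow> coord p 0 = (\<lambda>f. 0)"
  using linear_add[OF linear_coord] linear_scale[OF linear_coord] linear_diff[OF linear_coord]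
    linear_0[OF linear_coord] by (auto simp: fun_eq_iff)

lemma smooth_coordinate: "smooth_fun_on M U (\<lambda>q. \<phi> q \<bullet> b)"
proof (rule smooth_fun_on_chartI[OF open_chart subset_refl])
  have "smooth_on (\<phi> ` U) (\<lambda>u. u \<bullet> b)"
    by (intro smooth_on_linear[OF bounded_linear_inner_left] open_image smooth_on_id)
  then show "smooth_on (\<phi> ` U) (\<lambda>u. \<phi> (\<psi> u) \<bullet> b)"
    by (rule smooth_on_cong[OF _ open_image]) (simp add: inv_right)
qed

lemma components_coord: assumes p: "p \<in> U" shows "components (coord p v) = v"
proof -
  have "coord p v (\<lambda>q. \<phi> q \<bullet> b) = v \<bullet> b" for b
  proof -
    have "coord p v (\<lambda>q. \<phi> q \<bullet> b) = D (\<lambda>u. \<phi> (\<psi> u) \<bullet> b) (\<phi> p) v"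
      by (rule coord_apply[OF open_chart smooth_coordinate p])
    also have "\<dots> = D (\<lambda>u. u \<bullet> b) (\<phi> p) v"
      by (rule fun_cong[OF D_cong[OF open_image]]) (use p in \<open>auto simp: inv_right\<close>)
    also have "\<dots> = v \<bullet> b" by (simp add: D_eqI[OF bounded_linear_imp_has_derivative[OF bounded_linear_inner_left]])
    finally show ?thesis .
  qed
  then show ?thesis by (simp add: components_def euclidean_representation)
qed

lemma coord_tvec_change:
  assumes c: "(V, \<kappa>) \<in> charts M" "p \<in> V" "p \<in> U"
  shows "coord_tvec M (V, \<kappa>) p v = coord p (D (\<lambda>u. \<phi> (inv_into V \<kappa> u)) (\<kappa> p) v)"
proof
  fix f
  interpret V: manifold_chart M V \<kappa> by standard (use manifold c in auto)
  show "coord_tvec M (V, \<kappa>) p v f = coord p (D (\<lambda>u. \<phi> (V.\<psi> u)) (\<kappa> p) v) f"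
  proof (cases "smooth_at M p f")
    case True
    have p: "\<kappa> p \<in> \<kappa> ` (V \<inter> U)" using c by auto
    have d1: "(\<lambda>u. \<phi> (V.\<psi> u)) differentiable (at (\<kappa> p))"
      by (rule smooth_on_differentiable[OF transition(1)[OF c(1)] p])
    have d2: "(\<lambda>u. f (\<psi> u)) differentiable (at (\<phi> (V.\<psi> (\<kappa> p))))"
      using smooth_at_differentiable[OF True c(3)] c(2) by simp
    have "D (\<lambda>u. f (V.\<psi> u)) (\<kappa> p) v = D (\<lambda>u. f (\<psi> (\<phi> (V.\<psi> u)))) (\<kappa> p) v"
      by (rule fun_cong[OF D_cong[OF V.open_image_subset[OF open_chart] p]]) (auto)
    also have "\<dots> = D (\<lambda>u. f (\<psi> u)) (\<phi> p) (D (\<lambda>u. \<phi> (V.\<psi> u)) (\<kappa> p) v)"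
      using D_compose[OF d2 d1] c(2) by simp
    finally show ?thesis using True by (simp add: coord_eq coord_tvec_def o_def)
  qed (simp add: coord_eq coord_tvec_def)
qed

text \<open>The tangent space collects the coordinate vectors of all charts around p; the chain rule
  in \<open>coord_tvec_change\<close> expresses each of them in the present chart.\<close>

lemma tangent_space_coord: "p \<in> U \<Longrightarrow> tangent_space M p = range (coord p)"
proof -
  assume p: "p \<in> U"
  have "X \<in> range (coord p)" if "X \<in> tangent_space M p" for X
    using that coord_tvec_change[OF _ _ p] unfolding tangent_space_def by force
  moreover have "coord p v \<in> tangent_space M p" for v
    unfolding tangent_space_def coord_def using chart p by force
  ultimately show ?thesis by blast
qed

lemma coord_components: "p \<in> U \<Longrightarrow> X \<in> tangent_space M p \<Longrightarrow> coord p (components X) = X"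
  by (auto simp: tangent_space_coord components_coord)

lemma components_linear: "components (\<lambda>f. r * X f + s * Y f) = r *\<^sub>R components X + s *\<^sub>R components Y"
  by (simp add: components_def scaleR_add_left sum.distrib scaleR_sum_right)

lemma coord_eq_zero: "p \<in> U \<Longrightarrow> coord p v = (\<lambda>f. 0) \<longleftrightarrow> v = 0"
  using components_coord[of p v] components_coord[of p 0] by (auto simp: coord_zero)

lemma smooth_fun_on_inner:
  fixes g :: "'m \<Rightarrow> 'e::euclidean_space"
  assumes "openin (mtop M) W" "smooth_fun_on M W g"
  shows "smooth_fun_on M W (\<lambda>q. g q \<bullet> b)"
  unfolding smooth_fun_on_def
proof clarify
  fix V \<kappa> assume V: "(V, \<kappa>) \<in> charts M"
  interpret V: manifold_chart M V \<kappa> by standard (use manifold V in auto)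
  show "smooth_on (\<kappa> ` (V \<inter> W)) ((\<lambda>q. g q \<bullet> b) \<circ> V.\<psi>)"
    using smooth_on_linear[OF bounded_linear_inner_left V.open_image_subset[OF assms(1)] V.smooth_fun_on_chartD[OF assms(2)]]
    by (simp add: o_def)
qed

lemma flat_deriv_coord:
  fixes g :: "'m \<Rightarrow> 'e::euclidean_space"
  assumes W: "openin (mtop M) W" "smooth_fun_on M W g" "p \<in> W" "p \<in> U"
  shows "flat_deriv (coord p v) g = D (\<lambda>u. g (\<psi> u)) (\<phi> p) v"
proof -
  have d: "(\<lambda>u. g (\<psi> u)) differentiable (at (\<phi> p))"
    by (rule smooth_on_differentiable[OF smooth_fun_on_chartD[OF W(2)]]) (use W in auto)
  have "coord p v (\<lambda>q. g q \<bullet> b) = D (\<lambda>u. g (\<psi> u)) (\<phi> p) v \<bullet> b" for b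
    using coord_apply[OF W(1) smooth_fun_on_inner[OF W(1,2)] W(3)] D_bounded_linear[OF bounded_linear_inner_left d] by simp
  then show ?thesis by (simp add: flat_deriv_def euclidean_representation)
qed

definition field :: "('a \<Rightarrow> 'a) \<Rightarrow> 'm vfield" where "field Z p = coord p (Z (\<phi> p))"
definition rep :: "'m vfield \<Rightarrow> 'a \<Rightarrow> 'a" where "rep X u = components (X (\<psi> u))"

lemma vector_field_on_field:
  assumes W: "openin (mtop M) W" "W \<subseteq> U" and Z: "smooth_on (\<phi> ` W) Z"
  shows "vector_field_on M W (field Z)"
  unfolding vector_field_on_def
proof (intro conjI ballI allI impI; (elim conjE)?)
  show "field Z p \<in> tangent_space M p" if "p \<in> W" for p
    using that W(2) tangent_space_coord[of p] by (auto simp: field_def)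
  fix W' and f :: "'m \<Rightarrow> real" assume W': "openin (mtop M) W'" "W' \<subseteq> W" "smooth_fun_on M W' f"
  have W'U: "W' \<subseteq> U" using W' W by auto
  have op: "open (\<phi> ` W')" by (rule open_image_sub[OF W'(1) W'U])
  have f: "smooth_on (\<phi> ` W') (\<lambda>u. f (\<psi> u))" by (rule iffD1[OF smooth_fun_on_iff[OF W'(1) W'U] W'(3)])
  show "smooth_fun_on M W' (\<lambda>p. field Z p f)"
  proof (rule smooth_fun_on_chartI[OF W'(1) W'U])
    have "smooth_on (\<phi> ` W') (\<lambda>u. D (\<lambda>u. f (\<psi> u)) u (Z u))"
      using smooth_on_linear_field[OF op smooth_on_linear_D[OF f] smooth_on_D[OF f] smooth_on_subset[OF Z]] W'(2) by blast
    then show "smooth_on (\<phi> ` W') (\<lambda>u. field Z (\<psi> u) f)"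
    proof (rule smooth_on_cong[OF _ op])
      fix u assume "u \<in> \<phi> ` W'"
      then obtain p where p: "p \<in> W'" "u = \<phi> p" by auto
      then show "D (\<lambda>u. f (\<psi> u)) u (Z u) = field Z (\<psi> u) f"
        using coord_apply[OF W'(1,3) p(1)] W'U by (auto simp: field_def)
    qed
  qed
qed

lemma rep_field: "u \<in> \<phi> ` U \<Longrightarrow> rep (field Z) u = Z u"
  by (auto simp: rep_def field_def components_coord inv_in inv_right)

lemma field_rep: "vector_field_on M W X \<Longrightarrow> p \<in> W \<Longrightarrow> p \<in> U \<Longrightarrow> X p = coord p (rep X (\<phi> p))"
  by (simp add: rep_def coord_components vector_field_on_def)

lemma smooth_rep:
  assumes W: "openin (mtop M) W" "W \<subseteq> U" and X: "vector_field_on M W X"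
  shows "smooth_on (\<phi> ` W) (rep X)"
proof -
  have op: "open (\<phi> ` W)" by (rule open_image_sub[OF W])
  have "smooth_fun_on M W (\<lambda>p. X p (\<lambda>q. \<phi> q \<bullet> b))" for b :: 'a
    using X W(1) smooth_fun_on_subset[OF smooth_coordinate W(2)] by (simp add: vector_field_on_def)
  then have "smooth_on (\<phi> ` W) (\<lambda>u. X (\<psi> u) (\<lambda>q. \<phi> q \<bullet> b))" for b :: 'a by (rule iffD1[OF smooth_fun_on_iff[OF W]])
  then show ?thesis
    unfolding rep_def[abs_def] components_def by (intro smooth_on_sum smooth_on_scaleR smooth_on_const op)
qed

lemma vector_field_on_cong:
  assumes "vector_field_on M W X" "\<And>p. p \<in> W \<Longrightarrow> X p = Y p" "openin (mtop M) W"
  shows "vector_field_on M W Y"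
  unfolding vector_field_on_def
proof (intro conjI ballI allI impI; (elim conjE)?)
  show "Y p \<in> tangent_space M p" if "p \<in> W" for p
    using assms that by (auto simp: vector_field_on_def)
  fix W' and f :: "'m \<Rightarrow> real" assume W': "openin (mtop M) W'" "W' \<subseteq> W" "smooth_fun_on M W' f"
  then have "smooth_fun_on M W' (\<lambda>p. X p f)" using assms(1) by (simp add: vector_field_on_def)
  then show "smooth_fun_on M W' (\<lambda>p. Y p f)"
    unfolding smooth_fun_on_def
  proof (clarify)
    fix V \<kappa> assume V: "(V, \<kappa>) \<in> charts M" and *: "\<forall>(V, \<kappa>)\<in>charts M. smooth_on (\<kappa> ` (V \<inter> W')) ((\<lambda>p. X p f) \<circ> inv_into V \<kappa>)"
    interpret V: manifold_chart M V \<kappa> by standard (use manifold V in auto)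
    have "smooth_on (\<kappa> ` (V \<inter> W')) ((\<lambda>p. X p f) \<circ> V.\<psi>)" using * V by auto
    then show "smooth_on (\<kappa> ` (V \<inter> W')) ((\<lambda>p. Y p f) \<circ> V.\<psi>)"
      by (rule smooth_on_cong[OF _ V.open_image_subset[OF W'(1)]]) (use assms(2) W'(2) in auto)
  qed
qed

end

text \<open>Gram-Schmidt with coefficients that vary smoothly. The span condition carried through
  the induction keeps the projected vector w away from zero at every point, so the normalisation
  stays smooth.\<close>

lemma smooth_orthonormal_frame:
  fixes h :: "'a::euclidean_space \<Rightarrow> 'a \<Rightarrow> 'a \<Rightarrow> real"
  assumes S: "open S" and bil: "\<And>u. u \<in> S \<Longrightarrow> bilinear (h u)" and sym: "\<And>u v w. u \<in> S \<Longrightarrow> h u v w = h u w v"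
    and pos: "\<And>u v. u \<in> S \<Longrightarrow> v \<noteq> 0 \<Longrightarrow> h u v v > 0" and smo: "\<And>v w. smooth_on S (\<lambda>u. h u v w)"
  shows "\<exists>E. (\<forall>i<DIM('a). smooth_on S (E i)) \<and>
    (\<forall>u\<in>S. \<forall>i<DIM('a). \<forall>j<DIM('a). h u (E i u) (E j u) = (if i = j then 1 else 0))"
proof -
  obtain b where b: "bij_betw b {..<DIM('a)} (Basis :: 'a set)"
    using ex_bij_betw_nat_finite[OF finite_Basis] by (metis atLeast0LessThan)
  have lin: "linear (h u v)" "linear (\<lambda>v. h u v w)" if "u \<in> S" for u v w
    using bil[OF that] by (auto simp: bilinear_def)
  have smo': "smooth_on S (\<lambda>u. h u (A u) (B u))" if "smooth_on S A" "smooth_on S B" for A B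
    by (rule smooth_on_linear_field[OF S lin(1) smooth_on_linear_field[OF S lin(2) smo that(1)] that(2)])
  have "\<exists>E. (\<forall>i<m. smooth_on S (E i)) \<and> (\<forall>u\<in>S. \<forall>i<m. \<forall>j<m. h u (E i u) (E j u) = (if i = j then 1 else 0)) \<and>
    (\<forall>u\<in>S. \<forall>i<m. E i u \<in> span (b ` {..i}))" if "m \<le> DIM('a)" for m
    using that
  proof (induction m)
    case (Suc m)
    then obtain E where E: "\<And>i. i < m \<Longrightarrow> smooth_on S (E i)"
      "\<And>u i j. u \<in> S \<Longrightarrow> i < m \<Longrightarrow> j < m \<Longrightarrow> h u (E i u) (E j u) = (if i = j then 1 else 0)"
      "\<And>u i. u \<in> S \<Longrightarrow> i < m \<Longrightarrow> E i u \<in> span (b ` {..i})" by (metis Suc_leD)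
    define w where "w u = b m - (\<Sum>i<m. h u (b m) (E i u) *\<^sub>R E i u)" for u
    have smw: "smooth_on S w"
      unfolding w_def[abs_def]
      by (intro smooth_on_diff smooth_on_sum smooth_on_scaleR smo' smooth_on_const S E(1)) auto
    have wE: "h u (w u) (E j u) = 0" if u: "u \<in> S" and j: "j < m" for u j
    proof -
      have "(\<Sum>i<m. h u (b m) (E i u) * h u (E i u) (E j u)) = (\<Sum>i<m. if i = j then h u (b m) (E j u) else 0)"
        by (intro sum.cong refl) (use E(2)[OF u _ j] in auto)
      then show ?thesis
        using j by (simp add: w_def bilinear_lsub[OF bil[OF u]] bilinear_sum_left[OF bil[OF u]] bilinear_lmul[OF bil[OF u]])
    qed
    have sub: "(\<Sum>i<m. h u (b m) (E i u) *\<^sub>R E i u) \<in> span (b ` {..<m})" if "u \<in> S" for u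
    proof (intro span_sum span_scale)
      fix i assume "i \<in> {..<m}"
      then have "i < m" "{..i} \<subseteq> {..<m}" by auto
      then show "E i u \<in> span (b ` {..<m})"
        using E(3)[OF that, of i] span_mono[OF image_mono, of "{..i}" "{..<m}" b] by blast
    qed
    have bm: "b m \<notin> span (b ` {..<m})"
    proof
      assume "b m \<in> span (b ` {..<m})"
      moreover have "b ` {..<m} \<subseteq> Basis - {b m}"
      proof
        fix v assume "v \<in> b ` {..<m}"
        then obtain i where i: "i < m" "v = b i" by auto
        then have "b i \<noteq> b m"
          using b Suc.prems inj_on_eq_iff[of b "{..<DIM('a)}" i m] by (simp add: bij_betw_def)
        then show "v \<in> Basis - {b m}" using i b Suc.prems by (auto simp: bij_betw_def)
      qed
      ultimately have "b m \<in> span (Basis - {b m})" using span_mono by blast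
      moreover have "b m \<in> Basis" using b Suc.prems by (auto simp: bij_betw_def)
      ultimately show False using independent_Basis by (auto simp: dependent_def)
    qed
    have wnz: "w u \<noteq> 0" if "u \<in> S" for u
      using sub[OF that] bm by (auto simp: w_def)
    define e where "e u = (1 / sqrt (h u (w u) (w u))) *\<^sub>R w u" for u
    have sme: "smooth_on S e"
      unfolding e_def[abs_def]
      by (intro smooth_on_scaleR smooth_on_divide smooth_on_sqrt smo' smw smooth_on_const S)
        (use pos wnz in fastforce)+
    have ee: "h u (e u) (e u) = 1" if u: "u \<in> S" for u
      using pos[OF u wnz[OF u]] by (simp add: e_def bilinear_lmul[OF bil[OF u]] bilinear_rmul[OF bil[OF u]])
    have eE: "h u (e u) (E j u) = 0" "h u (E j u) (e u) = 0" if "u \<in> S" "j < m" for u j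
      using wE[OF that] sym[OF that(1), of "E j u" "e u"] by (simp_all add: e_def bilinear_lmul[OF bil[OF that(1)]])
    have espan: "e u \<in> span (b ` {..m})" if "u \<in> S" for u
    proof -
      have "(\<Sum>i<m. h u (b m) (E i u) *\<^sub>R E i u) \<in> span (b ` {..m})"
        using sub[OF that] span_mono[OF image_mono, of "{..<m}" "{..m}" b] by fastforce
      moreover have "b m \<in> span (b ` {..m})" by (intro span_base) auto
      ultimately show ?thesis unfolding e_def w_def by (intro span_scale span_diff)
    qed
    show ?case
      by (intro exI[of _ "E(m := e)"] conjI allI ballI impI)
        (use E sme ee eE espan in \<open>auto simp: less_Suc_eq\<close>)
  qed auto
  from this[of "DIM('a)"] show ?thesis by auto
qed

section \<open>Affine connections in a chart\<close>

context manifold_chart begin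

lemma smooth_fun_on_const: "openin (mtop M) W \<Longrightarrow> smooth_fun_on M W (\<lambda>p. c)"
  unfolding smooth_fun_on_def
proof clarify
  fix V \<kappa> assume W: "openin (mtop M) W" and V: "(V, \<kappa>) \<in> charts M"
  interpret V: manifold_chart M V \<kappa> by standard (use manifold V in auto)
  show "smooth_on (\<kappa> ` (V \<inter> W)) ((\<lambda>p. c) \<circ> V.\<psi>)"
    using smooth_on_const[OF V.open_image_subset[OF W]] by (simp add: o_def)
qed

lemma smooth_fun_on_chart_fun:
  assumes "openin (mtop M) W" "W \<subseteq> U" "smooth_on (\<phi> ` W) g"
  shows "smooth_fun_on M W (\<lambda>p. g (\<phi> p))"
proof (rule smooth_fun_on_chartI[OF assms(1,2)])
  show "smooth_on (\<phi> ` W) (\<lambda>u. g (\<phi> (\<psi> u)))"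
    by (rule smooth_on_cong[OF assms(3) open_image_sub[OF assms(1,2)]]) (use assms(2) in auto)
qed

lemma vector_field_on_zero:
  assumes W: "openin (mtop M) W" "W \<subseteq> U" and X: "\<And>p. p \<in> W \<Longrightarrow> X p = (\<lambda>k. 0)"
  shows "vector_field_on M W X"
proof (rule vector_field_on_cong[OF vector_field_on_field[OF W smooth_on_const[OF open_image_sub[OF W]], of 0] _ W(1)])
  show "field (\<lambda>_. 0) p = X p" if "p \<in> W" for p
    using X[OF that] W(2) that by (auto simp: field_def coord_zero)
qed

lemma vector_field_on_combine:
  assumes W: "openin (mtop M) W" "W \<subseteq> U" and X: "vector_field_on M W X" "vector_field_on M W Y"
    and f: "smooth_fun_on M W f"
  shows "vector_field_on M W (\<lambda>q k. f q * X q k + Y q k)"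
proof (rule vector_field_on_cong[OF vector_field_on_field[OF W] _ W(1)])
  have op: "open (\<phi> ` W)" by (rule open_image_sub[OF W])
  show "smooth_on (\<phi> ` W) (\<lambda>u. f (\<psi> u) *\<^sub>R rep X u + rep Y u)"
    by (intro smooth_on_add smooth_on_scaleR op smooth_rep W X iffD1[OF smooth_fun_on_iff[OF W] f])
  show "field (\<lambda>u. f (\<psi> u) *\<^sub>R rep X u + rep Y u) p = (\<lambda>k. f p * X p k + Y p k)" if "p \<in> W" for p
    using that W(2) field_rep[OF X(1) that] field_rep[OF X(2) that]
    by (auto simp: field_def coord_add coord_scale)
qed

text \<open>Used for the Levi-Civita connection, where the laws of an affine connection are given,
  and for the induced connection, where bilinearity and smoothness are derived from the Gauss
  formula.\<close>

definition christoffel :: "'m connection_op \<Rightarrow> 'a \<Rightarrow> 'a \<Rightarrow> 'a \<Rightarrow> 'a" where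
  "christoffel nabla u v w = components (nabla (field (\<lambda>_. v)) (field (\<lambda>_. w)) (\<psi> u))"

context
  fixes nabla :: "'m connection_op"
  assumes affine: "affine_connection M nabla"
begin

lemma affine_laws:
  assumes W: "openin (mtop M) W" and "vector_field_on M W X" "vector_field_on M W X'"
    "vector_field_on M W Y" "vector_field_on M W Y'" "smooth_fun_on M W f" "p \<in> W"
  shows "nabla (\<lambda>q k. X q k + X' q k) Y p = (\<lambda>k. nabla X Y p k + nabla X' Y p k)"
    "nabla (\<lambda>q k. f q * X q k) Y p = (\<lambda>k. f p * nabla X Y p k)"
    "nabla X (\<lambda>q k. Y q k + Y' q k) p = (\<lambda>k. nabla X Y p k + nabla X Y' p k)"
    "nabla X (\<lambda>q k. f q * Y q k) p = (\<lambda>k. X p f * Y p k + f p * nabla X Y p k)"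
  using affine[unfolded affine_connection_def, rule_format, of W X X' Y Y' f] assms by auto

lemma affine_field: "openin (mtop M) W \<Longrightarrow> vector_field_on M W X \<Longrightarrow> vector_field_on M W Y \<Longrightarrow> vector_field_on M W (nabla X Y)"
  using affine[unfolded affine_connection_def, rule_format, of W X X Y Y "\<lambda>p. 0"] smooth_fun_on_const by auto

text \<open>\<open>smooth_fun_on\<close> inspects f on W only, so the discontinuous f that is 0 on W
  and 1 elsewhere counts as smooth there and no bump function is involved. As Z = f Z, the product
  rules give zero.\<close>

lemma nabla_vanishing:
  assumes W: "openin (mtop M) W" and X: "vector_field_on M W X" "vector_field_on M W Z"
    and Z: "\<And>p. p \<in> W \<Longrightarrow> Z p = (\<lambda>k. 0)" and p: "p \<in> W"
  shows "nabla Z X p = (\<lambda>k. 0)" "nabla X Z p = (\<lambda>k. 0)"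
proof -
  define f where "f q = (if q \<in> W then 0 else 1 :: real)" for q
  have f: "smooth_fun_on M W f"
    unfolding smooth_fun_on_def
  proof clarify
    fix V \<kappa> assume V: "(V, \<kappa>) \<in> charts M"
    interpret V: manifold_chart M V \<kappa> by standard (use manifold V in auto)
    note op = V.open_image_subset[OF W]
    show "smooth_on (\<kappa> ` (V \<inter> W)) (f \<circ> V.\<psi>)"
      by (rule smooth_on_cong[OF smooth_on_const[OF op] op, of 0]) (auto simp: f_def)
  qed
  have "Z = (\<lambda>q k. f q * Z q k)" using Z by (auto simp: f_def fun_eq_iff)
  then show "nabla Z X p = (\<lambda>k. 0)" "nabla X Z p = (\<lambda>k. 0)"
    using affine_laws(2)[OF W X(2,2,1,1) f p] affine_laws(4)[OF W X(1,1,2,2) f p] p Z[OF p] by (simp_all add: f_def)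
qed

lemma nabla_cong:
  assumes W: "openin (mtop M) W" "W \<subseteq> U" and X: "vector_field_on M W X" "vector_field_on M W X'"
    and Y: "vector_field_on M W Y" and eq: "\<And>q. q \<in> W \<Longrightarrow> X q = X' q" and p: "p \<in> W"
  shows "nabla X Y p = nabla X' Y p" "nabla Y X p = nabla Y X' p"
proof -
  define Z where "Z q k = X' q k - X q k" for q k
  have Z: "vector_field_on M W Z" by (rule vector_field_on_zero[OF W]) (simp add: Z_def fun_eq_iff eq)
  have z: "Z q = (\<lambda>k. 0)" if "q \<in> W" for q using eq[OF that] by (simp add: Z_def fun_eq_iff)
  have X': "X' = (\<lambda>q k. X q k + Z q k)" by (simp add: Z_def fun_eq_iff)
  note c = smooth_fun_on_const[OF W(1), of 0]
  have "nabla X' Y p = (\<lambda>k. nabla X Y p k + nabla Z Y p k)"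
    unfolding X' by (rule affine_laws(1)[OF W(1) X(1) Z Y Y c p])
  then show "nabla X Y p = nabla X' Y p" using nabla_vanishing(1)[OF W(1) Y Z z p] by simp
  have "nabla Y X' p = (\<lambda>k. nabla Y X p k + nabla Y Z p k)"
    unfolding X' by (rule affine_laws(3)[OF W(1) Y Y X(1) Z c p])
  then show "nabla Y X p = nabla Y X' p" using nabla_vanishing(2)[OF W(1) Y Z z p] by simp
qed

lemma nabla_sum:
  assumes W: "openin (mtop M) W" "W \<subseteq> U" and "finite I"
    and E: "\<And>b. b \<in> I \<Longrightarrow> vector_field_on M W (E b)" "\<And>b. b \<in> I \<Longrightarrow> smooth_fun_on M W (f b)"
    and Y: "vector_field_on M W Y" and p: "p \<in> W"
  shows "vector_field_on M W (\<lambda>q k. \<Sum>b\<in>I. f b q * E b q k)"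
    "nabla (\<lambda>q k. \<Sum>b\<in>I. f b q * E b q k) Y p = (\<lambda>k. \<Sum>b\<in>I. f b p * nabla (E b) Y p k)"
    "nabla Y (\<lambda>q k. \<Sum>b\<in>I. f b q * E b q k) p = (\<lambda>k. \<Sum>b\<in>I. Y p (f b) * E b p k + f b p * nabla Y (E b) p k)"
proof -
  have zero: "vector_field_on M W (\<lambda>q k. 0)" by (rule vector_field_on_zero[OF W]) simp
  have "vector_field_on M W (\<lambda>q k. \<Sum>b\<in>I. f b q * E b q k) \<and>
    nabla (\<lambda>q k. \<Sum>b\<in>I. f b q * E b q k) Y p = (\<lambda>k. \<Sum>b\<in>I. f b p * nabla (E b) Y p k) \<and>
    nabla Y (\<lambda>q k. \<Sum>b\<in>I. f b q * E b q k) p = (\<lambda>k. \<Sum>b\<in>I. Y p (f b) * E b p k + f b p * nabla Y (E b) p k)"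
    using assms(3) E
  proof (induction I)
    case empty
    show ?case using zero nabla_vanishing[OF W(1) Y zero _ p] by simp
  next
    case (insert b I)
    then have Eb: "vector_field_on M W (E b)" and fb: "smooth_fun_on M W (f b)" by auto
    from insert have IH: "vector_field_on M W (\<lambda>q k. \<Sum>b\<in>I. f b q * E b q k)"
      "nabla (\<lambda>q k. \<Sum>b\<in>I. f b q * E b q k) Y p = (\<lambda>k. \<Sum>b\<in>I. f b p * nabla (E b) Y p k)"
      "nabla Y (\<lambda>q k. \<Sum>b\<in>I. f b q * E b q k) p = (\<lambda>k. \<Sum>b\<in>I. Y p (f b) * E b p k + f b p * nabla Y (E b) p k)"
      by auto
    have sc: "vector_field_on M W (\<lambda>q k. f b q * E b q k)"
      using vector_field_on_combine[OF W Eb zero fb] by simp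
    note c = smooth_fun_on_const[OF W(1), of 0]
    show ?case
      using insert.hyps vector_field_on_combine[OF W Eb IH(1) fb]
        affine_laws(1)[OF W(1) sc IH(1) Y Y c p] affine_laws(2)[OF W(1) Eb Eb Y Y fb p]
        affine_laws(3)[OF W(1) Y Y sc IH(1) c p] affine_laws(4)[OF W(1) Y Y Eb Eb fb p]
      by (simp add: IH(2,3))
  qed
  then show "vector_field_on M W (\<lambda>q k. \<Sum>b\<in>I. f b q * E b q k)"
    "nabla (\<lambda>q k. \<Sum>b\<in>I. f b q * E b q k) Y p = (\<lambda>k. \<Sum>b\<in>I. f b p * nabla (E b) Y p k)"
    "nabla Y (\<lambda>q k. \<Sum>b\<in>I. f b q * E b q k) p = (\<lambda>k. \<Sum>b\<in>I. Y p (f b) * E b p k + f b p * nabla Y (E b) p k)"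
    by auto
qed

lemma components_sum: "finite I \<Longrightarrow> components (\<lambda>k. \<Sum>b\<in>I. r b * X b k) = (\<Sum>b\<in>I. r b *\<^sub>R components (X b))"
proof (induction I rule: finite_induct)
  case (insert b I)
  then show ?case
    using components_linear[of "r b" "X b" 1 "\<lambda>k. \<Sum>b\<in>I. r b * X b k"] by simp
qed (simp add: components_def)

lemma const_field: "openin (mtop M) W \<Longrightarrow> W \<subseteq> U \<Longrightarrow> vector_field_on M W (field (\<lambda>_. v))"
  by (intro vector_field_on_field smooth_on_const open_image_sub)

lemma field_expand:
  assumes "vector_field_on M W X" "q \<in> W" "q \<in> U"
  shows "X q = (\<lambda>k. \<Sum>b\<in>Basis. (rep X (\<phi> q) \<bullet> b) * field (\<lambda>_. b) q k)"
proof
  fix k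
  have "X q k = coord q (rep X (\<phi> q)) k" using field_rep[OF assms] by simp
  then show "X q k = (\<Sum>b\<in>Basis. (rep X (\<phi> q) \<bullet> b) * field (\<lambda>_. b) q k)"
    using linear_sum_Basis[OF linear_coord[OF assms(3), of k], of "rep X (\<phi> q)"] by (simp add: field_def)
qed

text \<open>Both fields are expanded in the constant fields of \<open>Basis\<close>; the derivative
  of \<open>rep Y\<close> comes from the Leibniz rule in the second argument.\<close>

lemma nabla_chart_sum:
  assumes W: "openin (mtop M) W" "W \<subseteq> U" and X: "vector_field_on M W X" and Y: "vector_field_on M W Y" and p: "p \<in> W"
  shows "components (nabla X Y p) = (\<Sum>b\<in>Basis. \<Sum>c\<in>Basis. ((rep X (\<phi> p) \<bullet> b) * (rep Y (\<phi> p) \<bullet> c)) *\<^sub>R christoffel nabla (\<phi> p) b c)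
    + D (rep Y) (\<phi> p) (rep X (\<phi> p))"
proof -
  have pU: "p \<in> U" using p W by auto
  have op: "open (\<phi> ` W)" by (rule open_image_sub[OF W])
  have sc: "smooth_fun_on M W (\<lambda>q. rep X (\<phi> q) \<bullet> b)" if "vector_field_on M W X" for X and b :: 'a
    by (intro smooth_fun_on_chart_fun W smooth_on_linear[OF bounded_linear_inner_left op] smooth_rep that)
  have E: "vector_field_on M W (field (\<lambda>_. b))" for b by (rule const_field[OF W])
  note sumX = nabla_sum[OF W finite_Basis E sc[OF X] _ p]
  note sumY = nabla_sum[OF W finite_Basis E sc[OF Y] _ p]
  have "nabla X Y p = nabla (\<lambda>q k. \<Sum>b\<in>Basis. (rep X (\<phi> q) \<bullet> b) * field (\<lambda>_. b) q k) Y p"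
    using W(2) by (intro nabla_cong[OF W X sumX(1) Y _ p] field_expand[OF X]) (use Y in auto)
  also have "\<dots> = (\<lambda>k. \<Sum>b\<in>Basis. (rep X (\<phi> p) \<bullet> b) * nabla (field (\<lambda>_. b)) Y p k)" by (rule sumX(2)[OF Y])
  finally have 1: "components (nabla X Y p) = (\<Sum>b\<in>Basis. (rep X (\<phi> p) \<bullet> b) *\<^sub>R components (nabla (field (\<lambda>_. b)) Y p))"
    by (simp add: components_sum)
  have 2: "components (nabla (field (\<lambda>_. b)) Y p) =
      (\<Sum>c\<in>Basis. (rep Y (\<phi> p) \<bullet> c) *\<^sub>R christoffel nabla (\<phi> p) b c) + D (rep Y) (\<phi> p) b" for b
  proof -
    have "nabla (field (\<lambda>_. b)) Y p = nabla (field (\<lambda>_. b)) (\<lambda>q k. \<Sum>c\<in>Basis. (rep Y (\<phi> q) \<bullet> c) * field (\<lambda>_. c) q k) p"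
      using W(2) by (intro nabla_cong(2)[OF W Y sumY(1) E _ p] field_expand[OF Y]) (use E in auto)
    also have "\<dots> = (\<lambda>k. \<Sum>c\<in>Basis. field (\<lambda>_. b) p (\<lambda>q. rep Y (\<phi> q) \<bullet> c) * field (\<lambda>_. c) p k
        + (rep Y (\<phi> p) \<bullet> c) * nabla (field (\<lambda>_. b)) (field (\<lambda>_. c)) p k)" by (rule sumY(3)[OF E])
    also have "\<dots> = (\<lambda>k. 1 * (\<Sum>c\<in>Basis. field (\<lambda>_. b) p (\<lambda>q. rep Y (\<phi> q) \<bullet> c) * field (\<lambda>_. c) p k)
        + 1 * (\<Sum>c\<in>Basis. (rep Y (\<phi> p) \<bullet> c) * nabla (field (\<lambda>_. b)) (field (\<lambda>_. c)) p k))"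
      by (simp add: sum.distrib)
    finally have *: "components (nabla (field (\<lambda>_. b)) Y p) =
        (\<Sum>c\<in>Basis. field (\<lambda>_. b) p (\<lambda>q. rep Y (\<phi> q) \<bullet> c) *\<^sub>R components (field (\<lambda>_. c) p)) +
        (\<Sum>c\<in>Basis. (rep Y (\<phi> p) \<bullet> c) *\<^sub>R components (nabla (field (\<lambda>_. b)) (field (\<lambda>_. c)) p))"
      by (simp only: components_linear) (simp add: components_sum)
    have "field (\<lambda>_. b) p (\<lambda>q. rep Y (\<phi> q) \<bullet> c) = D (rep Y) (\<phi> p) b \<bullet> c" for c
    proof -
      have "field (\<lambda>_. b) p (\<lambda>q. rep Y (\<phi> q) \<bullet> c) = D (\<lambda>u. rep Y (\<phi> (\<psi> u)) \<bullet> c) (\<phi> p) b"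
        unfolding field_def by (rule coord_apply[OF W(1) sc[OF Y] p])
      also have "\<dots> = D (\<lambda>u. rep Y u \<bullet> c) (\<phi> p) b"
        by (rule fun_cong[OF D_cong[OF op]]) (use p W(2) in \<open>auto simp: inv_right\<close>)
      also have "\<dots> = D (rep Y) (\<phi> p) b \<bullet> c"
        by (rule D_bounded_linear[OF bounded_linear_inner_left smooth_on_differentiable[OF smooth_rep[OF W Y]]]) (use p in auto)
      finally show ?thesis .
    qed
    then show ?thesis using * pU by (simp add: field_def components_coord euclidean_representation christoffel_def)
  qed
  have "D (rep Y) (\<phi> p) (rep X (\<phi> p)) = (\<Sum>b\<in>Basis. (rep X (\<phi> p) \<bullet> b) *\<^sub>R D (rep Y) (\<phi> p) b)"
    by (rule linear_sum_Basis[OF smooth_on_linear_D[OF smooth_rep[OF W Y]]]) (use p in auto)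
  then show ?thesis by (simp add: 1 2 scaleR_add_right sum.distrib scaleR_sum_right)
qed

text \<open>For constant fields the derivative term of \<open>nabla_chart_sum\<close> vanishes. The
  remaining expression shows the bilinearity that the definition hides.\<close>

lemma christoffel_sum:
  assumes u: "u \<in> \<phi> ` U"
  shows "christoffel nabla u v w = (\<Sum>b\<in>Basis. \<Sum>c\<in>Basis. ((v \<bullet> b) * (w \<bullet> c)) *\<^sub>R christoffel nabla u b c)"
proof -
  have c: "rep (field (\<lambda>_. w)) u = w" if "u \<in> \<phi> ` U" for u w by (rule rep_field[OF that])
  have "D (rep (field (\<lambda>_. w))) u = D (\<lambda>_. w) u"
    by (rule D_cong[OF open_image u c])
  then show ?thesis
    using nabla_chart_sum[OF open_chart subset_refl const_field const_field inv_in[OF u], of v w] u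
    by (simp add: open_chart inv_right c christoffel_def[of nabla u v w])
qed

lemma bilinear_christoffel:
  assumes u: "u \<in> \<phi> ` U" shows "bilinear (christoffel nabla u)"
proof -
  have gen: "bilinear (\<lambda>v w. \<Sum>b\<in>Basis. \<Sum>c\<in>Basis. ((v \<bullet> b) * (w \<bullet> c)) *\<^sub>R \<gamma> b c)" for \<gamma> :: "'a \<Rightarrow> 'a \<Rightarrow> 'a"
    unfolding bilinear_def
    by (intro conjI allI linearI) (simp_all add: inner_add_left algebra_simps sum.distrib scaleR_sum_right)
  have "christoffel nabla u = (\<lambda>v w. \<Sum>b\<in>Basis. \<Sum>c\<in>Basis. ((v \<bullet> b) * (w \<bullet> c)) *\<^sub>R christoffel nabla u b c)"
    by (intro ext christoffel_sum u)
  then show ?thesis by (subst \<open>christoffel nabla u = _\<close>) (rule gen)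
qed

lemma nabla_chart:
  assumes W: "openin (mtop M) W" "W \<subseteq> U" and X: "vector_field_on M W X" and Y: "vector_field_on M W Y" and p: "p \<in> W"
  shows "nabla X Y p = coord p (christoffel nabla (\<phi> p) (rep X (\<phi> p)) (rep Y (\<phi> p)) + D (rep Y) (\<phi> p) (rep X (\<phi> p)))"
proof -
  have pU: "p \<in> U" using p W by auto
  have "nabla X Y p \<in> tangent_space M p"
    using affine_field[OF W(1) X Y] p by (simp add: vector_field_on_def)
  then have "nabla X Y p = coord p (components (nabla X Y p))" by (simp add: coord_components[OF pU])
  then show ?thesis
    using nabla_chart_sum[OF W X Y p] christoffel_sum[of "\<phi> p" "rep X (\<phi> p)" "rep Y (\<phi> p)"] pU by simp
qed

lemma smooth_christoffel: "smooth_on (\<phi> ` U) (\<lambda>u. christoffel nabla u v w)"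
  using smooth_rep[OF open_chart subset_refl
      affine_field[OF open_chart const_field[OF open_chart subset_refl] const_field[OF open_chart subset_refl]], of v w]
  by (simp add: rep_def[abs_def] christoffel_def)

end

lemma D_rep_const: "u \<in> \<phi> ` U \<Longrightarrow> D (rep (field (\<lambda>_. w))) u v = 0"
proof -
  assume u: "u \<in> \<phi> ` U"
  have "D (rep (field (\<lambda>_. w))) u = D (\<lambda>_. w) u" by (rule D_cong[OF open_image u rep_field])
  then show ?thesis by simp
qed

lemma nabla_const:
  assumes "affine_connection M nabla" and p: "p \<in> U"
  shows "nabla (field (\<lambda>_. v)) (field (\<lambda>_. w)) p = coord p (christoffel nabla (\<phi> p) v w)"
  using nabla_chart[OF assms(1) open_chart subset_refl const_field[OF assms(1)] const_field[OF assms(1)] p] p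
  by (simp add: open_chart rep_field D_rep_const)


definition metric_chart :: "'m metric_tensor \<Rightarrow> 'a \<Rightarrow> 'a \<Rightarrow> 'a \<Rightarrow> real" where
  "metric_chart h u v w = h (\<psi> u) (coord (\<psi> u) v) (coord (\<psi> u) w)"

lemma field_const_apply: "field (\<lambda>_. v) p = coord p v"
  by (simp add: field_def)

lemma levi_civitaD:
  assumes "levi_civita M h lc" "openin (mtop M) W" "vector_field_on M W X" "vector_field_on M W Y"
    "vector_field_on M W Z" "p \<in> W"
  shows "(\<lambda>k. lc X Y p k - lc Y X p k) = lie_bracket M X Y p"
    "X p (\<lambda>q. h q (Y q) (Z q)) = h p (lc X Y p) (Z p) + h p (Y p) (lc X Z p)"
  using assms unfolding levi_civita_def by blast+

text \<open>Constant fields commute: each maps a coordinate function to a constant, which the other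
  annihilates. So the torsion condition loses its bracket term.\<close>

lemma christoffel_symmetric:
  assumes lc: "levi_civita M h lc" and u: "u \<in> \<phi> ` U"
  shows "christoffel lc u v w = christoffel lc u w v"
proof -
  have aff: "affine_connection M lc" using lc by (simp add: levi_civita_def)
  let ?V = "field (\<lambda>_. v)" and ?W = "field (\<lambda>_. w)"
  have p: "\<psi> u \<in> U" by (rule inv_in[OF u])
  note cf = const_field[OF aff open_chart subset_refl]
  have bracket: "(\<lambda>k. lc ?V ?W (\<psi> u) k - lc ?W ?V (\<psi> u) k) = lie_bracket M ?V ?W (\<psi> u)"
    by (rule levi_civitaD(1)[OF lc open_chart cf cf cf p])
  have const: "field (\<lambda>_. v) (\<psi> u) (\<lambda>q. field (\<lambda>_. w) q (\<lambda>q. \<phi> q \<bullet> b)) = 0" for v w b :: 'a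
  proof -
    have eq: "field (\<lambda>_. w) (\<psi> y) (\<lambda>q. \<phi> q \<bullet> b) = w \<bullet> b" if "y \<in> \<phi> ` U" for y
    proof -
      have "field (\<lambda>_. w) (\<psi> y) (\<lambda>q. \<phi> q \<bullet> b) = D (\<lambda>u. \<phi> (\<psi> u) \<bullet> b) y w"
        unfolding field_const_apply
        by (subst coord_apply[OF open_chart smooth_coordinate inv_in[OF that]]) (simp add: inv_right[OF that])
      also have "\<dots> = D (\<lambda>u. u \<bullet> b) y w"
        by (rule fun_cong[OF D_cong[OF open_image that]]) (simp add: inv_right)
      finally show ?thesis by (simp add: D_eqI[OF bounded_linear_imp_has_derivative[OF bounded_linear_inner_left]])
    qed
    have "smooth_fun_on M U (\<lambda>q. field (\<lambda>_. w) q (\<lambda>q. \<phi> q \<bullet> b))"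
      using cf smooth_coordinate open_chart by (auto simp: vector_field_on_def)
    then have "field (\<lambda>_. v) (\<psi> u) (\<lambda>q. field (\<lambda>_. w) q (\<lambda>q. \<phi> q \<bullet> b)) =
        D (\<lambda>y. field (\<lambda>_. w) (\<psi> y) (\<lambda>q. \<phi> q \<bullet> b)) u v"
      unfolding field_const_apply[of v]
      by (subst coord_apply[OF open_chart _ p]) (simp_all add: inv_right[OF u])
    also have "\<dots> = D (\<lambda>y. w \<bullet> b) u v" by (rule fun_cong[OF D_cong[OF open_image u eq]])
    finally show ?thesis by simp
  qed
  have "components (lie_bracket M ?V ?W (\<psi> u)) = 0"
    unfolding components_def lie_bracket_def by (intro sum.neutral ballI) (simp only: const[of v w] const[of w v], simp)
  then have "components (\<lambda>k. 1 * lc ?V ?W (\<psi> u) k + (-1) * lc ?W ?V (\<psi> u) k) = 0" using bracket by simp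
  then show ?thesis by (simp only: components_linear) (simp add: christoffel_def)
qed

lemma metric_compatible:
  assumes lc: "levi_civita M h lc" and u: "u \<in> \<phi> ` U"
    and smo: "\<And>v w. smooth_on (\<phi> ` U) (\<lambda>y. metric_chart h y v w)"
  shows "D (\<lambda>y. metric_chart h y v w) u z =
    metric_chart h u (christoffel lc u z v) w + metric_chart h u v (christoffel lc u z w)"
proof -
  have aff: "affine_connection M lc" using lc by (simp add: levi_civita_def)
  have p: "\<psi> u \<in> U" by (rule inv_in[OF u])
  note cf = const_field[OF aff open_chart subset_refl]
  let ?g = "\<lambda>q. h q (field (\<lambda>_. v) q) (field (\<lambda>_. w) q)"
  have g: "smooth_fun_on M U ?g"
    by (rule smooth_fun_on_chartI[OF open_chart subset_refl])
      (use smo[of v w] in \<open>simp add: metric_chart_def[abs_def] field_const_apply\<close>)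
  have "field (\<lambda>_. z) (\<psi> u) ?g = h (\<psi> u) (lc (field (\<lambda>_. z)) (field (\<lambda>_. v)) (\<psi> u)) (field (\<lambda>_. w) (\<psi> u))
      + h (\<psi> u) (field (\<lambda>_. v) (\<psi> u)) (lc (field (\<lambda>_. z)) (field (\<lambda>_. w)) (\<psi> u))"
    by (rule levi_civitaD(2)[OF lc open_chart cf cf cf p])
  moreover have "field (\<lambda>_. z) (\<psi> u) ?g = D (\<lambda>y. metric_chart h y v w) u z"
    unfolding field_const_apply[of z]
    by (subst coord_apply[OF open_chart g p]) (simp add: inv_right[OF u] metric_chart_def[abs_def] field_const_apply)
  ultimately show ?thesis
    by (simp add: nabla_const[OF aff p] inv_right[OF u] metric_chart_def field_const_apply)
qed

section \<open>The centroaffine Gauss formula in a chart\<close>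

context
  fixes x :: "'m \<Rightarrow> 'e::euclidean_space" and \<epsilon> :: real and nabla :: "'m connection_op" and h :: "'m metric_tensor"
  assumes hyp: "centroaffine_hypersurface M x" and gauss: "centroaffine_gauss M x \<epsilon> nabla h" and \<epsilon>: "\<epsilon> \<noteq> 0"
begin

abbreviation (input) "xc \<equiv> \<lambda>u. x (\<psi> u)"

lemma smooth_x: "smooth_fun_on M (topspace (mtop M)) x"
  using hyp by (simp add: centroaffine_hypersurface_def)

lemma smooth_x_chart: "smooth_on (\<phi> ` U) xc"
  using smooth_fun_on_chartD[OF smooth_x] U_subset by (simp add: Int_absorb2)

lemma flat_deriv_x: "p \<in> U \<Longrightarrow> flat_deriv (coord p v) x = D xc (\<phi> p) v"
  using flat_deriv_coord[OF openin_topspace smooth_x, of p v] U_subset by auto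

lemma linear_DX: "u \<in> \<phi> ` U \<Longrightarrow> linear (D xc u)"
  by (rule smooth_on_linear_D[OF smooth_x_chart])

text \<open>The definition of a centroaffine hypersurface excludes x itself as a tangent vector;
  dividing v by s reduces every other nonzero multiple of x to this case.\<close>

lemma transversal_chart:
  assumes u: "u \<in> \<phi> ` U" and eq: "D xc u v = s *\<^sub>R xc u"
  shows "v = 0 \<and> s = 0"
proof -
  have p: "\<psi> u \<in> U" "\<psi> u \<in> topspace (mtop M)" using inv_in[OF u] U_subset by auto
  have fl: "flat_deriv (coord (\<psi> u) v) x = D xc u v" for v using flat_deriv_x[OF p(1)] inv_right[OF u] by simp
  have tan: "coord (\<psi> u) v \<in> tangent_space M (\<psi> u)" for v using tangent_space_coord[OF p(1)] by simp
  have "s = 0"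
  proof (rule ccontr)
    assume s: "s \<noteq> 0"
    have "D xc u ((1 / s) *\<^sub>R v) = x (\<psi> u)" using s by (simp add: linear_scale[OF linear_DX[OF u]] eq)
    then show False using hyp p(2) tan fl unfolding centroaffine_hypersurface_def by metis
  qed
  then have "flat_deriv (coord (\<psi> u) v) x = 0" using eq fl by simp
  then have "coord (\<psi> u) v = (\<lambda>f. 0)" using hyp p(2) tan unfolding centroaffine_hypersurface_def by metis
  then show ?thesis using coord_eq_zero[OF p(1)] \<open>s = 0\<close> by simp
qed

lemma frame_inj:
  assumes u: "u \<in> \<phi> ` U" and eq: "D xc u v - r *\<^sub>R xc u = D xc u w - s *\<^sub>R xc u"
  shows "v = w" "r = s"
proof -
  have "D xc u (v - w) = (r - s) *\<^sub>R xc u"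
    using eq by (simp add: linear_diff[OF linear_DX[OF u]] algebra_simps)
  from transversal_chart[OF u this] show "v = w" "r = s" by auto
qed

lemma gauss_fields:
  assumes W: "openin (mtop M) W" "W \<subseteq> U" and Y: "vector_field_on M W Y" and Z: "vector_field_on M W Z" and p: "p \<in> W"
  shows "D xc (\<phi> p) (components (nabla Y Z p)) - (h p (Y p) (Z p) * \<epsilon>) *\<^sub>R x p = D (\<lambda>u. D xc u (rep Z u)) (\<phi> p) (rep Y (\<phi> p))"
    and "nabla Y Z p \<in> tangent_space M p"
proof -
  have pU: "p \<in> U" using p W by auto
  have op: "open (\<phi> ` W)" by (rule open_image_sub[OF W])
  have sub: "\<phi> ` W \<subseteq> \<phi> ` U" using W by auto
  from gauss W(1) Y Z p have tan: "nabla Y Z p \<in> tangent_space M p" and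
    eq: "flat_deriv (Y p) (\<lambda>q. flat_deriv (Z q) x) = flat_deriv (nabla Y Z p) x - (h p (Y p) (Z p) * \<epsilon>) *\<^sub>R x p"
    unfolding centroaffine_gauss_def by blast+
  show "nabla Y Z p \<in> tangent_space M p" by (rule tan)
  let ?g = "\<lambda>q. flat_deriv (Z q) x"
  have g: "?g (\<psi> u) = D xc u (rep Z u)" if "u \<in> \<phi> ` W" for u
  proof -
    have "\<psi> u \<in> W" "u \<in> \<phi> ` U" using that W(2) by auto
    then show ?thesis
      using field_rep[OF Z] flat_deriv_x[of "\<psi> u"] inv_in[of u] inv_right[of u] by simp
  qed
  have sg: "smooth_on (\<phi> ` W) (\<lambda>u. D xc u (rep Z u))"
    using smooth_on_linear_field[OF op linear_DX smooth_on_subset[OF smooth_on_D[OF smooth_x_chart] sub] smooth_rep[OF W Z]]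
      sub by blast
  have "smooth_fun_on M W ?g"
    by (rule smooth_fun_on_chartI[OF W smooth_on_cong[OF sg op]]) (simp add: g)
  then have "flat_deriv (Y p) ?g = D (\<lambda>u. ?g (\<psi> u)) (\<phi> p) (rep Y (\<phi> p))"
    using flat_deriv_coord[OF W(1) _ p pU] field_rep[OF Y p pU] by simp
  also have "\<dots> = D (\<lambda>u. D xc u (rep Z u)) (\<phi> p) (rep Y (\<phi> p))"
    by (rule fun_cong[OF D_cong[OF op _ g]]) (use p in auto)
  finally show "D xc (\<phi> p) (components (nabla Y Z p)) - (h p (Y p) (Z p) * \<epsilon>) *\<^sub>R x p = D (\<lambda>u. D xc u (rep Z u)) (\<phi> p) (rep Y (\<phi> p))"
    using eq flat_deriv_x[OF pU, of "components (nabla Y Z p)"] coord_components[OF pU tan] by simp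
qed

lemma gauss_chart:
  assumes u: "u \<in> \<phi> ` U"
  shows "D (\<lambda>y. D xc y w) u v = D xc u (christoffel nabla u v w) - (\<epsilon> * metric_chart h u v w) *\<^sub>R xc u"
proof -
  have p: "\<psi> u \<in> U" by (rule inv_in[OF u])
  have cf: "vector_field_on M U (field (\<lambda>_. v))" for v
    by (intro vector_field_on_field open_chart smooth_on_const open_image subset_refl)
  have "D (\<lambda>y. D xc y (rep (field (\<lambda>_. w)) y)) u v = D (\<lambda>y. D xc y w) u v"
    by (rule fun_cong[OF D_cong[OF open_image u]]) (simp add: rep_field)
  then show ?thesis
    using gauss_fields(1)[OF open_chart subset_refl cf cf p, of v w] u
    by (simp add: inv_right rep_field christoffel_def metric_chart_def field_const_apply mult.commute)
qed

text \<open>Linearity in the direction of differentiation is clear, and \<open>D_commute\<close>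
  transfers it to the other slot.\<close>

lemma second_derivative_bilinear:
  assumes u: "u \<in> \<phi> ` U" shows "bilinear (\<lambda>v w. D (\<lambda>y. D xc y w) u v)"
  unfolding bilinear_def
proof (intro conjI allI)
  show "linear (\<lambda>v. D (\<lambda>y. D xc y w) u v)" for w by (rule smooth_on_linear_D[OF smooth_on_D[OF smooth_x_chart] u])
  then show "linear (\<lambda>w. D (\<lambda>y. D xc y w) u v)" for v
    by (subst D_commute[OF open_image u smooth_x_chart])
qed

text \<open>\<open>nabla\<close> and h are known only through the Gauss formula. Since the splitting
  into a tangential part and a multiple of x is unique, both parts inherit bilinearity from the
  second derivative of the immersion.\<close>

lemma bilinear_gauss:
  assumes u: "u \<in> \<phi> ` U"
  shows "bilinear (christoffel nabla u)" "bilinear (metric_chart h u)"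
proof -
  define B where "B v w = D (\<lambda>y. D xc y w) u v" for v w
  have B: "bilinear B" unfolding B_def by (rule second_derivative_bilinear[OF u])
  have eq: "D xc u (christoffel nabla u v w) - (\<epsilon> * metric_chart h u v w) *\<^sub>R xc u = B v w" for v w
    using gauss_chart[OF u, of w v] by (simp add: B_def)
  have uniq: "christoffel nabla u v w = a \<and> metric_chart h u v w = b"
    if "D xc u a - (\<epsilon> * b) *\<^sub>R xc u = B v w" for v w a b
    using frame_inj[OF u, of "christoffel nabla u v w" "\<epsilon> * metric_chart h u v w" a "\<epsilon> * b"] eq[of v w] that \<epsilon> by auto
  note lin = linear_add[OF linear_DX[OF u]] linear_scale[OF linear_DX[OF u]]
  have add: "D xc u (a + a') - (\<epsilon> * (b + b')) *\<^sub>R xc u = (D xc u a - (\<epsilon> * b) *\<^sub>R xc u) + (D xc u a' - (\<epsilon> * b') *\<^sub>R xc u)" for a a' b b'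
    by (simp add: lin algebra_simps)
  have scale: "D xc u (r *\<^sub>R a) - (\<epsilon> * (r * b)) *\<^sub>R xc u = r *\<^sub>R (D xc u a - (\<epsilon> * b) *\<^sub>R xc u)" for a b r
    by (simp add: lin algebra_simps)
  have 1: "christoffel nabla u v (w + w') = christoffel nabla u v w + christoffel nabla u v w' \<and>
      metric_chart h u v (w + w') = metric_chart h u v w + metric_chart h u v w'" for v w w'
    by (rule uniq) (simp only: add eq bilinear_radd[OF B])
  have 2: "christoffel nabla u (v + v') w = christoffel nabla u v w + christoffel nabla u v' w \<and>
      metric_chart h u (v + v') w = metric_chart h u v w + metric_chart h u v' w" for v v' w
    by (rule uniq) (simp only: add eq bilinear_ladd[OF B])
  have 3: "christoffel nabla u v (r *\<^sub>R w) = r *\<^sub>R christoffel nabla u v w \<and>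
      metric_chart h u v (r *\<^sub>R w) = r * metric_chart h u v w" for v w r
    by (rule uniq) (simp only: scale eq bilinear_rmul[OF B])
  have 4: "christoffel nabla u (r *\<^sub>R v) w = r *\<^sub>R christoffel nabla u v w \<and>
      metric_chart h u (r *\<^sub>R v) w = r * metric_chart h u v w" for v w r
    by (rule uniq) (simp only: scale eq bilinear_lmul[OF B])
  show "bilinear (christoffel nabla u)" "bilinear (metric_chart h u)"
    unfolding bilinear_def using 1 2 3 4 by (auto intro!: linearI)
qed

text \<open>The pair of tangential and transversal coefficients solves the linear system with the
  injective map sending (a, b) to D x a - b x, whose entries are smooth.\<close>

lemma smooth_gauss:
  "smooth_on (\<phi> ` U) (\<lambda>u. christoffel nabla u v w)" "smooth_on (\<phi> ` U) (\<lambda>u. metric_chart h u v w)"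
proof -
  let ?B = "\<lambda>u (z :: 'a \<times> real). D xc u (fst z) - snd z *\<^sub>R xc u"
  let ?s = "\<lambda>u. (christoffel nabla u v w, \<epsilon> * metric_chart h u v w)"
  have s: "smooth_on (\<phi> ` U) ?s"
  proof (rule smooth_on_linear_system[OF open_image, of ?B])
    show "linear (?B u)" if "u \<in> \<phi> ` U" for u
      by (intro linearI) (simp_all add: linear_add[OF linear_DX[OF that]] linear_scale[OF linear_DX[OF that]] algebra_simps)
    show "inj (?B u)" if "u \<in> \<phi> ` U" for u
      by (intro injI prod_eqI) (use frame_inj[OF that] in blast)+
    show "smooth_on (\<phi> ` U) (\<lambda>u. ?B u z)" for z
      by (intro smooth_on_diff smooth_on_scaleR smooth_on_const open_image smooth_on_D smooth_x_chart)
    show "smooth_on (\<phi> ` U) (\<lambda>u. D (\<lambda>y. D xc y w) u v)" by (intro smooth_on_D smooth_x_chart)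
    show "?B u (?s u) = D (\<lambda>y. D xc y w) u v" if "u \<in> \<phi> ` U" for u
      using gauss_chart[OF that] by simp
  qed
  show "smooth_on (\<phi> ` U) (\<lambda>u. christoffel nabla u v w)"
    using smooth_on_linear[OF bounded_linear_fst open_image s] by simp
  show "smooth_on (\<phi> ` U) (\<lambda>u. metric_chart h u v w)"
    using smooth_on_linear[OF bounded_linear_mult_right[of "1 / \<epsilon>"] open_image
        smooth_on_linear[OF bounded_linear_snd open_image s]] \<epsilon> by simp
qed

text \<open>The counterpart of \<open>nabla_chart\<close> for the induced connection, obtained by
  differentiating x_*(Z) and comparing tangential parts instead of using the laws of a
  connection.\<close>

lemma gauss_nabla_chart:
  assumes W: "openin (mtop M) W" "W \<subseteq> U" and Y: "vector_field_on M W Y" and Z: "vector_field_on M W Z" and p: "p \<in> W"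
  shows "nabla Y Z p = coord p (christoffel nabla (\<phi> p) (rep Y (\<phi> p)) (rep Z (\<phi> p)) + D (rep Z) (\<phi> p) (rep Y (\<phi> p)))"
proof -
  have pU: "p \<in> U" using p W by auto
  have op: "open (\<phi> ` W)" by (rule open_image_sub[OF W])
  have sub: "\<phi> ` W \<subseteq> \<phi> ` U" using W by auto
  define u where "u = \<phi> p"
  have u: "u \<in> \<phi> ` W" "u \<in> \<phi> ` U" using p pU by (auto simp: u_def)
  have "D (\<lambda>u. D xc u (rep Z u)) u (rep Y u) =
      D (\<lambda>y. D xc y (rep Z u)) u (rep Y u) + D xc u (D (rep Z) u (rep Y u))"
    using sub by (intro D_linear_field[OF op u(1) linear_DX] smooth_on_subset[OF smooth_on_D[OF smooth_x_chart] sub]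
        smooth_rep[OF W Z]) auto
  then have "D xc u (components (nabla Y Z p)) - (\<epsilon> * h p (Y p) (Z p)) *\<^sub>R xc u =
      D xc u (christoffel nabla u (rep Y u) (rep Z u) + D (rep Z) u (rep Y u)) - (\<epsilon> * metric_chart h u (rep Y u) (rep Z u)) *\<^sub>R xc u"
    using gauss_fields(1)[OF W Y Z p] gauss_chart[OF u(2), of "rep Z u" "rep Y u"] pU
    by (simp add: u_def linear_add[OF linear_DX] mult.commute)
  from frame_inj(1)[OF u(2) this] have "components (nabla Y Z p) = christoffel nabla u (rep Y u) (rep Z u) + D (rep Z) u (rep Y u)" .
  then show ?thesis using coord_components[OF pU gauss_fields(2)[OF W Y Z p]] by (simp add: u_def)
qed

lemma difference_tensor_chart:
  assumes lc: "levi_civita M h lc"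
    and W: "openin (mtop M) W" "W \<subseteq> U" and Y: "vector_field_on M W Y" and Z: "vector_field_on M W Z" and p: "p \<in> W"
  shows "difference_tensor nabla lc Y Z p =
    coord p (christoffel nabla (\<phi> p) (rep Y (\<phi> p)) (rep Z (\<phi> p)) - christoffel lc (\<phi> p) (rep Y (\<phi> p)) (rep Z (\<phi> p)))"
proof -
  have aff: "affine_connection M lc" using lc by (simp add: levi_civita_def)
  have pU: "p \<in> U" using p W by auto
  show ?thesis
    by (simp add: fun_eq_iff difference_tensor_def gauss_nabla_chart[OF W Y Z p] nabla_chart[OF aff W Y Z p]
        coord_add[OF pU] coord_diff[OF pU])
qed

end

end

section \<open>Open sets of Euclidean space and open submanifolds\<close>

lemma second_countable_euclidean: "second_countable (euclidean :: 'a::second_countable_topology topology)"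
proof -
  obtain B :: "'a set set" where B: "countable B" "topological_basis B" using ex_countable_basis by blast
  have "\<exists>V\<in>B. x \<in> V \<and> V \<subseteq> U" if "openin euclidean U" "x \<in> U" for U and x :: 'a
  proof -
    have "open U" using that(1) by simp
    then show ?thesis using that(2) by (rule topological_basisE[OF B(2)]) blast
  qed
  moreover have "openin euclidean V" if "V \<in> B" for V using topological_basis_open[OF B(2) that] by simp
  ultimately show ?thesis
    unfolding second_countable_def using B(1) by blast
qed

lemma smooth_manifold_euclidean_open:
  fixes S :: "'a::euclidean_space set"
  assumes S: "open S"
  shows "smooth_manifold (euclidean_open_manifold S)"
proof -
  have "smooth_on S (inv_into S id)"
    by (rule smooth_on_cong[OF smooth_on_id[OF S] S]) (metis id_apply inj_on_id inv_into_f_f)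
  then show ?thesis
    using S unfolding smooth_manifold_def euclidean_open_manifold_def
    by (simp add: Hausdorff_space_subtopology second_countable_subtopology second_countable_euclidean
        homeomorphic_map_id subtopology_subtopology openin_open_eq)
qed

lemma manifold_chart_euclidean_open:
  "open S \<Longrightarrow> manifold_chart (euclidean_open_manifold S) S id"
  by (simp add: manifold_chart_def smooth_manifold_euclidean_open) (simp add: euclidean_open_manifold_def)

lemma inv_into_id: "u \<in> S \<Longrightarrow> inv_into S id u = u"
  by (metis id_apply inj_on_id inv_into_f_f)

text \<open>The product is covered by one identity chart, so that \<open>manifold_chart\<close>
  applies to it directly.\<close>

lemma product_euclidean_open_manifold:
  "product_manifold (euclidean_open_manifold I) (euclidean_open_manifold J) = euclidean_open_manifold (I \<times> J)"
  by (simp add: product_manifold_def euclidean_open_manifold_def map_prod.id)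

lemma inv_into_Int:
  assumes "inj_on f U" "u \<in> f ` (U \<inter> W)"
  shows "inv_into (U \<inter> W) f u = inv_into U f u"
  using assms by (auto simp: inv_into_f_f inj_on_subset[OF assms(1)])

text \<open>Charts of the submanifold have a smaller domain, hence another \<open>inv_into\<close>;
  on the image of W' both inverses agree.\<close>

lemma smooth_fun_on_open_submanifold:
  assumes M: "smooth_manifold M" and W: "openin (mtop M) W'" "W' \<subseteq> W"
  shows "smooth_fun_on (open_submanifold M W) W' f \<longleftrightarrow> smooth_fun_on M W' f"
proof -
  have "smooth_on (\<phi> ` (U \<inter> W \<inter> W')) (f \<circ> inv_into (U \<inter> W) \<phi>) \<longleftrightarrow> smooth_on (\<phi> ` (U \<inter> W')) (f \<circ> inv_into U \<phi>)"
    if "(U, \<phi>) \<in> charts M" for U \<phi>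
  proof -
    interpret manifold_chart M U \<phi> by standard (use M that in auto)
    have eq: "U \<inter> W \<inter> W' = U \<inter> W'" using W(2) by auto
    have op: "open (\<phi> ` (U \<inter> W'))" by (rule open_image_subset[OF W(1)])
    have "inv_into (U \<inter> W) \<phi> u = \<psi> u" if "u \<in> \<phi> ` (U \<inter> W')" for u
      by (rule inv_into_Int[OF inj]) (use that W(2) in auto)
    then have "(f \<circ> inv_into (U \<inter> W) \<phi>) u = (f \<circ> \<psi>) u" if "u \<in> \<phi> ` (U \<inter> W')" for u
      using that by simp
    then show ?thesis unfolding eq
      using smooth_on_cong[OF _ op, of "f \<circ> inv_into (U \<inter> W) \<phi>" "f \<circ> \<psi>"]
        smooth_on_cong[OF _ op, of "f \<circ> \<psi>" "f \<circ> inv_into (U \<inter> W) \<phi>"] by metis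
  qed
  then show ?thesis
    unfolding smooth_fun_on_def open_submanifold_def by auto
qed

lemma smooth_at_open_submanifold:
  assumes M: "smooth_manifold M" and W: "openin (mtop M) W" "p \<in> W"
  shows "smooth_at (open_submanifold M W) p f \<longleftrightarrow> smooth_at M p f"
proof
  have top: "mtop (open_submanifold M W) = subtopology (mtop M) W" by (simp add: open_submanifold_def)
  show "smooth_at M p f" if sub: "smooth_at (open_submanifold M W) p f"
  proof -
    obtain W' where W': "openin (subtopology (mtop M) W) W'" "p \<in> W'" "smooth_fun_on (open_submanifold M W) W' f"
      using sub unfolding smooth_at_def top by blast
    have "openin (mtop M) W'" "W' \<subseteq> W"
      using openin_trans_full[OF W'(1) W(1)] openin_subset[OF W'(1)] by (auto simp: topspace_subtopology)
    then show ?thesis using smooth_fun_on_open_submanifold[OF M] W' unfolding smooth_at_def by blast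
  qed
  show "smooth_at (open_submanifold M W) p f" if sm: "smooth_at M p f"
  proof -
    obtain W' where W': "openin (mtop M) W'" "p \<in> W'" "smooth_fun_on M W' f"
      using sm unfolding smooth_at_def by blast
    have op: "openin (mtop M) (W' \<inter> W)" using W' W by auto
    have "smooth_fun_on M (W' \<inter> W) f"
      using W'(3) unfolding smooth_fun_on_def by (fastforce intro: smooth_on_subset)
    then have "smooth_fun_on (open_submanifold M W) (W' \<inter> W) f"
      using smooth_fun_on_open_submanifold[OF M op] by blast
    moreover have "openin (subtopology (mtop M) W) (W' \<inter> W)" using W'(1) by (auto simp: openin_subtopology)
    ultimately show ?thesis unfolding smooth_at_def top using W'(2) W(2) by blast
  qed
qed

text \<open>Tangent vectors are functionals extended by zero beyond the functions smooth near the
  point. An open W has the same such functions, so the vectors of M and of the submanifold are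
  literally equal.\<close>

lemma pushforward_open_submanifold:
  "smooth_manifold M \<Longrightarrow> openin (mtop M) W \<Longrightarrow> F p \<in> W \<Longrightarrow>
    pushforward (open_submanifold M W) F p v = pushforward M F p v"
  unfolding pushforward_def by (simp add: smooth_at_open_submanifold)

text \<open>The chain rule for derivations. For f smooth near the image point, the composition with
  F has to be shown smooth near z, which is the purpose of A'; for other f both sides take the
  default value zero.\<close>

lemma pushforward_coord:
  assumes "manifold_chart P A id" and N: "manifold_chart N V \<kappa>" and A: "open A" "z \<in> A"
    and F: "smooth_on A (\<lambda>y. \<kappa> (F y))" "\<And>y. y \<in> A \<Longrightarrow> F y \<in> V"
  shows "pushforward N F z (manifold_chart.coord P A id z v) =
    manifold_chart.coord N V \<kappa> (F z) (D (\<lambda>y. \<kappa> (F y)) z v)"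
proof
  fix f
  interpret P: manifold_chart P A id by fact
  interpret N: manifold_chart N V \<kappa> by fact
  show "pushforward N F z (P.coord z v) f = N.coord (F z) (D (\<lambda>y. \<kappa> (F y)) z v) f"
  proof (cases "smooth_at N (F z) f")
    case True
    obtain W where W: "openin (mtop N) W" "W \<subseteq> V" "F z \<in> W" "smooth_on (\<kappa> ` W) (\<lambda>u. f (N.\<psi> u))"
      by (rule N.smooth_at_local[OF True F(2)[OF A(2)]])
    define A' where "A' = A \<inter> (\<lambda>y. \<kappa> (F y)) -` (\<kappa> ` W)"
    have opW: "open (\<kappa> ` W)" by (rule N.open_image_sub[OF W(1,2)])
    have A': "open A'" "z \<in> A'" "A' \<subseteq> A"
      using A(2) W(3) by (auto simp: A'_def intro: continuous_open_preimage[OF smooth_on_continuous[OF F(1)] A(1) opW])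
    have "smooth_on A' (\<lambda>y. f (N.\<psi> (\<kappa> (F y))))"
      by (rule smooth_on_compose[OF A'(1) opW _ smooth_on_subset[OF F(1) A'(3)] W(4)]) (auto simp: A'_def)
    then have fF: "smooth_on A' (\<lambda>y. f (F y))"
      by (rule smooth_on_cong[OF _ A'(1)]) (use A'(3) F(2) in auto)
    have opA': "openin (mtop P) A'" 
    proof -
      have "P.\<psi> ` A' = A'" using A'(3) by (force simp: inv_into_id)
      then show ?thesis using P.open_inv_image[OF A'(1)] A'(3) by simp
    qed
    have "smooth_fun_on P A' (f \<circ> F)"
      by (rule P.smooth_fun_on_chartI[OF opA' A'(3)])
        (use smooth_on_cong[OF fF A'(1)] A'(3) in \<open>auto simp: inv_into_id subset_iff\<close>)
    from P.coord_apply[OF opA' this A'(2)]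
    have "P.coord z v (f \<circ> F) = D (\<lambda>y. f (F (P.\<psi> y))) z v" by simp
    also have "\<dots> = D (\<lambda>y. f (N.\<psi> (\<kappa> (F y)))) z v"
      by (rule fun_cong[OF D_cong[OF A]]) (use F(2) in \<open>simp add: inv_into_id\<close>)
    also have "\<dots> = D (\<lambda>u. f (N.\<psi> u)) (\<kappa> (F z)) (D (\<lambda>y. \<kappa> (F y)) z v)"
      by (rule D_compose[OF smooth_on_differentiable[OF W(4)] smooth_on_differentiable[OF F(1) A(2)]]) (use W(3) in auto)
    finally show ?thesis using True by (simp add: pushforward_def N.coord_eq)
  qed (simp add: pushforward_def N.coord_eq)
qed

text \<open>Differentiating the identity map recovers the component vector of a derivation.\<close>

definition coordinate_metric :: "('a::euclidean_space \<Rightarrow> 'a \<Rightarrow> 'a \<Rightarrow> real) \<Rightarrow> 'a metric_tensor" where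
  "coordinate_metric g = (\<lambda>y v w. g y (flat_deriv v (\<lambda>z. z)) (flat_deriv w (\<lambda>z. z)))"

lemma flat_deriv_id:
  fixes N :: "('a::euclidean_space, 'a) manifold" and v :: "'a tvec"
  assumes "manifold_chart N V id" shows "flat_deriv v (\<lambda>z. z) = manifold_chart.components id v"
proof -
  interpret N: manifold_chart N V id by fact
  show ?thesis by (simp add: flat_deriv_def N.components_def)
qed

lemma riemannian_coordinate_metric:
  fixes J :: "'a::euclidean_space set"
  assumes J: "open J" and bil: "\<And>y. y \<in> J \<Longrightarrow> bilinear (g y)" and sym: "\<And>y v w. y \<in> J \<Longrightarrow> g y v w = g y w v"
    and pos: "\<And>y v. y \<in> J \<Longrightarrow> v \<noteq> 0 \<Longrightarrow> g y v v > 0" and smo: "\<And>v w. smooth_on J (\<lambda>y. g y v w)"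
  shows "riemannian_metric (euclidean_open_manifold J) (coordinate_metric g)"
proof -
  interpret J: manifold_chart "euclidean_open_manifold J" J id by (rule manifold_chart_euclidean_open[OF J])
  have top: "topspace (mtop (euclidean_open_manifold J)) = J" by (simp add: euclidean_open_manifold_def)
  have gm: "coordinate_metric g y v w = g y (J.components v) (J.components w)" for y v w
    by (simp add: coordinate_metric_def flat_deriv_id[OF J.manifold_chart_axioms])
  have "g y (J.components u) (J.components v) = g y (J.components v) (J.components u) \<and>
      g y (J.components (\<lambda>f. a * u f + b * v f)) (J.components w) = a * g y (J.components u) (J.components w) + b * g y (J.components v) (J.components w)"
    if "y \<in> J" for y u v w a b
    by (intro conjI sym that) (simp add: J.components_linear bilinear_ladd[OF bil[OF that]] bilinear_lmul[OF bil[OF that]])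
  moreover have "g y (J.components v) (J.components v) > 0"
    if y: "y \<in> J" and v: "v \<in> tangent_space (euclidean_open_manifold J) y" "v \<noteq> (\<lambda>f. 0)" for y v
  proof (rule pos[OF y])
    show "J.components v \<noteq> 0" using J.coord_components[OF y v(1)] v(2) J.coord_zero[OF y] by metis
  qed
  moreover have "smooth_fun_on (euclidean_open_manifold J) W (\<lambda>p. g p (J.components (X p)) (J.components (Y p)))"
    if W: "openin (mtop (euclidean_open_manifold J)) W" and X: "vector_field_on (euclidean_open_manifold J) W X"
      and Y: "vector_field_on (euclidean_open_manifold J) W Y" for W X Y
  proof -
    have WJ: "W \<subseteq> J" using openin_subset[OF W] top by simp
    have op: "open W" using J.open_image_sub[OF W WJ] by simp
    have sX: "smooth_on W (J.rep X)" and sY: "smooth_on W (J.rep Y)"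
      using J.smooth_rep[OF W WJ X] J.smooth_rep[OF W WJ Y] by simp_all
    have lin: "linear (g p v)" "linear (\<lambda>v. g p v w)" if "p \<in> W" for p v w
      using bil[of p] that WJ by (auto simp: bilinear_def)
    have "smooth_on W (\<lambda>p. g p (J.rep X p) (J.rep Y p))"
      by (rule smooth_on_linear_field[OF op lin(1) smooth_on_linear_field[OF op lin(2) smooth_on_subset[OF smo WJ] sX] sY])
    then have "smooth_on W (\<lambda>u. g (J.\<psi> u) (J.components (X (J.\<psi> u))) (J.components (Y (J.\<psi> u))))"
      by (rule smooth_on_cong[OF _ op]) (use WJ in \<open>auto simp: J.rep_def inv_into_id subset_iff\<close>)
    then show ?thesis by (intro J.smooth_fun_on_chartI[OF W WJ]) simp
  qed
  ultimately show ?thesis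
    unfolding riemannian_metric_def positive_definite_metric_def top gm by blast
qed

section \<open>The local isometry and the passage to a chart\<close>

context manifold_chart begin

text \<open>In each chart of M the map and its inverse are \<Psi> and \<Phi> composed with a
  transition map.\<close>

lemma diffeomorphism_chart:
  fixes A :: "'b::euclidean_space set" and \<Psi> :: "'b \<Rightarrow> 'a"
  assumes A: "open A" and \<Psi>: "smooth_on A \<Psi>" "\<Psi> ` A \<subseteq> \<phi> ` U" "open (\<Psi> ` A)"
    and \<Phi>: "smooth_on (\<Psi> ` A) \<Phi>" "\<And>z. z \<in> A \<Longrightarrow> \<Phi> (\<Psi> z) = z"
  shows "diffeomorphism (euclidean_open_manifold A) (open_submanifold M (\<psi> ` \<Psi> ` A)) (\<lambda>z. \<psi> (\<Psi> z))"
proof -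
  let ?W = "\<psi> ` \<Psi> ` A" and ?F = "\<lambda>z. \<psi> (\<Psi> z)" and ?G = "\<lambda>p. \<Phi> (\<phi> p)"
  have W: "openin (mtop M) ?W" by (rule open_inv_image[OF \<Psi>(3,2)])
  have WU: "?W \<subseteq> U" using \<Psi>(2) inv_in by auto
  have \<phi>F: "\<phi> (?F z) = \<Psi> z" if "z \<in> A" for z using \<Psi>(2) that by (intro inv_right) auto
  have GF: "?G (?F z) = z" if "z \<in> A" for z using \<phi>F \<Phi>(2) that by simp
  have FG: "?F (?G p) = p" "?G p \<in> A" "\<phi> p \<in> \<Psi> ` A" if p: "p \<in> ?W" for p
  proof -
    obtain z where z: "z \<in> A" "p = ?F z" using p by auto
    then show "?F (?G p) = p" "?G p \<in> A" "\<phi> p \<in> \<Psi> ` A" using GF[OF z(1)] \<phi>F[OF z(1)] by auto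
  qed
  have contF: "continuous_map (top_of_set A) (mtop M) ?F"
  proof -
    have "{z \<in> A. ?F z \<in> V} = A \<inter> \<Psi> -` (\<phi> ` (U \<inter> V))" if V: "openin (mtop M) V" for V
    proof
      show "{z \<in> A. ?F z \<in> V} \<subseteq> A \<inter> \<Psi> -` (\<phi> ` (U \<inter> V))"
      proof
        fix z assume "z \<in> {z \<in> A. ?F z \<in> V}"
        then have z: "z \<in> A" "?F z \<in> V" "?F z \<in> U" using WU by auto
        then show "z \<in> A \<inter> \<Psi> -` (\<phi> ` (U \<inter> V))" using \<phi>F[OF z(1)] by (metis IntI imageI vimageI)
      qed
      show "A \<inter> \<Psi> -` (\<phi> ` (U \<inter> V)) \<subseteq> {z \<in> A. ?F z \<in> V}" by auto
    qed
    then have "openin (top_of_set A) {z \<in> A. ?F z \<in> V}" if "openin (mtop M) V" for V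
      using that continuous_open_preimage[OF smooth_on_continuous[OF \<Psi>(1)] A open_image_subset[OF that]] A
      by (simp add: openin_open_eq)
    then show ?thesis
      using WU U_subset by (fastforce simp: continuous_map_def)
  qed
  have contG: "continuous_map (subtopology (mtop M) ?W) (top_of_set A) ?G"
  proof -
    have "continuous_map (subtopology (mtop M) U) euclidean \<phi>"
      using homeomorphic_imp_continuous_map[OF homeo] by (simp add: continuous_map_in_subtopology)
    then have "continuous_map (subtopology (mtop M) ?W) euclidean \<phi>"
      by (rule continuous_map_from_subtopology_mono[OF _ WU])
    then have "continuous_map (subtopology (mtop M) ?W) (top_of_set (\<Psi> ` A)) \<phi>"
      using FG(3) by (auto simp: continuous_map_in_subtopology topspace_subtopology)
    moreover have "continuous_map (top_of_set (\<Psi> ` A)) euclidean \<Phi>"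
      using smooth_on_continuous[OF \<Phi>(1)] by simp
    ultimately have "continuous_map (subtopology (mtop M) ?W) euclidean (\<Phi> \<circ> \<phi>)"
      by (rule continuous_map_compose)
    then show ?thesis using FG(2) by (auto simp: continuous_map_in_subtopology topspace_subtopology o_def)
  qed
  have smF: "smooth_map (euclidean_open_manifold A) (open_submanifold M ?W) ?F"
    unfolding smooth_map_def
  proof (intro conjI)
    show "continuous_map (mtop (euclidean_open_manifold A)) (mtop (open_submanifold M ?W)) ?F"
      using contF by (auto simp: euclidean_open_manifold_def open_submanifold_def continuous_map_in_subtopology)
    have "smooth_on (A \<inter> ?F -` (V \<inter> ?W)) (\<kappa> \<circ> ?F \<circ> inv_into A id)" if V: "(V, \<kappa>) \<in> charts M" for V \<kappa>
    proof -
      interpret V: manifold_chart M V \<kappa> by standard (use manifold V in auto)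
      let ?S = "A \<inter> ?F -` (V \<inter> ?W)"
      have S: "open ?S"
      proof -
        have "openin (top_of_set A) {z \<in> topspace (top_of_set A). ?F z \<in> V \<inter> ?W}"
          by (rule openin_continuous_map_preimage[OF contF]) (use V.open_chart W in auto)
        moreover have "{z \<in> topspace (top_of_set A). ?F z \<in> V \<inter> ?W} = ?S" by auto
        ultimately show ?thesis using A by (simp add: openin_open_eq)
      qed
      have "smooth_on ?S (\<lambda>z. \<kappa> (\<psi> (\<Psi> z)))"
      proof (rule smooth_on_compose[OF S open_image_subset[OF V.open_chart] _ smooth_on_subset[OF \<Psi>(1)] transition(2)[OF V]])
        show "\<Psi> ` ?S \<subseteq> \<phi> ` (U \<inter> V)"
        proof clarify
          fix z assume z: "z \<in> A" "?F z \<in> V"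
          then have "?F z \<in> U" using WU by auto
          then show "\<Psi> z \<in> \<phi> ` (U \<inter> V)" using \<phi>F[OF z(1)] z(2) by (metis IntI imageI)
        qed
      qed auto
      then show ?thesis by (rule smooth_on_cong[OF _ S]) (auto simp: inv_into_id)
    qed
    then show "\<forall>(U', \<phi>')\<in>charts (euclidean_open_manifold A). \<forall>(V, \<kappa>)\<in>charts (open_submanifold M ?W).
        smooth_on (\<phi>' ` (U' \<inter> ?F -` V)) (\<kappa> \<circ> ?F \<circ> inv_into U' \<phi>')"
      by (auto simp: euclidean_open_manifold_def open_submanifold_def)
  qed
  have smG: "smooth_map (open_submanifold M ?W) (euclidean_open_manifold A) ?G"
    unfolding smooth_map_def
  proof (intro conjI)
    show "continuous_map (mtop (open_submanifold M ?W)) (mtop (euclidean_open_manifold A)) ?G"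
      using contG by (simp add: euclidean_open_manifold_def open_submanifold_def)
    have "smooth_on (\<kappa> ` (V \<inter> ?W \<inter> ?G -` A)) (id \<circ> ?G \<circ> inv_into (V \<inter> ?W) \<kappa>)" if V: "(V, \<kappa>) \<in> charts M" for V \<kappa>
    proof -
      interpret V: manifold_chart M V \<kappa> by standard (use manifold V in auto)
      have eq: "V \<inter> ?W \<inter> ?G -` A = V \<inter> ?W" using FG(2) by auto
      have S: "open (\<kappa> ` (V \<inter> ?W))" by (rule V.open_image_subset[OF W])
      have "smooth_on (\<kappa> ` (V \<inter> ?W)) (\<lambda>u. \<Phi> (\<phi> (V.\<psi> u)))"
      proof (rule smooth_on_compose[OF S \<Psi>(3) _ smooth_on_subset[OF transition(1)[OF V]] \<Phi>(1)])
        show "(\<lambda>u. \<phi> (V.\<psi> u)) ` \<kappa> ` (V \<inter> ?W) \<subseteq> \<Psi> ` A" using FG(3) by auto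
        show "\<kappa> ` (V \<inter> ?W) \<subseteq> \<kappa> ` (V \<inter> U)" using WU by auto
      qed
      then show ?thesis unfolding eq
        by (rule smooth_on_cong[OF _ S]) (simp add: inv_into_Int[OF V.inj])
    qed
    then show "\<forall>(U', \<phi>')\<in>charts (open_submanifold M ?W). \<forall>(V, \<kappa>)\<in>charts (euclidean_open_manifold A).
        smooth_on (\<phi>' ` (U' \<inter> ?G -` V)) (\<kappa> \<circ> ?G \<circ> inv_into U' \<phi>')"
      by (auto simp: euclidean_open_manifold_def open_submanifold_def)
  qed
  show ?thesis
    unfolding diffeomorphism_def
    using smF smG GF FG(1)
    by (auto simp: euclidean_open_manifold_def open_submanifold_def topspace_subtopology intro!: exI[of _ ?G])
qed

text \<open>On the coordinate vector with coefficients a, the three maps F, \<open>fst\<close> and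
  \<open>snd\<close> give \<open>D \<Psi> z a\<close>, \<open>fst a\<close> and
  \<open>snd a\<close>, which turns the isometry condition into the hypothesis h.\<close>

lemma isometry_chart:
  fixes I :: "real set" and J :: "'b::euclidean_space set"
  assumes IJ: "open I" "open J" and \<Psi>: "smooth_on (I \<times> J) \<Psi>" "\<Psi> ` (I \<times> J) \<subseteq> \<phi> ` U" "open (\<Psi> ` (I \<times> J))"
    and \<Phi>: "smooth_on (\<Psi> ` (I \<times> J)) \<Phi>" "\<And>z. z \<in> I \<times> J \<Longrightarrow> \<Phi> (\<Psi> z) = z"
    and h: "\<And>z v w. z \<in> I \<times> J \<Longrightarrow> metric_chart h (\<Psi> z) (D \<Psi> z v) (D \<Psi> z w) =
      fst v * fst w + (\<rho> (fst z))\<^sup>2 * g (snd z) (snd v) (snd w)"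
  shows "isometry (product_manifold (euclidean_open_manifold I) (euclidean_open_manifold J))
    (warped_metric (euclidean_open_manifold J) (coordinate_metric g) \<rho>)
    (open_submanifold M (\<psi> ` \<Psi> ` (I \<times> J))) h (\<lambda>z. \<psi> (\<Psi> z))"
  unfolding isometry_def product_euclidean_open_manifold
proof (intro conjI ballI)
  let ?A = "I \<times> J" and ?W = "\<psi> ` \<Psi> ` (I \<times> J)" and ?F = "\<lambda>z. \<psi> (\<Psi> z)"
  have A: "open ?A" using IJ by (rule open_Times)
  show "diffeomorphism (euclidean_open_manifold ?A) (open_submanifold M ?W) ?F"
    by (rule diffeomorphism_chart[OF A \<Psi> \<Phi>])
  interpret P: manifold_chart "euclidean_open_manifold ?A" ?A id by (rule manifold_chart_euclidean_open[OF A])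
  interpret J: manifold_chart "euclidean_open_manifold J" J id by (rule manifold_chart_euclidean_open[OF IJ(2)])
  fix z v w assume "z \<in> topspace (mtop (euclidean_open_manifold ?A))"
    and v: "v \<in> tangent_space (euclidean_open_manifold ?A) z" and w: "w \<in> tangent_space (euclidean_open_manifold ?A) z"
  then have z: "z \<in> ?A" by (simp add: euclidean_open_manifold_def)
  obtain v' where v': "v = P.coord z v'" using v P.tangent_space_coord[OF z] by auto
  obtain w' where w': "w = P.coord z w'" using w P.tangent_space_coord[OF z] by auto
  have W: "openin (mtop M) ?W" by (rule open_inv_image[OF \<Psi>(3,2)])
  have inU: "?F y \<in> U" "\<phi> (?F y) = \<Psi> y" if "y \<in> ?A" for y
    using \<Psi>(2) that by (auto intro!: inv_in inv_right)
  have FW: "?F z \<in> ?W" using z by auto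
  have pF: "pushforward (open_submanifold M ?W) ?F z (P.coord z a) = coord (?F z) (D \<Psi> z a)" for a
  proof -
    have sm: "smooth_on ?A (\<lambda>y. \<phi> (?F y))"
      by (rule smooth_on_cong[OF \<Psi>(1) A]) (simp add: inU)
    have "pushforward M ?F z (P.coord z a) = coord (?F z) (D (\<lambda>y. \<phi> (?F y)) z a)"
      by (rule pushforward_coord[OF P.manifold_chart_axioms manifold_chart_axioms A z sm inU(1)])
    also have "D (\<lambda>y. \<phi> (?F y)) z a = D \<Psi> z a"
      by (rule fun_cong[OF D_cong[OF A z]]) (simp add: inU)
    finally show ?thesis by (simp only: pushforward_open_submanifold[where F = ?F and p = z, OF manifold W FW])
  qed
  have pfst: "P.coord z a fst = fst a" for a
  proof -
    have op: "openin (mtop (euclidean_open_manifold ?A)) ?A" by (rule P.open_chart)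
    have sm: "smooth_on ?A fst" using smooth_on_linear[OF bounded_linear_fst A smooth_on_id[OF A]] .
    have "smooth_fun_on (euclidean_open_manifold ?A) ?A fst"
      by (rule P.smooth_fun_on_chartI[OF op subset_refl])
        (use smooth_on_cong[OF sm A] in \<open>auto simp: inv_into_id\<close>)
    from P.coord_apply[OF op this z] have "P.coord z a fst = D (\<lambda>y. fst (P.\<psi> y)) z a" by simp
    also have "\<dots> = D fst z a" by (rule fun_cong[OF D_cong[OF A z]]) (simp add: inv_into_id)
    also have "\<dots> = fst a" by (simp add: D_eqI[OF bounded_linear_imp_has_derivative[OF bounded_linear_fst]])
    finally show ?thesis .
  qed
  have psnd: "flat_deriv (pushforward (euclidean_open_manifold J) snd z (P.coord z a)) (\<lambda>z. z) = snd a" for a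
  proof -
    have sm: "smooth_on ?A (\<lambda>y. id (snd y))" using smooth_on_linear[OF bounded_linear_snd A smooth_on_id[OF A]] by simp
    have "pushforward (euclidean_open_manifold J) snd z (P.coord z a) = J.coord (snd z) (D (\<lambda>y. id (snd y)) z a)"
      by (rule pushforward_coord[OF P.manifold_chart_axioms J.manifold_chart_axioms A z sm]) auto
    moreover have "D (\<lambda>y. id (snd y)) z a = snd a"
      by (simp add: D_eqI[OF bounded_linear_imp_has_derivative[OF bounded_linear_snd]])
    moreover have "snd z \<in> J" using z by auto
    ultimately show ?thesis by (simp add: flat_deriv_id[OF J.manifold_chart_axioms] J.components_coord)
  qed
  have "h (?F z) (coord (?F z) (D \<Psi> z v')) (coord (?F z) (D \<Psi> z w')) =
      fst v' * fst w' + (\<rho> (fst z))\<^sup>2 * g (snd z) (snd v') (snd w')"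
    using h[OF z] by (simp add: metric_chart_def)
  then show "h (?F z) (pushforward (open_submanifold M ?W) ?F z v) (pushforward (open_submanifold M ?W) ?F z w) =
      warped_metric (euclidean_open_manifold J) (coordinate_metric g) \<rho> z v w"
    by (simp only: v' w' pF warped_metric_def pfst coordinate_metric_def psnd)
qed


lemma vector_field_on_subset:
  "vector_field_on M W X \<Longrightarrow> W' \<subseteq> W \<Longrightarrow> vector_field_on M W' X"
  by (auto simp: vector_field_on_def)

text \<open>Transfers the hypotheses on M to one chart. They speak of local vector fields, so each
  statement about a single vector requires a field that extends it and meets the same side
  condition.\<close>

lemma centroaffine_chart:
  fixes x :: "'m \<Rightarrow> 'e::euclidean_space" and h :: "'m metric_tensor" and T :: "'m vfield" and \<alpha> \<beta> :: "'m \<Rightarrow> real"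
  assumes dim: "DIM('a) \<ge> 3"
    and hyp: "centroaffine_hypersurface M x" and \<epsilon>: "\<epsilon> \<noteq> 0" and gauss: "centroaffine_gauss M x \<epsilon> nabla h"
    and convex: "positive_definite_metric M h" and lc: "levi_civita M h lc"
    and tcheb: "tchebychev_field M h (difference_tensor nabla lc) T"
    and T_nz: "\<And>p. p \<in> U \<Longrightarrow> T p \<noteq> (\<lambda>f. 0)"
    and smooth_\<alpha>: "smooth_fun_on M (topspace (mtop M)) \<alpha>"
    and K_T_perp: "\<And>Y p. vector_field_on M U Y \<Longrightarrow> \<forall>p\<in>U. h p (Y p) (T p) = 0 \<Longrightarrow> p \<in> U \<Longrightarrow>
      difference_tensor nabla lc T Y p = (\<lambda>f. \<alpha> p * Y p f) \<and> Y p \<alpha> = 0"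
    and K_T_T: "\<And>p. p \<in> U \<Longrightarrow> difference_tensor nabla lc T T p = (\<lambda>f. 2 * \<alpha> p * T p f)"
  shows "centroaffine_chart (\<phi> ` U) (\<lambda>u. x (\<psi> u)) \<epsilon> (metric_chart h) (christoffel nabla) (christoffel lc)
    (rep T) (\<lambda>u. \<alpha> (\<psi> u))"
proof
  have aff: "affine_connection M lc" using lc by (simp add: levi_civita_def)
  let ?h = "metric_chart h" and ?T = "rep T"
  note bil = bilinear_gauss[OF hyp gauss \<epsilon>] and smo = smooth_gauss[OF hyp gauss \<epsilon>]
  have TM: "vector_field_on M (topspace (mtop M)) T" using tcheb by (simp add: tchebychev_field_def)
  have TU: "vector_field_on M U T" by (rule vector_field_on_subset[OF TM U_subset])
  have Tp: "T p = coord p (?T (\<phi> p))" if "p \<in> U" for p by (rule field_rep[OF TU that that])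
  have smT: "smooth_on (\<phi> ` U) ?T" by (rule smooth_rep[OF open_chart subset_refl TU])
  have hp: "h p (coord p v) (coord p w) = ?h (\<phi> p) v w" if "p \<in> U" for p v w
    using that by (simp add: metric_chart_def)
  show "open (\<phi> ` U)" by (rule open_image)
  show "3 \<le> DIM('a)" by (rule dim)
  show "\<epsilon> \<noteq> 0" by (rule \<epsilon>)
  show "smooth_on (\<phi> ` U) (\<lambda>u. x (\<psi> u))" by (rule smooth_x_chart[OF hyp gauss \<epsilon>])
  show "smooth_on (\<phi> ` U) (\<lambda>y. ?h y v w)" for v w by (rule smo(2))
  show "smooth_on (\<phi> ` U) (\<lambda>y. christoffel nabla y v w)" for v w by (rule smo(1))
  show "smooth_on (\<phi> ` U) (\<lambda>y. christoffel lc y v w)" for v w by (rule smooth_christoffel[OF aff])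
  show "smooth_on (\<phi> ` U) ?T" by (rule smT)
  show smA: "smooth_on (\<phi> ` U) (\<lambda>u. \<alpha> (\<psi> u))"
    using smooth_fun_on_chartD[OF smooth_\<alpha>] U_subset by (simp add: Int_absorb2)
  show bilh: "bilinear (?h u)" if "u \<in> \<phi> ` U" for u by (rule bil(2)[OF that])
  show "bilinear (christoffel nabla u)" if "u \<in> \<phi> ` U" for u by (rule bil(1)[OF that])
  show "bilinear (christoffel lc u)" if "u \<in> \<phi> ` U" for u by (rule bilinear_christoffel[OF aff that])
  show pos: "?h u v v > 0" if u: "u \<in> \<phi> ` U" and v: "v \<noteq> 0" for u v
  proof -
    have p: "\<psi> u \<in> U" "\<psi> u \<in> topspace (mtop M)" using inv_in[OF u] U_subset by auto
    show ?thesis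
      using convex p v tangent_space_coord[OF p(1)] coord_eq_zero[OF p(1), of v]
      unfolding positive_definite_metric_def metric_chart_def by blast
  qed
  show "v = 0 \<and> s = 0" if "u \<in> \<phi> ` U" "D (\<lambda>u. x (\<psi> u)) u v = s *\<^sub>R x (\<psi> u)" for u v s
    by (rule transversal_chart[OF hyp gauss \<epsilon> that])
  show "D (\<lambda>y. D (\<lambda>u. x (\<psi> u)) y v) u w =
      D (\<lambda>u. x (\<psi> u)) u (christoffel nabla u w v) - (\<epsilon> * ?h u w v) *\<^sub>R x (\<psi> u)" if "u \<in> \<phi> ` U" for u v w
    by (rule gauss_chart[OF hyp gauss \<epsilon> that])
  show "christoffel lc u v w = christoffel lc u w v" if "u \<in> \<phi> ` U" for u v w
    by (rule christoffel_symmetric[OF lc that])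
  show "D (\<lambda>y. ?h y v w) u z = ?h u (christoffel lc u z v) w + ?h u v (christoffel lc u z w)"
    if "u \<in> \<phi> ` U" for u v w z by (rule metric_compatible[OF lc that smo(2)])
  show Tnz: "?T u \<noteq> 0" if u: "u \<in> \<phi> ` U" for u
  proof
    assume "?T u = 0"
    then have "T (\<psi> u) = (\<lambda>f. 0)" using Tp[OF inv_in[OF u]] by (simp add: inv_right[OF u] coord_zero inv_in[OF u])
    then show False using T_nz[OF inv_in[OF u]] by simp
  qed
  have diff: "difference_tensor nabla lc Y Z p =
      coord p (christoffel nabla (\<phi> p) (rep Y (\<phi> p)) (rep Z (\<phi> p)) - christoffel lc (\<phi> p) (rep Y (\<phi> p)) (rep Z (\<phi> p)))"
    if "vector_field_on M U Y" "vector_field_on M U Z" "p \<in> U" for Y Z p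
    by (rule difference_tensor_chart[OF hyp gauss \<epsilon> lc open_chart subset_refl that])
  have coord_inject: "v = w" if "coord p v = coord p w" "p \<in> U" for p v w
    using that components_coord by metis
  have sym: "?h u v w = ?h u w v" if u: "u \<in> \<phi> ` U" for u v w
  proof -
    have "D (\<lambda>y. D (\<lambda>u. x (\<psi> u)) y v) u w = D (\<lambda>y. D (\<lambda>u. x (\<psi> u)) y w) u v"
      by (rule D_commute[OF open_image u smooth_x_chart[OF hyp gauss \<epsilon>]])
    then have "\<epsilon> * ?h u w v = \<epsilon> * ?h u v w"
      by (intro frame_inj(2)[OF hyp gauss \<epsilon> u]) (simp only: gauss_chart[OF hyp gauss \<epsilon> u])
    then show ?thesis using \<epsilon> by simp
  qed
  show "christoffel nabla u (?T u) (?T u) - christoffel lc u (?T u) (?T u) = (2 * \<alpha> (\<psi> u)) *\<^sub>R ?T u"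
    if u: "u \<in> \<phi> ` U" for u
  proof (rule coord_inject[OF _ inv_in[OF u]])
    show "coord (\<psi> u) (christoffel nabla u (?T u) (?T u) - christoffel lc u (?T u) (?T u)) =
        coord (\<psi> u) ((2 * \<alpha> (\<psi> u)) *\<^sub>R ?T u)"
      using diff[OF TU TU inv_in[OF u]] K_T_T[OF inv_in[OF u]] Tp[OF inv_in[OF u]]
      by (simp add: inv_right[OF u] coord_scale[OF inv_in[OF u]])
  qed
  show "christoffel nabla u (?T u) v - christoffel lc u (?T u) v = \<alpha> (\<psi> u) *\<^sub>R v \<and> D (\<lambda>u. \<alpha> (\<psi> u)) u v = 0"
    if u: "u \<in> \<phi> ` U" and perp: "?h u v (?T u) = 0" for u v
  proof -
    note p = inv_in[OF u]
    have lin: "linear (?h y w)" "linear (\<lambda>w'. ?h y w' w)" if "y \<in> \<phi> ` U" for y w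
      using bilh[OF that] by (auto simp: bilinear_def)
    \<comment> \<open>The constant field v is projected onto the complement of T to obtain a field
      orthogonal to T on all of U; at u the projection leaves v unchanged.\<close>
    define r where "r y = ?h y v (?T y) / ?h y (?T y) (?T y)" for y
    define Z where "Z y = v - r y *\<^sub>R ?T y" for y
    have TT: "?h y (?T y) (?T y) \<noteq> 0" if "y \<in> \<phi> ` U" for y using pos[OF that Tnz[OF that]] by simp
    have smvT: "smooth_on (\<phi> ` U) (\<lambda>y. ?h y v (?T y))"
      by (rule smooth_on_linear_field[OF open_image lin(1) smo(2) smT])
    have smTT: "smooth_on (\<phi> ` U) (\<lambda>y. ?h y (?T y) (?T y))"
      by (rule smooth_on_linear_field[OF open_image lin(1) smooth_on_linear_field[OF open_image lin(2) smo(2) smT] smT])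
    have smZ: "smooth_on (\<phi> ` U) Z"
      unfolding Z_def[abs_def] r_def
      by (intro smooth_on_diff smooth_on_scaleR smooth_on_divide open_image smooth_on_const smvT smTT smT TT)
    have Zf: "vector_field_on M U (field Z)" by (rule vector_field_on_field[OF open_chart subset_refl smZ])
    have Zu: "Z u = v" by (simp add: Z_def r_def perp)
    have Zperp: "h p (field Z p) (T p) = 0" if p: "p \<in> U" for p
    proof -
      have y: "\<phi> p \<in> \<phi> ` U" using p by simp
      have "?h (\<phi> p) (Z (\<phi> p)) (?T (\<phi> p)) = 0"
        using TT[OF y] by (simp add: Z_def r_def bilinear_lsub[OF bilh[OF y]] bilinear_lmul[OF bilh[OF y]])
      then show ?thesis by (simp add: Tp[OF p] field_def hp[OF p])
    qed
    have K: "difference_tensor nabla lc T (field Z) (\<psi> u) = (\<lambda>f. \<alpha> (\<psi> u) * field Z (\<psi> u) f)" and Z\<alpha>: "field Z (\<psi> u) \<alpha> = 0"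
      using K_T_perp[OF Zf _ p] Zperp by auto
    have "coord (\<psi> u) (christoffel nabla u (?T u) v - christoffel lc u (?T u) v) = coord (\<psi> u) (\<alpha> (\<psi> u) *\<^sub>R v)"
      using diff[OF TU Zf p] K by (simp add: inv_right[OF u] rep_field[OF u] Zu field_def coord_scale[OF p])
    then have 1: "christoffel nabla u (?T u) v - christoffel lc u (?T u) v = \<alpha> (\<psi> u) *\<^sub>R v"
      by (rule coord_inject[OF _ p])
    have "coord (\<psi> u) v \<alpha> = D (\<lambda>u. \<alpha> (\<psi> u)) (\<phi> (\<psi> u)) v"
      by (rule coord_apply[OF openin_topspace smooth_\<alpha>]) (use p U_subset in auto)
    then show ?thesis using 1 Z\<alpha> by (simp add: field_def inv_right[OF u] Zu)
  qed
  show "\<exists>e. (\<forall>i<DIM('a). \<forall>j<DIM('a). ?h u (e i) (e j) = (if i = j then 1 else 0)) \<and>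
      real DIM('a) *\<^sub>R ?T u = (\<Sum>i<DIM('a). christoffel nabla u (e i) (e i) - christoffel lc u (e i) (e i))"
    if u: "u \<in> \<phi> ` U" for u
  proof -
    \<comment> \<open>\<open>tchebychev_field\<close> expresses T by smooth orthonormal frames on
      open sets, so a frame on the whole chart is built rather than a basis at u.\<close>
    obtain E where E: "\<And>i. i < DIM('a) \<Longrightarrow> smooth_on (\<phi> ` U) (E i)"
      "\<And>u i j. u \<in> \<phi> ` U \<Longrightarrow> i < DIM('a) \<Longrightarrow> j < DIM('a) \<Longrightarrow> ?h u (E i u) (E j u) = (if i = j then 1 else 0)"
      using smooth_orthonormal_frame[OF open_image bilh sym pos smo(2)] by metis
    note p = inv_in[OF u]
    define e where "e i = field (E i)" for i
    have ef: "vector_field_on M U (e i)" if "i < DIM('a)" for i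
      unfolding e_def by (rule vector_field_on_field[OF open_chart subset_refl E(1)[OF that]])
    have "orthonormal_frame_on M h U e"
      unfolding orthonormal_frame_on_def using ef E(2) by (auto simp: e_def field_def hp)
    then have T: "T (\<psi> u) = (\<lambda>f. (\<Sum>i<DIM('a). difference_tensor nabla lc (e i) (e i) (\<psi> u) f) / real DIM('a))"
      using tcheb open_chart p unfolding tchebychev_field_def by blast
    let ?K = "\<lambda>i. christoffel nabla u (E i u) (E i u) - christoffel lc u (E i u) (E i u)"
    have K: "difference_tensor nabla lc (e i) (e i) (\<psi> u) = coord (\<psi> u) (?K i)" if "i < DIM('a)" for i
      using diff[OF ef[OF that] ef[OF that] p] by (simp add: inv_right[OF u] e_def rep_field[OF u])
    have "T (\<psi> u) = coord (\<psi> u) ((1 / real DIM('a)) *\<^sub>R (\<Sum>i<DIM('a). ?K i))"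
      unfolding T using K by (simp add: fun_eq_iff coord_scale[OF p] linear_sum[OF linear_coord[OF p]])
    then have "coord (\<psi> u) (?T u) = coord (\<psi> u) ((1 / real DIM('a)) *\<^sub>R (\<Sum>i<DIM('a). ?K i))"
      using Tp[OF p] by (simp only: inv_right[OF u])
    then have "?T u = (1 / real DIM('a)) *\<^sub>R (\<Sum>i<DIM('a). ?K i)" by (rule coord_inject[OF _ p])
    then have "real DIM('a) *\<^sub>R ?T u = (\<Sum>i<DIM('a). ?K i)" by simp
    then show ?thesis using E(2)[OF u] by (intro exI[of _ "\<lambda>i. E i u"]) simp
  qed
qed

end

theorem proposition3p3:
  fixes M :: "('m, real ^ 'n) manifold"
    and x :: "'m \<Rightarrow> real ^ 'q"
    and \<epsilon> :: real
    and nabla lc K :: "'m connection_op"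
    and h :: "'m metric_tensor"
    and T :: "'m vfield"
    and \<alpha> \<beta> :: "'m \<Rightarrow> real"
  assumes dim_M: "CARD('n) \<ge> 3"
    and dim_ambient: "CARD('q) = CARD('n) + 1"
    and dim_N: "CARD('k) = CARD('n) - 1"
    and manifold: "smooth_manifold M"
    and hypersurface: "centroaffine_hypersurface M x"
    and sign: "\<epsilon> \<in> {1, -1}"
    and gauss: "centroaffine_gauss M x \<epsilon> nabla h"
    and convex: "positive_definite_metric M h"
    and levi_civita: "levi_civita M h lc"
    and K_def: "K = difference_tensor nabla lc"
    and tchebychev: "tchebychev_field M h K T"
    and T_nonzero: "\<forall>p\<in>topspace (mtop M). T p \<noteq> (\<lambda>f. 0)"
    and smooth_\<alpha>: "smooth_fun_on M (topspace (mtop M)) \<alpha>"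
    and smooth_\<beta>: "smooth_fun_on M (topspace (mtop M)) \<beta>"
    and K_T_perp: "\<forall>W X. openin (mtop M) W \<and> vector_field_on M W X \<and>
          (\<forall>p\<in>W. h p (X p) (T p) = 0) \<longrightarrow>
          (\<forall>p\<in>W. K T X p = (\<lambda>f. \<alpha> p * X p f) \<and> X p \<alpha> = 0)"
    and K_T_T: "\<forall>p\<in>topspace (mtop M). K T T p = (\<lambda>f. \<beta> p * T p f)"
    and \<beta>_eq: "\<forall>p\<in>topspace (mtop M). \<beta> p = 2 * \<alpha> p"
  shows "\<forall>p\<in>topspace (mtop M).
    \<exists>W (I :: real set) (\<rho> :: real \<Rightarrow> real)
      (N :: (real ^ 'k, real ^ 'k) manifold) (gN :: (real ^ 'k) metric_tensor) F.
      openin (mtop M) W \<and> p \<in> W \<and>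
      open I \<and> is_interval I \<and> smooth_on I \<rho> \<and> (\<forall>t\<in>I. \<rho> t > 0) \<and>
      smooth_manifold N \<and> riemannian_metric N gN \<and>
      isometry (product_manifold (euclidean_open_manifold I) N) (warped_metric N gN \<rho>)
        (open_submanifold M W) h F"
proof
  fix p assume p: "p \<in> topspace (mtop M)"
  then obtain U \<phi> where U: "(U, \<phi>) \<in> charts M" "p \<in> U" using manifold by (auto simp: smooth_manifold_def)
  interpret chart: manifold_chart M U \<phi> by standard (use manifold U in auto)
  have \<epsilon>: "\<epsilon> \<noteq> 0" using sign by auto
  have UM: "q \<in> topspace (mtop M)" if "q \<in> U" for q using chart.U_subset that by auto
  interpret core: centroaffine_chart "\<phi> ` U" "\<lambda>u. x (chart.\<psi> u)" \<epsilon> "chart.metric_chart h"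
    "chart.christoffel nabla" "chart.christoffel lc" "chart.rep T" "\<lambda>u. \<alpha> (chart.\<psi> u)"
  proof (rule chart.centroaffine_chart[OF _ hypersurface \<epsilon> gauss convex levi_civita])
    show "DIM(real ^ 'n) \<ge> 3" using dim_M by simp
    show "tchebychev_field M h (difference_tensor nabla lc) T" using tchebychev K_def by simp
    show "T q \<noteq> (\<lambda>f. 0)" if "q \<in> U" for q using T_nonzero UM[OF that] by simp
    show "difference_tensor nabla lc T Y q = (\<lambda>f. \<alpha> q * Y q f) \<and> Y q \<alpha> = 0"
      if "vector_field_on M U Y" "\<forall>p\<in>U. h p (Y p) (T p) = 0" "q \<in> U" for Y q
      using K_T_perp chart.open_chart that unfolding K_def by blast
    show "difference_tensor nabla lc T T q = (\<lambda>f. 2 * \<alpha> q * T q f)" if "q \<in> U" for q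
      using K_T_T \<beta>_eq UM[OF that] unfolding K_def by simp
  qed (rule smooth_\<alpha>)
  have dimb: "DIM(real ^ 'n) = DIM(real ^ 'k) + 1" and dimf: "DIM(real ^ 'q) = DIM(real ^ 'n) + 1"
    using dim_M dim_ambient dim_N by simp_all
  have \<phi>p: "\<phi> p \<in> \<phi> ` U" using U(2) by simp
  obtain I :: "real set" and J :: "(real ^ 'k) set" and \<rho> g \<Psi> \<Phi> where
    IJ: "open I" "is_interval I" "open J" and \<rho>: "smooth_on I \<rho>" "\<And>t. t \<in> I \<Longrightarrow> \<rho> t > 0"
    and \<Psi>: "smooth_on (I \<times> J) \<Psi>" "\<Psi> ` (I \<times> J) \<subseteq> \<phi> ` U" "open (\<Psi> ` (I \<times> J))" "\<phi> p \<in> \<Psi> ` (I \<times> J)"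
    and \<Phi>: "smooth_on (\<Psi> ` (I \<times> J)) \<Phi>" "\<And>z. z \<in> I \<times> J \<Longrightarrow> \<Phi> (\<Psi> z) = z"
    and h: "\<And>z v w. z \<in> I \<times> J \<Longrightarrow> chart.metric_chart h (\<Psi> z) (D \<Psi> z v) (D \<Psi> z w) =
      fst v * fst w + (\<rho> (fst z))\<^sup>2 * g (snd z) (snd v) (snd w)"
    and g: "\<And>y. y \<in> J \<Longrightarrow> bilinear (g y)" "\<And>y v w. y \<in> J \<Longrightarrow> g y v w = g y w v"
      "\<And>y v. y \<in> J \<Longrightarrow> v \<noteq> 0 \<Longrightarrow> g y v v > 0" "\<And>v w. smooth_on J (\<lambda>y. g y v w)"
    by (rule core.warped_product_coordinates[OF \<phi>p dimb dimf], rule that)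
  \<comment> \<open>The fibre N is the open set J with the metric built from g, and W is the part of
    M parametrised by the product of I and J.\<close>
  let ?W = "chart.\<psi> ` \<Psi> ` (I \<times> J)"
  have "openin (mtop M) ?W" by (rule chart.open_inv_image[OF \<Psi>(3,2)])
  moreover have "p \<in> ?W" using \<Psi>(4) chart.inv[OF U(2)] by (metis imageI)
  moreover have "smooth_manifold (euclidean_open_manifold J)" by (rule smooth_manifold_euclidean_open[OF IJ(3)])
  moreover have "riemannian_metric (euclidean_open_manifold J) (coordinate_metric g)"
    by (rule riemannian_coordinate_metric[OF IJ(3) g])
  moreover have "isometry (product_manifold (euclidean_open_manifold I) (euclidean_open_manifold J))
      (warped_metric (euclidean_open_manifold J) (coordinate_metric g) \<rho>)
      (open_submanifold M ?W) h (\<lambda>z. chart.\<psi> (\<Psi> z))"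
    by (rule chart.isometry_chart[OF IJ(1,3) \<Psi>(1-3) \<Phi> h])
  ultimately show "\<exists>W (I :: real set) (\<rho> :: real \<Rightarrow> real)
      (N :: (real ^ 'k, real ^ 'k) manifold) (gN :: (real ^ 'k) metric_tensor) F.
      openin (mtop M) W \<and> p \<in> W \<and>
      open I \<and> is_interval I \<and> smooth_on I \<rho> \<and> (\<forall>t\<in>I. \<rho> t > 0) \<and>
      smooth_manifold N \<and> riemannian_metric N gN \<and>
      isometry (product_manifold (euclidean_open_manifold I) N) (warped_metric N gN \<rho>)
        (open_submanifold M W) h F"
    using IJ(1,2) \<rho> by blast
qed

end
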